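(* Let $\varphi$ satisfy (BP) and suppose that $\widehat\varphi$ is continuous in a neighborhood of $\xi=0$. Let $(h_k)$ and $(\varepsilon_k)$ be scales such that $h_k/\varepsilon_k\to0$. Suppose that $(U^{h_k})$ is $h_k$-bounded and $M^{\varepsilon_k}[U^{h_k}]$ converges in $\mathcal{S}'(\mathbb{R}^d\times\mathbb{R}^d)$ to the Wigner measure $\mu$. Then $m^{\varepsilon_k}[T_\varphi^{h_k}U^{h_k}]$ converges in $\mathcal{S}'(\mathbb{R}^d\times\mathbb{R}^d)$ to a measure $\mu_\varphi$ given by $$\mu_\varphi(x,\xi)=|\widehat\varphi(0)|^2\mu(x,\xi).$$
   Context: A scale is a sequence of positive numbers tending to $0$. Fourier transform: $\widehat u(\xi)=\int_{\mathbb{R}^d}u(x)e^{-ix\cdot\xi}dx$; $\langle\xi\rangle=(1+|\xi|^2)^{1/2}$; $H^s(\mathbb{R}^d)$ is the Sobolev space of order $s\in\mathbb{R}$. (BP): there exist $s\in\mathbb{R}$ and $B>0$ such that $\varphi\in H^s(\mathbb{R}^d)$ and $\sum_{k\in\mathbb{Z}^d}|\langle\xi+2\pi k\rangle^s\widehat\varphi(\xi+2\pi k)|^2\le B$ for a.e. $\xi\in\mathbb{R}^d$. $L^2(h\mathbb{Z}^d)$: functions $U:\mathbb{Z}^d\to\mathbb{C}$ with $\|U\|_h^2=h^d\sum_n|U_n|^2<\infty$. $(U^{h_k})$ is $h_k$-bounded if $U^{h_k}\in L^2(h_k\mathbb{Z}^d)$ and $\|U^{h_k}\|_{h_k}\le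 C$ for all $k$. Reconstruction: $T_\varphi^hU(x)=\sum_{n\in\mathbb{Z}^d}U_n\varphi(x/h-n)$ (a bounded operator from $L^2(h\mathbb{Z}^d)$ to $H^s(\mathbb{R}^d)$ under (BP)). For $u\in\mathcal{S}'(\mathbb{R}^d)$: $m^\varepsilon[u](x,\xi)=(2\pi\varepsilon)^{-d}\,\overline{u(x)}\,\widehat u(\xi/\varepsilon)e^{ix\cdot\xi/\varepsilon}$. With $\widehat U(\xi)=\sum_nU_ne^{-in\cdot\xi}$, for $U\in L^2(h\mathbb{Z}^d)$, $$M^\varepsilon[U](x,\xi)=\frac{h^{2d}}{(2\pi\varepsilon)^d}\sum_{m\in\mathbb{Z}^d}\overline{U_m}\,\widehat U(h\xi/\varepsilon)e^{im\cdot(h/\varepsilon)\xi}\delta_{hm}(x).$$ Both are elements of $\mathcal{S}'(\mathbb{R}^d\times\mathbb{R}^d)$; Wigner measures are the positive Radon measures obtained as their (weak) limits in $\mathcal{S}'$. *)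

theory Defs
  imports "HOL-Analysis.Analysis"
begin

section \<open>Schwartz functions and tempered distributions\<close>

text \<open>\<open>partials [b\<^sub>1, \<dots>, b\<^sub>n] f\<close> is the iterated directional derivative of \<open>f\<close> along \<open>b\<^sub>n, \<dots>, b\<^sub>1\<close>;
  with all \<open>b\<^sub>i\<close> in \<open>Basis\<close> these are the partial derivatives of order \<open>n\<close>.\<close>

fun partials :: "'a::euclidean_space list \<Rightarrow> ('a \<Rightarrow> complex) \<Rightarrow> 'a \<Rightarrow> complex" where
  "partials [] f = f"
| "partials (b # bs) f = (\<lambda>x. frechet_derivative (partials bs f) (at x) b)"

definition smooth :: "('a::euclidean_space \<Rightarrow> complex) \<Rightarrow> bool" where
  "smooth f \<longleftrightarrow> (\<forall>bs. set bs \<subseteq> Basis \<longrightarrow> (\<forall>x. partials bs f differentiable at x))"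

definition schwartz :: "('a::euclidean_space \<Rightarrow> complex) set" where
  "schwartz = {f. smooth f \<and>
     (\<forall>bs N. set bs \<subseteq> Basis \<longrightarrow> bdd_above (range (\<lambda>x. (1 + norm x) ^ N * norm (partials bs f x))))}"

definition schwartz_seminorm :: "nat \<Rightarrow> ('a::euclidean_space \<Rightarrow> complex) \<Rightarrow> real" where
  "schwartz_seminorm N f = (\<Sum>bs | set bs \<subseteq> Basis \<and> length bs \<le> N.
     SUP x. (1 + norm x) ^ N * norm (partials bs f x))"

text \<open>A tempered distribution is a functional of which only the values on \<^term>\<open>schwartz\<close> matter.
  The seminorms increase with \<open>N\<close>, so a bound by one of them is continuity for the
  Frechet topology.\<close>

type_synonym 'a functional = "('a \<Rightarrow> complex) \<Rightarrow> complex"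

definition tempered_distribution :: "'a::euclidean_space functional \<Rightarrow> bool" where
  "tempered_distribution u \<longleftrightarrow>
     (\<forall>f\<in>schwartz. \<forall>g\<in>schwartz. u (\<lambda>x. f x + g x) = u f + u g) \<and>
     (\<forall>c. \<forall>f\<in>schwartz. u (\<lambda>x. c * f x) = c * u f) \<and>
     (\<exists>N C. \<forall>f\<in>schwartz. norm (u f) \<le> C * schwartz_seminorm N f)"

text \<open>The usual operations on distributions, by duality: \<open>td_cnj u\<close> is the complex conjugate of
  \<open>u\<close>, \<open>td_translate v u\<close> is \<open>u(x - v)\<close>, and \<open>td_dilate c u\<close> is \<open>u(x / c)\<close> for \<open>c > 0\<close>.\<close>

definition td_cnj :: "'a::euclidean_space functional \<Rightarrow> 'a functional" where
  "td_cnj u f = cnj (u (\<lambda>x. cnj (f x)))"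

definition td_translate :: "'a \<Rightarrow> 'a::euclidean_space functional \<Rightarrow> 'a functional" where
  "td_translate v u f = u (\<lambda>x. f (x + v))"

definition td_dilate :: "real \<Rightarrow> 'a::euclidean_space functional \<Rightarrow> 'a functional" where
  "td_dilate c u f = of_real (c ^ DIM('a)) * u (\<lambda>x. f (c *\<^sub>R x))"

definition fourier :: "('a::euclidean_space \<Rightarrow> complex) \<Rightarrow> 'a \<Rightarrow> complex" where
  "fourier f \<xi> = (LINT x|lborel. f x * cis (- (x \<bullet> \<xi>)))"

definition td_fourier :: "'a::euclidean_space functional \<Rightarrow> 'a functional" where
  "td_fourier u f = u (fourier f)"

text \<open>The Fourier transform of \<open>u\<close> is the function \<open>F\<close>, which is determined almost everywhere.\<close>

definition has_fourier_function :: "'a::euclidean_space functional \<Rightarrow> ('a \<Rightarrow> complex) \<Rightarrow> bool" where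
  "has_fourier_function u F \<longleftrightarrow> F \<in> borel_measurable borel \<and>
     (\<forall>f\<in>schwartz. integrable lborel (\<lambda>\<xi>. F \<xi> * f \<xi>) \<and>
        td_fourier u f = (LINT \<xi>|lborel. F \<xi> * f \<xi>))"


section \<open>Sobolev spaces and the condition (BP)\<close>

definition bracket :: "'a::euclidean_space \<Rightarrow> real" where
  "bracket \<xi> = (1 + (norm \<xi>)\<^sup>2) powr (1/2)"

definition sobolev_space :: "real \<Rightarrow> 'a::euclidean_space functional set" where
  "sobolev_space s = {u. tempered_distribution u \<and>
     (\<exists>F. has_fourier_function u F \<and>
        integrable lborel (\<lambda>\<xi>. (norm (of_real (bracket \<xi> powr s) * F \<xi>))\<^sup>2))}"

definition real_vec :: "int ^ 'd \<Rightarrow> real ^ 'd::finite" where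
  "real_vec n = (\<chi> i. real_of_int (n $ i))"

text \<open>The bound does not depend on the representative \<open>F\<close> of the Fourier transform of \<open>\<phi>\<close>; a
  representative exists because of \<open>\<phi> \<in> sobolev_space s\<close>.\<close>

definition BP :: "(real ^ 'd::finite) functional \<Rightarrow> bool" where
  "BP \<phi> \<longleftrightarrow> (\<exists>s B. 0 < B \<and> \<phi> \<in> sobolev_space s \<and>
     (\<forall>F. has_fourier_function \<phi> F \<longrightarrow>
       (AE \<xi> in lborel.
         (\<lambda>k::int^'d. (norm (of_real (bracket (\<xi> + (2 * pi) *\<^sub>R real_vec k) powr s)
             * F (\<xi> + (2 * pi) *\<^sub>R real_vec k)))\<^sup>2) summable_on UNIV \<and>
         (\<Sum>\<^sub>\<infinity>k::int^'d. (norm (of_real (bracket (\<xi> + (2 * pi) *\<^sub>R real_vec k) powr s)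
             * F (\<xi> + (2 * pi) *\<^sub>R real_vec k)))\<^sup>2) \<le> B)))"


section \<open>Grid functions and reconstruction\<close>

definition is_scale :: "(nat \<Rightarrow> real) \<Rightarrow> bool" where
  "is_scale h \<longleftrightarrow> (\<forall>k. 0 < h k) \<and> h \<longlonglongrightarrow> 0"

definition grid_L2 :: "(int ^ 'd::finite \<Rightarrow> complex) set" where
  "grid_L2 = {U. (\<lambda>n. (norm (U n))\<^sup>2) summable_on UNIV}"

definition grid_norm :: "real \<Rightarrow> (int ^ 'd::finite \<Rightarrow> complex) \<Rightarrow> real" where
  "grid_norm h U = sqrt (h ^ CARD('d) * (\<Sum>\<^sub>\<infinity>n. (norm (U n))\<^sup>2))"

definition h_bounded :: "(nat \<Rightarrow> real) \<Rightarrow> (nat \<Rightarrow> int ^ 'd::finite \<Rightarrow> complex) \<Rightarrow> bool" where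
  "h_bounded h U \<longleftrightarrow> (\<forall>k. U k \<in> grid_L2) \<and> (\<exists>C. \<forall>k. grid_norm (h k) (U k) \<le> C)"

text \<open>The series over the grid are taken weakly, i.e. after pairing with a test function.
  For \<open>U \<in> grid_L2\<close> (and, in \<open>reconstruction\<close>, \<open>\<phi>\<close> satisfying \<^term>\<open>BP\<close>) they converge
  absolutely, and the sums agree with those taken in \<open>sobolev_space s\<close> and in \<open>L\<^sup>2\<close> of
  the torus, respectively.\<close>

definition reconstruction ::
  "(real ^ 'd::finite) functional \<Rightarrow> real \<Rightarrow> (int ^ 'd \<Rightarrow> complex) \<Rightarrow> (real ^ 'd) functional" where
  "reconstruction \<phi> h U f = (\<Sum>\<^sub>\<infinity>n. U n * td_dilate h (td_translate (real_vec n) \<phi>) f)"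

definition grid_fourier :: "(int ^ 'd::finite \<Rightarrow> complex) \<Rightarrow> (real ^ 'd) functional" where
  "grid_fourier U f = (\<Sum>\<^sub>\<infinity>n. U n * (LINT \<xi>|lborel. cis (- (real_vec n \<bullet> \<xi>)) * f \<xi>))"


section \<open>Wigner transforms and Wigner measures\<close>

text \<open>The product of the conjugate of \<open>u\<close>, in \<open>x\<close>, and the dilated Fourier transform of \<open>u\<close>, in \<open>\<xi>\<close>,
  is a tensor product: the second factor is applied to \<open>\<xi> \<mapsto> a (x, \<xi>)\<close>, the first
  to the resulting function of \<open>x\<close>. The exponential is moved to the test function.\<close>

definition wigner ::
  "real \<Rightarrow> (real ^ 'd::finite) functional \<Rightarrow> ((real ^ 'd) \<times> (real ^ 'd)) functional" where
  "wigner \<epsilon> u a = of_real (1 / (2 * pi * \<epsilon>) ^ CARD('d)) *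
     td_cnj u (\<lambda>x. td_dilate \<epsilon> (td_fourier u) (\<lambda>\<xi>. cis ((x \<bullet> \<xi>) / \<epsilon>) * a (x, \<xi>)))"

definition grid_wigner ::
  "real \<Rightarrow> real \<Rightarrow> (int ^ 'd::finite \<Rightarrow> complex) \<Rightarrow> ((real ^ 'd) \<times> (real ^ 'd)) functional" where
  "grid_wigner h \<epsilon> U a = of_real (h ^ (2 * CARD('d)) / (2 * pi * \<epsilon>) ^ CARD('d)) *
     (\<Sum>\<^sub>\<infinity>m. cnj (U m) * td_dilate (\<epsilon> / h) (grid_fourier U)
        (\<lambda>\<xi>. cis (h / \<epsilon> * (real_vec m \<bullet> \<xi>)) * a (h *\<^sub>R real_vec m, \<xi>)))"

text \<open>On a Euclidean space a Borel measure that is finite on compact sets is automatically regular.\<close>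

definition radon_measure :: "'a::euclidean_space measure \<Rightarrow> bool" where
  "radon_measure \<mu> \<longleftrightarrow> sets \<mu> = sets borel \<and> (\<forall>K. compact K \<longrightarrow> emeasure \<mu> K < \<infinity>)"

text \<open>Weak convergence of a sequence of tempered distributions to a positive Radon measure which,
  as an element of the dual of \<^term>\<open>schwartz\<close>, acts by integration.\<close>

definition converges_to_measure :: "(nat \<Rightarrow> 'a::euclidean_space functional) \<Rightarrow> 'a measure \<Rightarrow> bool" where
  "converges_to_measure L \<mu> \<longleftrightarrow> radon_measure \<mu> \<and>
     (\<forall>a\<in>schwartz. integrable \<mu> a \<and> (\<lambda>k. L k a) \<longlonglongrightarrow> (LINT z|\<mu>. a z))"

end

theory Submission
  imports Defs "HOL-Probability.Characteristic_Functions" "HOL-Probability.Sinc_Integral"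
begin

text \<open>Write \<open>K(p, \<xi>)\<close> for the Fourier transform of the test function \<open>a(x, \<xi>)\<close> in \<open>x\<close>. On the Fourier
  side both transforms become sesquilinear forms in the grid function: up to the same constant they
  are the sums over \<open>m\<close> and \<open>n\<close> of \<open>cnj (U m) * U n\<close> times the integral over \<open>(\<eta>, \<xi>)\<close> of
  \<open>H(\<eta>, \<xi>) K((\<eta> - \<xi>) / h, \<epsilon> \<xi> / h) exp (\<i> (m \<bullet> \<eta> - n \<bullet> \<xi>))\<close>. For the grid transform \<open>H\<close> is \<open>1\<close>, and for
  the transform of the reconstruction \<open>H(\<eta>, \<xi>)\<close> is \<open>cnj (F \<eta>) * F \<xi>\<close>, where \<open>F\<close> is the Fourier
  transform of \<open>\<phi>\<close>. As \<open>h\<close> and \<open>h / \<epsilon>\<close> tend to \<open>0\<close>, the factor \<open>K\<close> concentrates at \<open>\<eta> = \<xi> = 0\<close>, where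
  \<open>cnj (F \<eta>) * F \<xi>\<close> is close to the square of the norm of \<open>F 0\<close>. The difference is controlled by
  Schur's test and by a weighted estimate for trigonometric polynomials: cutting space into period
  cubes, (BP) bounds the weighted mass of the square of such a polynomial by the square sum of its
  coefficients. Both bounds need only finitely supported grid functions, so the Fourier
  series of \<open>U\<close> itself never appears.\<close>

section \<open>Integration on Euclidean space\<close>

text \<open>The obstacle is that both factors of the Wigner transform are distributions:
  \<open>wigner\<close> feeds to \<open>\<phi>\<close> a series in \<open>U\<close> whose terms are
  themselves built from \<open>\<phi>\<close>. That series has to define a Schwartz function, and
  \<open>\<phi>\<close> has to act on it term by term, before any estimate applies. This is why
  completeness of the Schwartz space and continuity of \<open>\<phi>\<close> along its limits are
  established.

  For negative \<open>s\<close>, (BP) allows \<open>F\<close> to grow. Since \<open>K\<close> decays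
  faster than every power, \<open>F\<close> may first be divided by any power of
  \<open>1 + norm x\<close>; the restrictions \<open>h \<le> 1\<close> and
  \<open>h \<le> \<epsilon>\<close> turn decay of \<open>K\<close> in its rescaled arguments into
  decay in \<open>\<eta>\<close> and \<open>\<xi>\<close>.

  When all weights are paid for, one power of each argument of \<open>K\<close> is kept in reserve.
  Outside the ball of radius \<open>r\<close> this reserve is at least
  \<open>r / (h + h / \<epsilon>)\<close>, which leads to the explicit error
  \<open>\<delta> + (h + h / \<epsilon>) / r\<close>. Schur's test contributes the mass of a kernel
  of width \<open>h\<close>, a multiple of \<open>h ^ d\<close>, which is exactly the factor that
  turns the square sum of \<open>U\<close> into the square of \<open>grid_norm\<close>.\<close>

lemma
  fixes f :: "'a::euclidean_space \<Rightarrow> real \<Rightarrow> 'b::{real_normed_field,banach,second_countable_topology}"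
  assumes "\<And>b. b \<in> Basis \<Longrightarrow> integrable lborel (f b)"
  shows lborel_integrable_prod: "integrable lborel (\<lambda>x. \<Prod>b\<in>Basis. f b (x \<bullet> b))"
    and lborel_integral_prod: "(LBINT x. (\<Prod>b\<in>Basis. f b (x \<bullet> b))) = (\<Prod>b\<in>Basis. LBINT t. f b t)"
proof -
  interpret product_sigma_finite "\<lambda>_::'a. lborel::real measure" ..
  have [measurable]: "f b \<in> borel_measurable borel" if "b \<in> Basis" for b
    using assms[OF that] by auto
  let ?T = "\<lambda>g. \<Sum>b\<in>Basis. g b *\<^sub>R (b::'a)"
  have T: "?T g \<bullet> b = g b" if "b \<in> Basis" for g and b :: 'a
    using that by (simp add: inner_sum_left inner_Basis if_distrib[of "(*) _"] cong: if_cong)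
  have eq: "(\<Prod>b\<in>Basis. f b (?T g \<bullet> b)) = (\<Prod>b\<in>Basis. f b (g b))" for g
    using T by (intro prod.cong) auto
  show "integrable lborel (\<lambda>x. \<Prod>b\<in>Basis. f b (x \<bullet> b))"
    by (subst lborel_eq, subst integrable_distr_eq)
      (auto simp: eq intro!: product_integrable_prod assms)
  show "(LBINT x. (\<Prod>b\<in>Basis. f b (x \<bullet> b))) = (\<Prod>b\<in>Basis. LBINT t. f b t)"
    by (subst lborel_eq, subst integral_distr)
      (auto simp: eq intro!: product_integral_prod assms)
qed

text \<open>Comparison with a product of the functions \<open>1 / (1 + t^2)\<close> of one variable:
  each factor \<open>1 + (x \<bullet> b)^2\<close> is at most \<open>(1 + norm x)^2\<close>, so
  \<open>d\<close> coordinates cost the power \<open>2 d\<close>. Any exponent that depends only on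
  the dimension serves later.\<close>

lemma integrable_inverse_norm_power:
  assumes n: "2 * DIM('a::euclidean_space) \<le> n"
  shows "integrable lborel (\<lambda>x::'a. 1 / (1 + norm x) ^ n)"
proof (rule Bochner_Integration.integrable_bound)
  have "integrable lborel (\<lambda>t::real. inverse (1 + t\<^sup>2))"
    using integrable_inverse_1_plus_square by (simp add: set_integrable_def einterval_def)
  then show "integrable lborel (\<lambda>x::'a. \<Prod>b\<in>Basis. inverse (1 + (x \<bullet> b)\<^sup>2))"
    by (intro lborel_integrable_prod)
  show "AE x::'a in lborel. norm (1 / (1 + norm x) ^ n) \<le> norm (\<Prod>b\<in>Basis. inverse (1 + (x \<bullet> b)\<^sup>2))"
  proof (intro always_eventually allI)
    fix x :: 'a
    have "(\<Prod>b\<in>Basis. 1 + (x \<bullet> b)\<^sup>2) \<le> (\<Prod>b\<in>(Basis::'a set). (1 + norm x)\<^sup>2)"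
    proof (rule prod_mono)
      fix b :: 'a assume "b \<in> Basis"
      then have "\<bar>x \<bullet> b\<bar>\<^sup>2 \<le> (norm x)\<^sup>2" by (intro power_mono Basis_le_norm) auto
      then show "0 \<le> 1 + (x \<bullet> b)\<^sup>2 \<and> 1 + (x \<bullet> b)\<^sup>2 \<le> (1 + norm x)\<^sup>2"
        by (simp add: power2_sum add_increasing2)
    qed
    also have "\<dots> = (1 + norm x) ^ (2 * DIM('a))"
      by (simp add: power_mult)
    also have "\<dots> \<le> (1 + norm x) ^ n"
      using n by (intro power_increasing) auto
    finally have "(\<Prod>b\<in>Basis. 1 + (x \<bullet> b)\<^sup>2) \<le> (1 + norm x) ^ n" .
    moreover have "0 < (\<Prod>b\<in>Basis. 1 + (x \<bullet> b)\<^sup>2)"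
      by (intro prod_pos) (auto intro: add_pos_nonneg)
    ultimately show "norm (1 / (1 + norm x) ^ n) \<le> norm (\<Prod>b\<in>Basis. inverse (1 + (x \<bullet> b)\<^sup>2))"
      by (simp add: inverse_eq_divide prod_dividef abs_of_pos frac_le)
  qed
qed auto

lemma
  fixes f :: "'a::euclidean_space \<Rightarrow> 'b::{banach, second_countable_topology}"
  assumes c: "c > 0" and [measurable]: "f \<in> borel_measurable borel"
  shows integrable_lborel_affine: "integrable lborel (\<lambda>x. f (t + c *\<^sub>R x)) \<longleftrightarrow> integrable lborel f"
    and integral_lborel_affine: "(LBINT x. f x) = c ^ DIM('a) *\<^sub>R (LBINT x. f (t + c *\<^sub>R x))"
proof -
  have m: "(\<lambda>x. t + c *\<^sub>R x) \<in> borel_measurable (borel::'a measure)" by simp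
  have eq: "lborel = density (distr lborel borel (\<lambda>x::'a. t + c *\<^sub>R x)) (\<lambda>_. ennreal (c ^ DIM('a)))"
    using lborel_affine[of c t] c by simp
  show "integrable lborel (\<lambda>x. f (t + c *\<^sub>R x)) \<longleftrightarrow> integrable lborel f"
  proof -
    have "integrable lborel f \<longleftrightarrow> integrable lborel (\<lambda>x. c ^ DIM('a) *\<^sub>R f (t + c *\<^sub>R x))"
      using c by (subst eq) (simp add: integrable_density integrable_distr_eq)
    also have "\<dots> \<longleftrightarrow> integrable lborel (\<lambda>x. f (t + c *\<^sub>R x))"
    proof
      assume "integrable lborel (\<lambda>x. c ^ DIM('a) *\<^sub>R f (t + c *\<^sub>R x))"
      from integrable_scaleR_right[OF this, of "inverse (c ^ DIM('a))"]
      show "integrable lborel (\<lambda>x. f (t + c *\<^sub>R x))" using c by simp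
    qed (rule integrable_scaleR_right)
    finally show ?thesis ..
  qed
  show "(LBINT x. f x) = c ^ DIM('a) *\<^sub>R (LBINT x. f (t + c *\<^sub>R x))"
    using c by (subst eq) (simp add: integral_density integral_distr)
qed

lemma nn_integral_lborel_affine:
  fixes f :: "'a::euclidean_space \<Rightarrow> ennreal"
  assumes c: "c > 0" and [measurable]: "f \<in> borel_measurable borel"
  shows "(\<integral>\<^sup>+x. f x \<partial>lborel) = ennreal (c ^ DIM('a)) * (\<integral>\<^sup>+x. f (t + c *\<^sub>R x) \<partial>lborel)"
proof -
  have eq: "lborel = density (distr lborel borel (\<lambda>x::'a. t + c *\<^sub>R x)) (\<lambda>_. ennreal (c ^ DIM('a)))"
    using lborel_affine[of c t] c by simp
  show ?thesis
    using c by (subst eq) (simp add: nn_integral_density nn_integral_distr nn_integral_cmult)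
qed

lemma integral_lborel_uminus:
  fixes f :: "'a::euclidean_space \<Rightarrow> 'b::{banach, second_countable_topology}"
  assumes [measurable]: "f \<in> borel_measurable borel"
  shows "(LBINT x. f (t - x)) = (LBINT x. f x)"
proof -
  have "lborel = density (distr lborel borel (\<lambda>x::'a. t + (-1) *\<^sub>R x)) (\<lambda>_. ennreal (\<bar>-1\<bar> ^ DIM('a)))"
    by (rule lborel_affine) simp
  then have eq: "lborel = distr lborel borel (\<lambda>x::'a. t - x)"
    by (simp add: density_1)
  show ?thesis
    by (subst (2) eq) (simp add: integral_distr)
qed

text \<open>Dominated convergence for the remainder quotient of the Frechet derivative. That theorem
  speaks about sequences, so the limit at \<open>x0\<close> is tested along arbitrary ones.\<close>

lemma has_derivative_under_integral:
  fixes f :: "'a::euclidean_space \<Rightarrow> 'b \<Rightarrow> 'c::{banach, second_countable_topology}"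
  assumes r: "r > 0"
    and f: "\<And>x. x \<in> ball x0 r \<Longrightarrow> integrable M (f x)"
    and f': "\<And>v. integrable M (\<lambda>y. f' x0 y v)"
    and deriv: "\<And>x y. x \<in> ball x0 r \<Longrightarrow> y \<in> space M \<Longrightarrow> ((\<lambda>x. f x y) has_derivative f' x y) (at x)"
    and bound: "\<And>x y v. x \<in> ball x0 r \<Longrightarrow> y \<in> space M \<Longrightarrow> norm (f' x y v) \<le> H y * norm v"
    and H: "integrable M H"
  shows "((\<lambda>x. LINT y|M. f x y) has_derivative (\<lambda>v. LINT y|M. f' x0 y v)) (at x0)"
proof -
  have x0: "x0 \<in> ball x0 r" using r by simp
  have lin: "linear (f' x0 y)" if "y \<in> space M" for y
    using deriv[OF x0 that] has_derivative_linear by blast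
  have H0: "0 \<le> H y" if "y \<in> space M" for y
  proof -
    obtain b :: 'a where b: "b \<in> Basis" by (meson nonempty_Basis ex_in_conv)
    show ?thesis using order_trans[OF norm_ge_zero bound[OF x0 that, of b]] b by simp
  qed
  show ?thesis unfolding has_derivative_at_within
  proof
    show "bounded_linear (\<lambda>v. LINT y|M. f' x0 y v)"
    proof (rule bounded_linear_intro)
      fix u v :: 'a and c :: real
      have "(LINT y|M. f' x0 y (u + v)) = (LINT y|M. f' x0 y u + f' x0 y v)"
        by (rule Bochner_Integration.integral_cong) (auto simp: linear_add[OF lin])
      also have "\<dots> = (LINT y|M. f' x0 y u) + (LINT y|M. f' x0 y v)"
        by (rule Bochner_Integration.integral_add) (rule f')+
      finally show "(LINT y|M. f' x0 y (u + v)) = (LINT y|M. f' x0 y u) + (LINT y|M. f' x0 y v)" .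
      have "(LINT y|M. f' x0 y (c *\<^sub>R v)) = (LINT y|M. c *\<^sub>R f' x0 y v)"
        by (rule Bochner_Integration.integral_cong) (auto simp: linear_cmul[OF lin])
      then show "(LINT y|M. f' x0 y (c *\<^sub>R v)) = c *\<^sub>R (LINT y|M. f' x0 y v)" by simp
      have "norm (LINT y|M. f' x0 y v) \<le> (LINT y|M. H y * norm v)"
        using f' H bound[OF x0] by (intro order_trans[OF integral_norm_bound] integral_mono) auto
      then show "norm (LINT y|M. f' x0 y v) \<le> norm v * (LINT y|M. H y)" by (simp add: mult.commute)
    qed
    show "((\<lambda>x. ((LINT y|M. f x y) - (LINT y|M. f x0 y) - (LINT y|M. f' x0 y (x - x0))) /\<^sub>R norm (x - x0)) \<longlongrightarrow> 0) (at x0)"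
      unfolding tendsto_at_iff_sequentially comp_def
    proof (intro allI impI)
      fix X :: "nat \<Rightarrow> 'a" assume X: "\<forall>i. X i \<in> UNIV - {x0}" and lim: "X \<longlonglongrightarrow> x0"
      then obtain N where N: "\<And>n. n \<ge> N \<Longrightarrow> X n \<in> ball x0 r"
        using r by (metis (no_types, lifting) metric_LIMSEQ_D mem_ball dist_commute)
      \<comment> \<open>Only a tail of the sequence lies in the ball where the bounds hold;
        \<open>Y\<close> is that tail.\<close>
      define Y where "Y n = X (n + N)" for n
      have Y: "Y n \<in> ball x0 r" "Y n \<noteq> x0" for n using N X by (auto simp: Y_def)
      have limY: "Y \<longlonglongrightarrow> x0" unfolding Y_def using lim by (rule LIMSEQ_ignore_initial_segment)
      let ?q = "\<lambda>x y. (f x y - f x0 y - f' x0 y (x - x0)) /\<^sub>R norm (x - x0)"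
      have q0: "?q x y = (f x y - f x0 y) /\<^sub>R norm (x - x0) - f' x0 y (x - x0) /\<^sub>R norm (x - x0)" for x y
        by (simp add: algebra_simps)
      \<comment> \<open>One \<open>H\<close> bounds the difference quotient, by the mean value
        inequality on the convex ball; the other bounds the linear term.\<close>
      have lim_q: "(\<lambda>n. LINT y|M. ?q (Y n) y) \<longlonglongrightarrow> (LINT y|M. 0)"
      proof (rule integral_dominated_convergence[where w="\<lambda>y. 2 * H y"])
        show "AE y in M. (\<lambda>n. ?q (Y n) y) \<longlonglongrightarrow> 0"
        proof (rule AE_I2)
          fix y assume "y \<in> space M"
          from deriv[OF x0 this] have "((\<lambda>x. ?q x y) \<longlongrightarrow> 0) (at x0)" by (simp add: has_derivative_at_within)
          with Y limY show "(\<lambda>n. ?q (Y n) y) \<longlonglongrightarrow> 0"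
            unfolding tendsto_at_iff_sequentially comp_def by blast
        qed
        show "AE y in M. norm (?q (Y n) y) \<le> 2 * H y" for n
        proof (rule AE_I2)
          fix y assume y: "y \<in> space M"
          have "norm (f (Y n) y - f x0 y) \<le> H y * norm (Y n - x0)"
          proof (rule differentiable_bound[OF convex_ball[of x0 r]])
            show "((\<lambda>x. f x y) has_derivative f' x y) (at x within ball x0 r)" if "x \<in> ball x0 r" for x
              using deriv[OF that y] by (rule has_derivative_at_withinI)
            show "onorm (f' x y) \<le> H y" if "x \<in> ball x0 r" for x
              using bound[OF that y] by (rule onorm_le)
          qed (use Y x0 in auto)
          moreover have "norm (f' x0 y (Y n - x0)) \<le> H y * norm (Y n - x0)"
            by (rule bound[OF x0 y])
          ultimately have "norm (f (Y n) y - f x0 y - f' x0 y (Y n - x0)) \<le> 2 * H y * norm (Y n - x0)"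
            using norm_triangle_ineq4[of "f (Y n) y - f x0 y" "f' x0 y (Y n - x0)"] by linarith
          then show "norm (?q (Y n) y) \<le> 2 * H y"
            using Y(2)[of n] by (simp add: pos_divide_le_eq flip: divide_inverse_commute)
        qed
        have 1: "integrable M (f (Y n))" "integrable M (f x0)" for n using f Y x0 by auto
        show "(\<lambda>y. ?q (Y n) y) \<in> borel_measurable M" for n
          using 1 f' by (intro borel_measurable_integrable Bochner_Integration.integrable_diff
              Bochner_Integration.integrable_scaleR_right) auto
      qed (use H in auto)
      have q: "(LINT y|M. ?q (Y n) y) =
          ((LINT y|M. f (Y n) y) - (LINT y|M. f x0 y) - (LINT y|M. f' x0 y (Y n - x0))) /\<^sub>R norm (Y n - x0)" for n
        using f Y x0 f' by (simp add: Bochner_Integration.integral_diff Bochner_Integration.integrable_diff)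
      have "(\<lambda>n. ((LINT y|M. f (Y n) y) - (LINT y|M. f x0 y) - (LINT y|M. f' x0 y (Y n - x0))) /\<^sub>R norm (Y n - x0)) \<longlonglongrightarrow> 0"
        using lim_q unfolding q integral_zero .
      then show "(\<lambda>n. ((LINT y|M. f (X n) y) - (LINT y|M. f x0 y) - (LINT y|M. f' x0 y (X n - x0))) /\<^sub>R norm (X n - x0)) \<longlonglongrightarrow> 0"
        unfolding Y_def by (rule LIMSEQ_offset)
    qed
  qed
qed

section \<open>Measurability of conjugation and \<open>cis\<close>; Fourier integrals of
  Gaussians\<close>

lemma borel_measurable_cnj [measurable]: "cnj \<in> borel_measurable borel"
  by (intro borel_measurable_continuous_onI continuous_intros)

lemma borel_measurable_cis [measurable]: "cis \<in> borel_measurable borel"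
  by (intro borel_measurable_continuous_onI continuous_intros)

text \<open>The characteristic function of the standard normal distribution, rescaled by
  \<open>t\<close>.\<close>

lemma
  fixes t :: real
  assumes t: "t > 0"
  shows integrable_gaussian_cis: "integrable lborel (\<lambda>x::real. cis (x * y) * of_real (exp (- (t * x)\<^sup>2 / 2)))"
    and integral_gaussian_cis: "(LBINT x. cis (x * y) * of_real (exp (- (t * x)\<^sup>2 / 2)))
      = of_real (sqrt (2 * pi) / t * exp (- (y / t)\<^sup>2 / 2))"
proof -
  let ?g = "\<lambda>x::real. cis (x * (y / t)) * of_real (exp (- x\<^sup>2 / 2))"
  have "integrable lborel (\<lambda>x::real. exp (- x\<^sup>2 / 2))"
    using integrable_mult_right[OF integrable_std_normal_moment[of 0], of "sqrt (2 * pi)"]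
    by (simp add: std_normal_density_def)
  then have g: "integrable lborel ?g"
    by (rule Bochner_Integration.integrable_bound) (auto simp: norm_mult)
  have m[measurable]: "?g \<in> borel_measurable borel" by measurable
  have "of_real (exp (- (y / t)\<^sup>2 / 2)) = char std_normal_distribution (y / t)"
    by (simp add: char_std_normal_distribution)
  also have "\<dots> = (LBINT x. std_normal_density x *\<^sub>R iexp ((y / t) * x))"
    unfolding char_def by (subst integral_density) auto
  also have "\<dots> = (LBINT x. of_real (1 / sqrt (2 * pi)) * ?g x)"
    by (intro Bochner_Integration.integral_cong) (auto simp: std_normal_density_def cis_conv_exp scaleR_conv_of_real mult_ac)
  also have "\<dots> = of_real (1 / sqrt (2 * pi)) * (LBINT x. ?g x)"
    by simp
  finally have G: "(LBINT x. ?g x) = of_real (sqrt (2 * pi) * exp (- (y / t)\<^sup>2 / 2))"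
    by (simp add: field_simps)
  have eq: "(\<lambda>x. ?g (0 + t *\<^sub>R x)) = (\<lambda>x. cis (x * y) * of_real (exp (- (t * x)\<^sup>2 / 2)))"
    using t by auto
  show "integrable lborel (\<lambda>x::real. cis (x * y) * of_real (exp (- (t * x)\<^sup>2 / 2)))"
    using integrable_lborel_affine[OF t m, of 0] g unfolding eq by simp
  show "(LBINT x. cis (x * y) * of_real (exp (- (t * x)\<^sup>2 / 2)))
      = of_real (sqrt (2 * pi) / t * exp (- (y / t)\<^sup>2 / 2))"
    using integral_lborel_affine[OF t m, of 0] G t unfolding eq
    by (simp add: field_simps scaleR_conv_of_real)
qed

lemma norm_power2_Basis: "(norm (x::'a::euclidean_space))\<^sup>2 = (\<Sum>b\<in>Basis. (x \<bullet> b)\<^sup>2)"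
  unfolding power2_norm_eq_inner by (subst euclidean_inner) (simp add: power2_eq_square)

lemma cis_sum: "cis (\<Sum>i\<in>A. f i) = (\<Prod>i\<in>A. cis (f i))"
  by (induction A rule: infinite_finite_induct) (auto simp: cis_mult[symmetric])

text \<open>Gaussian and character both factor over the coordinates, which reduces everything to one
  dimension.\<close>

lemma
  fixes y :: "'a::euclidean_space"
  assumes t: "t > 0"
  shows integrable_gaussian_cis_euclidean:
      "integrable lborel (\<lambda>x. cis (x \<bullet> y) * of_real (exp (- (t * norm x)\<^sup>2 / 2)))"
    and integral_gaussian_cis_euclidean:
      "(LBINT x. cis (x \<bullet> y) * of_real (exp (- (t * norm x)\<^sup>2 / 2)))
      = of_real ((sqrt (2 * pi) / t) ^ DIM('a) * exp (- (norm y / t)\<^sup>2 / 2))"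
proof -
  have *: "(\<Prod>b\<in>Basis. cis ((x \<bullet> b) * (y \<bullet> b)) * of_real (exp (- (t * (x \<bullet> b))\<^sup>2 / 2))) =
      cis (x \<bullet> y) * of_real (exp (- (t * norm x)\<^sup>2 / 2))" (is "?l = ?r") for x
  proof -
    have "?l = cis (\<Sum>b\<in>Basis. (x \<bullet> b) * (y \<bullet> b)) * of_real (exp (\<Sum>b\<in>Basis. - (t * (x \<bullet> b))\<^sup>2 / 2))"
      by (simp add: prod.distrib cis_sum exp_sum)
    also have "(\<Sum>b\<in>Basis. - (t * (x \<bullet> b))\<^sup>2 / 2) = - (t * norm x)\<^sup>2 / 2"
      by (simp add: power_mult_distrib norm_power2_Basis sum_distrib_left sum_divide_distrib sum_negf)
    finally show ?thesis by (simp add: euclidean_inner[of x y])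
  qed
  have **: "(\<Prod>b\<in>Basis. complex_of_real (sqrt (2 * pi) / t * exp (- ((y \<bullet> b) / t)\<^sup>2 / 2)))
     = of_real ((sqrt (2 * pi) / t) ^ DIM('a) * exp (- (norm y / t)\<^sup>2 / 2))" (is "?l = ?r")
  proof -
    have "?l = of_real (\<Prod>b\<in>(Basis::'a set). (sqrt (2 * pi) / t) * exp (- ((y \<bullet> b) / t)\<^sup>2 / 2))"
      by simp
    also have "(\<Prod>b\<in>(Basis::'a set). (sqrt (2 * pi) / t) * exp (- ((y \<bullet> b) / t)\<^sup>2 / 2)) =
      (sqrt (2 * pi) / t) ^ DIM('a) * exp (\<Sum>b\<in>Basis. - ((y \<bullet> b) / t)\<^sup>2 / 2)"
      by (simp only: prod.distrib exp_sum[OF finite_Basis] prod_constant)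
    also have "(\<Sum>b\<in>Basis. - ((y \<bullet> b) / t)\<^sup>2 / 2) = - (norm y / t)\<^sup>2 / 2"
      by (simp add: power_divide norm_power2_Basis sum_divide_distrib sum_negf)
    finally show ?thesis .
  qed
  note 1 = lborel_integrable_prod[where f="\<lambda>b x. cis (x * (y \<bullet> b)) * complex_of_real (exp (- (t * x)\<^sup>2 / 2))", OF integrable_gaussian_cis[OF t]]
  note 2 = lborel_integral_prod[where f="\<lambda>b x. cis (x * (y \<bullet> b)) * complex_of_real (exp (- (t * x)\<^sup>2 / 2))", OF integrable_gaussian_cis[OF t]]
  show "integrable lborel (\<lambda>x. cis (x \<bullet> y) * of_real (exp (- (t * norm x)\<^sup>2 / 2)))"
    using 1 unfolding * .
  show "(LBINT x. cis (x \<bullet> y) * of_real (exp (- (t * norm x)\<^sup>2 / 2)))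
      = of_real ((sqrt (2 * pi) / t) ^ DIM('a) * exp (- (norm y / t)\<^sup>2 / 2))"
    using 2 unfolding * integral_gaussian_cis[OF t] ** .
qed


section \<open>Schwartz functions\<close>

text \<open>The direction comes first, so that \<open>dderiv b\<close> is an operator on functions
  and \<open>partials\<close> is its iteration.\<close>

definition dderiv :: "'a \<Rightarrow> ('a::euclidean_space \<Rightarrow> complex) \<Rightarrow> 'a \<Rightarrow> complex" where
  "dderiv v f x = frechet_derivative f (at x) v"

definition rapid :: "('a::euclidean_space \<Rightarrow> complex) \<Rightarrow> bool" where
  "rapid f \<longleftrightarrow> (\<forall>N. \<exists>C. \<forall>x. (1 + norm x) ^ N * norm (f x) \<le> C)"

lemma partials_Cons: "partials (b # bs) f = dderiv b (partials bs f)"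
  by (auto simp: dderiv_def)

text \<open>The recursion of \<open>partials\<close> peels off the derivative taken last. Peeling
  off the one taken first is what shows that \<open>dderiv b f\<close> is again a Schwartz
  function.\<close>

lemma partials_snoc: "partials (bs @ [b]) f = partials bs (dderiv b f)"
proof (induction bs)
  case Nil
  show ?case by (simp add: dderiv_def fun_eq_iff)
next
  case (Cons a bs)
  then show ?case by (simp add: partials_Cons del: partials.simps)
qed

lemma schwartz_iff:
  "f \<in> schwartz \<longleftrightarrow>
    (\<forall>bs. set bs \<subseteq> Basis \<longrightarrow> (\<forall>x. partials bs f differentiable at x) \<and> rapid (partials bs f))"
  by (auto simp: schwartz_def smooth_def rapid_def bdd_above_def)

lemma dderiv_eq: "(f has_derivative D) (at x) \<Longrightarrow> dderiv v f x = D v"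
  by (metis dderiv_def frechet_derivative_at)

lemma dderiv_fun_eq: "(\<And>x. (f has_derivative D x) (at x)) \<Longrightarrow> dderiv v f = (\<lambda>x. D x v)"
  by (auto simp: dderiv_eq)

text \<open>A class of rapidly decreasing functions that is closed under partial derivatives
  contains all iterated derivatives of its members. Closure properties can then be proved with a
  single differentiation, the class \<open>X\<close> being chosen as all functions of the shape in
  question.\<close>

lemma schwartz_coinduct:
  assumes X: "X f"
    and rapid: "\<And>f. X f \<Longrightarrow> rapid f"
    and deriv: "\<And>f. X f \<Longrightarrow> \<exists>D. (\<forall>x. (f has_derivative D x) (at x)) \<and> (\<forall>b\<in>Basis. X (\<lambda>x. D x b))"
  shows "f \<in> schwartz"
proof -
  have *: "X (partials bs f)" if "set bs \<subseteq> Basis" for bs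
    using that
  proof (induction bs)
    case (Cons b bs)
    then obtain D where "\<forall>x. (partials bs f has_derivative D x) (at x)" "X (\<lambda>x. D x b)"
      using deriv[of "partials bs f"] by auto
    moreover from this(1) have "dderiv b (partials bs f) = (\<lambda>x. D x b)" by (intro dderiv_fun_eq) auto
    ultimately show ?case by (simp add: partials_Cons del: partials.simps)
  qed (use X in auto)
  show ?thesis
    unfolding schwartz_iff differentiable_def using *[THEN rapid] *[THEN deriv] by blast
qed

lemma
  assumes "f \<in> schwartz"
  shows schwartz_differentiable: "f differentiable at x"
    and schwartz_rapid: "rapid f"
    and schwartz_has_derivative: "(f has_derivative (\<lambda>v. dderiv v f x)) (at x)"
    and schwartz_dderiv: "b \<in> Basis \<Longrightarrow> dderiv b f \<in> schwartz"
    and schwartz_partials: "set bs \<subseteq> Basis \<Longrightarrow> partials bs f \<in> schwartz"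
proof -
  have *: "\<And>bs. set bs \<subseteq> Basis \<Longrightarrow> (\<forall>x. partials bs f differentiable at x) \<and> rapid (partials bs f)"
    using assms by (simp add: schwartz_iff)
  from *[of "[]"] show d: "f differentiable at x" and "rapid f" by auto
  from d show "(f has_derivative (\<lambda>v. dderiv v f x)) (at x)"
    unfolding dderiv_def by (simp add: frechet_derivative_works[symmetric])
  have 1: "dderiv b g \<in> schwartz" if "g \<in> schwartz" "b \<in> Basis" for b and g :: "'a \<Rightarrow> complex"
    unfolding schwartz_iff partials_snoc[symmetric] using that by (auto simp: schwartz_iff)
  show "dderiv b f \<in> schwartz" if "b \<in> Basis" using 1[OF assms that] .
  show "partials bs f \<in> schwartz" if "set bs \<subseteq> Basis" using that
    by (induction bs) (auto simp: partials_Cons assms 1 simp del: partials.simps(2))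
qed

lemma rapidD:
  assumes "rapid f"
  obtains C where "C > 0" "\<And>x. (1 + norm x) ^ N * norm (f x) \<le> C"
proof -
  obtain C where "\<And>x. (1 + norm x) ^ N * norm (f x) \<le> C" using assms unfolding rapid_def by blast
  then have "(1 + norm x) ^ N * norm (f x) \<le> max C 1" for x by (simp add: le_max_iff_disj)
  then show thesis using that[of "max C 1"] by auto
qed

lemma rapid_growth:
  assumes f: "rapid f" and g: "\<And>x. norm (g x) \<le> A * (1 + norm x) ^ k * norm (f x)"
  shows "rapid g"
  unfolding rapid_def
proof
  fix N
  obtain C where "\<And>x. (1 + norm x) ^ (N + k) * norm (f x) \<le> C" using f unfolding rapid_def by blast
  then have C: "(1 + norm x) ^ (N + k) * norm (f x) \<le> max C 1" for x by (simp add: le_max_iff_disj)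
  have "(1 + norm x) ^ N * norm (g x) \<le> \<bar>A\<bar> * max C 1" for x
  proof -
    have "(1 + norm x) ^ N * norm (g x) \<le> (1 + norm x) ^ N * (A * (1 + norm x) ^ k * norm (f x))"
      using g by (intro mult_left_mono) auto
    also have "\<dots> = A * ((1 + norm x) ^ (N + k) * norm (f x))" by (simp add: power_add)
    also have "\<dots> \<le> \<bar>A\<bar> * max C 1" using C by (intro mult_mono) auto
    finally show ?thesis .
  qed
  then show "\<exists>C. \<forall>x. (1 + norm x) ^ N * norm (g x) \<le> C" by blast
qed

lemma rapid_add:
  assumes "rapid f" "rapid g" shows "rapid (\<lambda>x. f x + g x)"
  unfolding rapid_def
proof
  fix N
  obtain C D where C: "\<And>x. (1 + norm x) ^ N * norm (f x) \<le> C" and D: "\<And>x. (1 + norm x) ^ N * norm (g x) \<le> D"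
    using assms unfolding rapid_def by metis
  have "(1 + norm x) ^ N * norm (f x + g x) \<le> C + D" for x
  proof -
    have "(1 + norm x) ^ N * norm (f x + g x) \<le> (1 + norm x) ^ N * (norm (f x) + norm (g x))"
      by (intro mult_left_mono norm_triangle_ineq) auto
    then show ?thesis using C[of x] D[of x] by (simp add: distrib_left)
  qed
  then show "\<exists>C. \<forall>x. (1 + norm x) ^ N * norm (f x + g x) \<le> C" by blast
qed

lemma rapid_compose_affine:
  fixes L :: "'a::euclidean_space \<Rightarrow> 'b::euclidean_space"
  assumes f: "rapid f" and L: "\<And>x. norm x \<le> C * norm (L x)"
  shows "rapid (\<lambda>x. f (L x + v))"
  unfolding rapid_def
proof
  fix N
  obtain B where B: "\<And>x. (1 + norm x) ^ N * norm (f x) \<le> B" using f unfolding rapid_def by blast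
  \<comment> \<open>\<open>K\<close> collects the loss from \<open>C\<close> and from the shift
    \<open>v\<close>, so that one comparison of \<open>1 + norm x\<close> with its image serves for
    every exponent \<open>N\<close>.\<close>
  define K where "K = 1 + \<bar>C\<bar> + \<bar>C\<bar> * norm v"
  have le: "1 + norm x \<le> K * (1 + norm (L x + v))" for x
  proof -
    have "norm (L x) \<le> norm (L x + v) + norm v" using norm_triangle_ineq4[of "L x + v" v] by simp
    then have "\<bar>C\<bar> * norm (L x) \<le> \<bar>C\<bar> * (norm (L x + v) + norm v)" by (intro mult_left_mono) auto
    moreover have "C * norm (L x) \<le> \<bar>C\<bar> * norm (L x)" by (intro mult_right_mono) auto
    ultimately have "norm x \<le> \<bar>C\<bar> * (norm (L x + v) + norm v)" using L[of x] by linarith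
    also have "1 + \<dots> \<le> K * (1 + norm (L x + v))"
      unfolding K_def by (simp add: algebra_simps)
    finally show ?thesis by simp
  qed
  have "(1 + norm x) ^ N * norm (f (L x + v)) \<le> K ^ N * B" for x
  proof -
    have "(1 + norm x) ^ N * norm (f (L x + v)) \<le> (K * (1 + norm (L x + v))) ^ N * norm (f (L x + v))"
      using le by (intro mult_right_mono power_mono) auto
    also have "\<dots> = K ^ N * ((1 + norm (L x + v)) ^ N * norm (f (L x + v)))"
      by (simp add: power_mult_distrib)
    also have "\<dots> \<le> K ^ N * B" using B by (intro mult_left_mono) (auto simp: K_def)
    finally show ?thesis .
  qed
  then show "\<exists>C. \<forall>x. (1 + norm x) ^ N * norm (f (L x + v)) \<le> C" by blast
qed

section \<open>Closure properties of the Schwartz space\<close>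

lemma schwartz_zero: "(\<lambda>_. 0) \<in> schwartz"
  by (rule schwartz_coinduct[of "\<lambda>f. f = (\<lambda>_. 0)"])
    (auto simp: rapid_def intro!: exI[of _ "\<lambda>_ _. 0"])

lemma schwartz_add:
  assumes "f \<in> schwartz" "g \<in> schwartz" shows "(\<lambda>x. f x + g x) \<in> schwartz"
proof (rule schwartz_coinduct[of "\<lambda>h. \<exists>f\<in>schwartz. \<exists>g\<in>schwartz. h = (\<lambda>x. f x + g x)"])
  fix h :: "'a \<Rightarrow> complex" assume "\<exists>f\<in>schwartz. \<exists>g\<in>schwartz. h = (\<lambda>x. f x + g x)"
  then obtain f g where fg: "f \<in> schwartz" "g \<in> schwartz" and h: "h = (\<lambda>x. f x + g x)" by blast
  show "rapid h" unfolding h using fg by (intro rapid_add schwartz_rapid)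
  show "\<exists>D. (\<forall>x. (h has_derivative D x) (at x)) \<and>
      (\<forall>b\<in>Basis. \<exists>f\<in>schwartz. \<exists>g\<in>schwartz. (\<lambda>x. D x b) = (\<lambda>x. f x + g x))"
    unfolding h using fg
    by (intro exI[of _ "\<lambda>x v. dderiv v f x + dderiv v g x"])
      (auto intro!: has_derivative_add schwartz_has_derivative schwartz_dderiv)
qed (use assms in blast)

lemma schwartz_cmult:
  assumes "f \<in> schwartz" shows "(\<lambda>x. c * f x) \<in> schwartz"
proof (rule schwartz_coinduct[of "\<lambda>h. \<exists>f\<in>schwartz. h = (\<lambda>x. c * f x)"])
  fix h :: "'a \<Rightarrow> complex" assume "\<exists>f\<in>schwartz. h = (\<lambda>x. c * f x)"
  then obtain f where f: "f \<in> schwartz" and h: "h = (\<lambda>x. c * f x)" by blast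
  show "rapid h" unfolding h by (rule rapid_growth[OF schwartz_rapid[OF f], of _ "norm c" 0]) (simp add: norm_mult)
  show "\<exists>D. (\<forall>x. (h has_derivative D x) (at x)) \<and> (\<forall>b\<in>Basis. \<exists>f\<in>schwartz. (\<lambda>x. D x b) = (\<lambda>x. c * f x))"
    unfolding h using f
    by (intro exI[of _ "\<lambda>x v. c * dderiv v f x"])
      (auto intro!: has_derivative_mult_right schwartz_has_derivative schwartz_dderiv)
qed (use assms in blast)

lemma schwartz_diff:
  assumes "f \<in> schwartz" "g \<in> schwartz" shows "(\<lambda>x. f x - g x) \<in> schwartz"
  using schwartz_add[OF assms(1) schwartz_cmult[OF assms(2), of "-1"]] by simp

lemma schwartz_sum:
  assumes "\<And>i. i \<in> I \<Longrightarrow> f i \<in> schwartz" shows "(\<lambda>x. \<Sum>i\<in>I. f i x) \<in> schwartz"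
  using assms by (induction I rule: infinite_finite_induct) (auto intro: schwartz_zero schwartz_add)

lemma schwartz_cnj:
  assumes "f \<in> schwartz" shows "(\<lambda>x. cnj (f x)) \<in> schwartz"
proof (rule schwartz_coinduct[of "\<lambda>h. \<exists>f\<in>schwartz. h = (\<lambda>x. cnj (f x))"])
  fix h :: "'a \<Rightarrow> complex" assume "\<exists>f\<in>schwartz. h = (\<lambda>x. cnj (f x))"
  then obtain f where f: "f \<in> schwartz" and h: "h = (\<lambda>x. cnj (f x))" by blast
  show "rapid h" unfolding h by (rule rapid_growth[OF schwartz_rapid[OF f], of _ 1 0]) simp
  show "\<exists>D. (\<forall>x. (h has_derivative D x) (at x)) \<and> (\<forall>b\<in>Basis. \<exists>f\<in>schwartz. (\<lambda>x. D x b) = (\<lambda>x. cnj (f x)))"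
    unfolding h using f
    by (intro exI[of _ "\<lambda>x v. cnj (dderiv v f x)"])
      (auto intro!: has_derivative_cnj schwartz_has_derivative schwartz_dderiv)
qed (use assms in blast)

text \<open>Reduces a general direction to \<open>Basis\<close>, the directions that the definition
  of \<open>schwartz\<close> speaks about.\<close>

lemma dderiv_expand:
  assumes "f \<in> schwartz" shows "dderiv v f x = (\<Sum>b\<in>Basis. of_real (v \<bullet> b) * dderiv b f x)"
proof -
  have lin: "linear (\<lambda>v. dderiv v f x)"
    using schwartz_has_derivative[OF assms] has_derivative_linear by blast
  have "dderiv v f x = dderiv (\<Sum>b\<in>Basis. (v \<bullet> b) *\<^sub>R b) f x" by (simp add: euclidean_representation)
  also have "\<dots> = (\<Sum>b\<in>Basis. (v \<bullet> b) *\<^sub>R dderiv b f x)"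
    by (simp add: linear_sum[OF lin] linear_cmul[OF lin])
  finally show ?thesis unfolding scaleR_conv_of_real .
qed

lemma schwartz_dderiv_gen:
  assumes "f \<in> schwartz" shows "dderiv v f \<in> schwartz"
proof -
  have "dderiv v f = (\<lambda>x. \<Sum>b\<in>Basis. of_real (v \<bullet> b) * dderiv b f x)"
    by (rule ext) (rule dderiv_expand[OF assms])
  moreover have "\<dots> \<in> schwartz" using assms by (intro schwartz_sum schwartz_cmult schwartz_dderiv)
  ultimately show ?thesis by simp
qed

text \<open>The product rule produces a term without the factor \<open>x \<bullet> v\<close>. The
  class used for the coinduction therefore carries a second, free summand \<open>g\<close>.\<close>

lemma schwartz_inner_mult:
  assumes "f \<in> schwartz" shows "(\<lambda>x. of_real (x \<bullet> v) * f x) \<in> schwartz"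
proof (rule schwartz_coinduct[of "\<lambda>h. \<exists>f\<in>schwartz. \<exists>g\<in>schwartz. h = (\<lambda>x. of_real (x \<bullet> v) * f x + g x)"])
  fix h :: "'a \<Rightarrow> complex" assume "\<exists>f\<in>schwartz. \<exists>g\<in>schwartz. h = (\<lambda>x. of_real (x \<bullet> v) * f x + g x)"
  then obtain f g where fg: "f \<in> schwartz" "g \<in> schwartz" and h: "h = (\<lambda>x. of_real (x \<bullet> v) * f x + g x)" by blast
  have *: "norm (of_real (x \<bullet> v) * f x) \<le> norm v * (1 + norm x) ^ 1 * norm (f x)" for x
  proof -
    have "\<bar>x \<bullet> v\<bar> \<le> norm v * (1 + norm x)"
      using Cauchy_Schwarz_ineq2[of x v] by (simp add: algebra_simps add_increasing)
    then show ?thesis by (simp add: norm_mult mult_right_mono)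
  qed
  show "rapid h" unfolding h
    using fg by (intro rapid_add rapid_growth[OF schwartz_rapid[OF fg(1)] *] schwartz_rapid)
  have 1: "((\<lambda>x. complex_of_real (x \<bullet> v)) has_derivative (\<lambda>u. of_real (u \<bullet> v))) (at x)" for x
    by (auto intro!: derivative_eq_intros)
  show "\<exists>D. (\<forall>x. (h has_derivative D x) (at x)) \<and>
      (\<forall>b\<in>Basis. \<exists>f\<in>schwartz. \<exists>g\<in>schwartz. (\<lambda>x. D x b) = (\<lambda>x. of_real (x \<bullet> v) * f x + g x))"
  proof (intro exI conjI allI ballI)
    show "(h has_derivative (\<lambda>u. (of_real (x \<bullet> v) * dderiv u f x + of_real (u \<bullet> v) * f x) + dderiv u g x)) (at x)" for x
      unfolding h using fg by (intro has_derivative_add has_derivative_mult 1 schwartz_has_derivative)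
    fix b :: 'a assume b: "b \<in> Basis"
    show "\<exists>f'\<in>schwartz. \<exists>g'\<in>schwartz. (\<lambda>x. (of_real (x \<bullet> v) * dderiv b f x + of_real (b \<bullet> v) * f x) + dderiv b g x)
       = (\<lambda>x. of_real (x \<bullet> v) * f' x + g' x)"
      by (rule bexI[OF _ schwartz_dderiv[OF fg(1) b]],
          rule bexI[OF _ schwartz_add[OF schwartz_cmult[OF fg(1), of "of_real (b \<bullet> v)"] schwartz_dderiv[OF fg(2) b]]]) (simp add: add.assoc)
  qed
next
  show "\<exists>f'\<in>schwartz. \<exists>g\<in>schwartz. (\<lambda>x. of_real (x \<bullet> v) * f x) = (\<lambda>x. of_real (x \<bullet> v) * f' x + g x)"
    by (intro bexI[OF _ assms] bexI[OF _ schwartz_zero]) simp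
qed

lemma has_derivative_cis:
  assumes "(g has_derivative g') (at x)"
  shows "((\<lambda>x. cis (g x)) has_derivative (\<lambda>v. \<i> * of_real (g' v) * cis (g x))) (at x)"
proof -
  have "(cis has_derivative (\<lambda>t. t *\<^sub>R (\<i> * cis (g x)))) (at (g x))"
  proof -
    have 1: "((\<lambda>t. \<i> * complex_of_real t) has_derivative (\<lambda>t. \<i> * of_real t)) (at (g x))"
      by (auto intro!: derivative_eq_intros)
    have 2: "(exp has_derivative (*) (exp z)) (at z)" for z :: complex
      by (rule has_field_derivative_imp_has_derivative[OF DERIV_exp])
    show ?thesis
      using has_derivative_compose[OF 1 2] by (simp add: cis_conv_exp[abs_def] scaleR_conv_of_real mult_ac)
  qed
  from has_derivative_compose[OF assms this] show ?thesis
    by (simp add: scaleR_conv_of_real mult_ac)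
qed

lemma schwartz_cis_mult:
  assumes "f \<in> schwartz" shows "(\<lambda>x. cis (x \<bullet> v) * f x) \<in> schwartz"
proof (rule schwartz_coinduct[of "\<lambda>h. \<exists>f\<in>schwartz. h = (\<lambda>x. cis (x \<bullet> v) * f x)"])
  fix h :: "'a \<Rightarrow> complex" assume "\<exists>f\<in>schwartz. h = (\<lambda>x. cis (x \<bullet> v) * f x)"
  then obtain f where f: "f \<in> schwartz" and h: "h = (\<lambda>x. cis (x \<bullet> v) * f x)" by blast
  show "rapid h" unfolding h by (rule rapid_growth[OF schwartz_rapid[OF f], of _ 1 0]) (simp add: norm_mult)
  have 1: "((\<lambda>x. cis (x \<bullet> v)) has_derivative (\<lambda>u. \<i> * of_real (u \<bullet> v) * cis (x \<bullet> v))) (at x)" for x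
    by (rule has_derivative_cis) (auto intro!: derivative_eq_intros)
  show "\<exists>D. (\<forall>x. (h has_derivative D x) (at x)) \<and>
      (\<forall>b\<in>Basis. \<exists>f\<in>schwartz. (\<lambda>x. D x b) = (\<lambda>x. cis (x \<bullet> v) * f x))"
  proof (intro exI conjI allI ballI)
    show "(h has_derivative (\<lambda>u. cis (x \<bullet> v) * dderiv u f x + \<i> * of_real (u \<bullet> v) * cis (x \<bullet> v) * f x)) (at x)" for x
      unfolding h using f by (intro has_derivative_mult 1 schwartz_has_derivative)
    fix b :: 'a assume b: "b \<in> Basis"
    show "\<exists>f'\<in>schwartz. (\<lambda>x. cis (x \<bullet> v) * dderiv b f x + \<i> * of_real (b \<bullet> v) * cis (x \<bullet> v) * f x)
       = (\<lambda>x. cis (x \<bullet> v) * f' x)"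
    proof (rule bexI[of _ "\<lambda>x. dderiv b f x + (\<i> * of_real (b \<bullet> v)) * f x"])
      show "(\<lambda>x. dderiv b f x + (\<i> * of_real (b \<bullet> v)) * f x) \<in> schwartz"
        using b f by (intro schwartz_add schwartz_cmult schwartz_dderiv)
    qed (simp add: algebra_simps)
  qed
qed (use assms in blast)

text \<open>Differentiating the quadratic phase brings down a factor that is linear in
  \<open>z\<close>; \<open>schwartz_inner_mult\<close> absorbs it into the Schwartz function, so the
  class is closed.\<close>

lemma schwartz_chirp_mult:
  fixes f :: "'a::euclidean_space \<times> 'a \<Rightarrow> complex"
  assumes "f \<in> schwartz" shows "(\<lambda>z. cis (c * (fst z \<bullet> snd z)) * f z) \<in> schwartz"
proof (rule schwartz_coinduct[of "\<lambda>h. \<exists>f\<in>schwartz. h = (\<lambda>z. cis (c * (fst z \<bullet> snd z)) * f z)"])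
  fix h :: "'a \<times> 'a \<Rightarrow> complex" assume "\<exists>f\<in>schwartz. h = (\<lambda>z. cis (c * (fst z \<bullet> snd z)) * f z)"
  then obtain f where f: "f \<in> schwartz" and h: "h = (\<lambda>z. cis (c * (fst z \<bullet> snd z)) * f z)" by blast
  let ?e = "\<lambda>z::'a \<times> 'a. cis (c * (fst z \<bullet> snd z))"
  \<comment> \<open>The gradient of \<open>fst z \<bullet> snd z\<close> is \<open>z\<close> with
    its components exchanged; here the exchange is moved to the direction \<open>u\<close>.\<close>
  let ?l = "\<lambda>(z::'a \<times> 'a) u. z \<bullet> (snd u, fst u)"
  show "rapid h" unfolding h by (rule rapid_growth[OF schwartz_rapid[OF f], of _ 1 0]) (simp add: norm_mult)
  have 1: "(?e has_derivative (\<lambda>u. \<i> * of_real (c * ?l z u) * ?e z)) (at z)" for z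
    by (rule has_derivative_cis) (auto intro!: derivative_eq_intros simp: inner_prod_def inner_commute algebra_simps)
  show "\<exists>D. (\<forall>x. (h has_derivative D x) (at x)) \<and>
      (\<forall>b\<in>Basis. \<exists>f\<in>schwartz. (\<lambda>x. D x b) = (\<lambda>z. cis (c * (fst z \<bullet> snd z)) * f z))"
  proof (intro exI conjI allI ballI)
    show "(h has_derivative (\<lambda>u. ?e z * dderiv u f z + \<i> * of_real (c * ?l z u) * ?e z * f z)) (at z)" for z
      unfolding h using f by (intro has_derivative_mult 1 schwartz_has_derivative)
    fix b :: "'a \<times> 'a" assume b: "b \<in> Basis"
    show "\<exists>f'\<in>schwartz. (\<lambda>z. ?e z * dderiv b f z + \<i> * of_real (c * ?l z b) * ?e z * f z)
       = (\<lambda>z. ?e z * f' z)"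
    proof (rule bexI[of _ "\<lambda>z. dderiv b f z + (\<i> * of_real c) * (of_real (?l z b) * f z)"])
      show "(\<lambda>z. dderiv b f z + (\<i> * of_real c) * (of_real (?l z b) * f z)) \<in> schwartz"
        using b f by (intro schwartz_add schwartz_cmult schwartz_inner_mult schwartz_dderiv)
    qed (simp add: algebra_simps)
  qed
qed (use assms in blast)

text \<open>The bound on \<open>norm x\<close> says that \<open>L\<close> is bounded below. Since
  \<open>L\<close> may fail to be onto, slices of a function of two variables are covered as well as
  dilations and reflections.\<close>

lemma schwartz_compose_affine:
  fixes L :: "'a::euclidean_space \<Rightarrow> 'b::euclidean_space"
  assumes f: "f \<in> schwartz" and lin: "linear L" and L: "\<And>x. norm x \<le> C * norm (L x)"
  shows "(\<lambda>x. f (L x + v)) \<in> schwartz"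
proof (rule schwartz_coinduct[of "\<lambda>h. \<exists>f\<in>schwartz. h = (\<lambda>x. f (L x + v))"])
  fix h :: "'a \<Rightarrow> complex" assume "\<exists>f\<in>schwartz. h = (\<lambda>x. f (L x + v))"
  then obtain f where f: "f \<in> schwartz" and h: "h = (\<lambda>x. f (L x + v))" by blast
  show "rapid h" unfolding h using f L by (intro rapid_compose_affine schwartz_rapid)
  have 1: "((\<lambda>x. L x + v) has_derivative L) (at x)" for x
    using linear_imp_has_derivative[OF lin] by (auto intro!: derivative_eq_intros)
  show "\<exists>D. (\<forall>x. (h has_derivative D x) (at x)) \<and>
      (\<forall>b\<in>Basis. \<exists>f\<in>schwartz. (\<lambda>x. D x b) = (\<lambda>x. f (L x + v)))"
  proof (intro exI conjI allI ballI)
    show "(h has_derivative (\<lambda>u. dderiv (L u) f (L x + v))) (at x)" for x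
      unfolding h using has_derivative_compose[OF 1 schwartz_has_derivative[OF f]] .
    fix b :: 'a assume "b \<in> Basis"
    show "\<exists>f'\<in>schwartz. (\<lambda>x. dderiv (L b) f (L x + v)) = (\<lambda>x. f' (L x + v))"
      using schwartz_dderiv_gen[OF f] by blast
  qed
qed (use f in blast)

lemma schwartz_dilate:
  assumes f: "f \<in> schwartz" and c: "c > 0" shows "(\<lambda>x. f (c *\<^sub>R x + v)) \<in> schwartz"
  by (rule schwartz_compose_affine[OF f, of _ "inverse c"]) (use c in \<open>auto simp: linear_iff scaleR_add_right field_simps\<close>)

lemma schwartz_slice_fst:
  fixes a :: "'a::euclidean_space \<times> 'b::euclidean_space \<Rightarrow> complex"
  assumes "a \<in> schwartz" shows "(\<lambda>x. a (x, y)) \<in> schwartz"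
  using schwartz_compose_affine[OF assms, of "\<lambda>x. (x, 0)" 1 "(0, y)"]
  by (simp add: linear_iff norm_Pair)

lemma schwartz_slice_snd:
  fixes a :: "'a::euclidean_space \<times> 'b::euclidean_space \<Rightarrow> complex"
  assumes "a \<in> schwartz" shows "(\<lambda>y. a (x, y)) \<in> schwartz"
  using schwartz_compose_affine[OF assms, of "\<lambda>y. (0, y)" 1 "(x, 0)"]
  by (simp add: linear_iff norm_Pair)

lemma schwartz_dilate_prod:
  fixes a :: "'a::euclidean_space \<times> 'b::euclidean_space \<Rightarrow> complex"
  assumes a: "a \<in> schwartz" and c: "c > 0" "d > 0"
  shows "(\<lambda>z. a (c *\<^sub>R fst z + v, d *\<^sub>R snd z)) \<in> schwartz"
proof -
  have le: "norm (x::'a, y::'b) \<le> (inverse c + inverse d) * norm (c *\<^sub>R x, d *\<^sub>R y)" for x y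
  proof -
    have "norm (x, y) \<le> norm x + norm y" by (rule norm_Pair_le)
    also have "\<dots> = inverse c * norm (c *\<^sub>R x) + inverse d * norm (d *\<^sub>R y)"
      using c by (simp add: field_simps)
    also have "\<dots> \<le> inverse c * norm (c *\<^sub>R x, d *\<^sub>R y) + inverse d * norm (c *\<^sub>R x, d *\<^sub>R y)"
      using c by (intro add_mono mult_left_mono) (auto simp: norm_Pair)
    finally show ?thesis by (simp add: algebra_simps)
  qed
  have "(\<lambda>z. a ((c *\<^sub>R fst z, d *\<^sub>R snd z) + (v, 0))) \<in> schwartz"
    by (rule schwartz_compose_affine[OF a, of _ "inverse c + inverse d"])
      (auto simp: linear_iff scaleR_add_right intro: le)
  then show ?thesis by simp
qed

lemma dderiv_slice_fst:
  fixes a :: "'a::euclidean_space \<times> 'b::euclidean_space \<Rightarrow> complex"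
  assumes a: "a \<in> schwartz"
  shows "dderiv v (\<lambda>x. a (x, y)) x = dderiv (v, 0) a (x, y)"
proof -
  have "((\<lambda>x. (x, y)) has_derivative (\<lambda>v. (v, 0))) (at x)"
    by (auto intro!: derivative_eq_intros)
  from has_derivative_compose[OF this schwartz_has_derivative[OF a]]
  show ?thesis by (rule dderiv_eq)
qed

lemma schwartz_continuous: "f \<in> schwartz \<Longrightarrow> continuous_on UNIV f"
  by (auto intro!: continuous_at_imp_continuous_on differentiable_imp_continuous_within schwartz_differentiable)

lemma schwartz_measurable: "f \<in> schwartz \<Longrightarrow> f \<in> borel_measurable borel"
  by (intro borel_measurable_continuous_onI schwartz_continuous)

lemma schwartz_bound:
  assumes "f \<in> schwartz"
  obtains C where "C > 0" "\<And>x. norm (f x) \<le> C / (1 + norm x) ^ N"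
proof -
  from rapidD[OF schwartz_rapid[OF assms], of N] obtain C
    where "C > 0" "\<And>x. (1 + norm x) ^ N * norm (f x) \<le> C" by blast
  then show thesis using that[of C] by (simp add: field_simps add_pos_nonneg)
qed

lemma schwartz_integrable:
  fixes f :: "'a::euclidean_space \<Rightarrow> complex"
  assumes f: "f \<in> schwartz" shows "integrable lborel f"
proof -
  obtain C where C: "C > 0" "\<And>x. norm (f x) \<le> C / (1 + norm x) ^ (2 * DIM('a))"
    using schwartz_bound[OF f] by metis
  show ?thesis
  proof (rule Bochner_Integration.integrable_bound)
    show "integrable lborel (\<lambda>x::'a. C * (1 / (1 + norm x) ^ (2 * DIM('a))))"
      using integrable_inverse_norm_power[of "2 * DIM('a)"] by (intro integrable_mult_right) auto
    show "AE x in lborel. norm (f x) \<le> norm (C * (1 / (1 + norm x) ^ (2 * DIM('a))))"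
      using C by (auto intro!: always_eventually order_trans[OF C(2)])
  qed (use schwartz_measurable[OF f] in simp)
qed


section \<open>The Fourier transform on Schwartz functions\<close>

text \<open>Stated for rapid decay alone because it is applied to \<open>norm x\<close> times a
  Schwartz function, which may fail to be smooth at the origin.\<close>

lemma integrable_rapid:
  fixes f :: "'a::euclidean_space \<Rightarrow> complex"
  assumes f: "rapid f" and [measurable]: "f \<in> borel_measurable borel"
  shows "integrable lborel f"
proof -
  obtain C where C: "C > 0" "\<And>x. (1 + norm x) ^ (2 * DIM('a)) * norm (f x) \<le> C"
    using rapidD[OF f] by metis
  show ?thesis
  proof (rule Bochner_Integration.integrable_bound)
    show "integrable lborel (\<lambda>x::'a. C * (1 / (1 + norm x) ^ (2 * DIM('a))))"
      using integrable_inverse_norm_power[of "2 * DIM('a)"] by (intro integrable_mult_right) auto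
    have "norm (f x) \<le> C * (1 / (1 + norm x) ^ (2 * DIM('a)))" for x
      using C(2)[of x] by (simp add: field_simps add_pos_nonneg)
    then show "AE x in lborel. norm (f x) \<le> norm (C * (1 / (1 + norm x) ^ (2 * DIM('a))))"
      using C(1) by simp
  qed simp
qed

text \<open>By translation invariance the integral of \<open>g (x + t v)\<close> is constant in
  \<open>t\<close>; differentiating under the integral at \<open>t = 0\<close> gives the
  claim.\<close>

lemma integral_dderiv_eq_0:
  fixes g :: "'a::euclidean_space \<Rightarrow> complex"
  assumes g: "g \<in> schwartz"
  shows "(LBINT x. dderiv v g x) = 0"
proof -
  let ?m = "2 * DIM('a)"
  obtain C where C: "C > 0" "\<And>x. norm (dderiv v g x) \<le> C / (1 + norm x) ^ ?m"
    using schwartz_bound[OF schwartz_dderiv_gen[OF g]] by metis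
  let ?H = "\<lambda>x::'a. C * (1 + norm v) ^ ?m * (1 / (1 + norm x) ^ ?m)"
  have "((\<lambda>t. LBINT x. g (x + t *\<^sub>R v)) has_derivative (\<lambda>s. LBINT x. s *\<^sub>R dderiv v g (x + 0 *\<^sub>R v))) (at 0)"
  proof (rule has_derivative_under_integral[where r=1 and H="?H"])
    have S: "(\<lambda>x. g (x + t *\<^sub>R v)) \<in> schwartz" for t
      using schwartz_dilate[OF g, of 1 "t *\<^sub>R v"] by simp
    show "integrable lborel (\<lambda>x. g (x + t *\<^sub>R v))" for t
      by (rule schwartz_integrable[OF S])
    show "integrable lborel (\<lambda>x. s *\<^sub>R dderiv v g (x + 0 *\<^sub>R v))" for s
      using schwartz_integrable[OF schwartz_dderiv_gen[OF g]] by simp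
    show "((\<lambda>t. g (x + t *\<^sub>R v)) has_derivative (\<lambda>s. s *\<^sub>R dderiv v g (x + t *\<^sub>R v))) (at t)" for x t
    proof -
      have 1: "((\<lambda>t. x + t *\<^sub>R v) has_derivative (\<lambda>s. s *\<^sub>R v)) (at t)"
        by (auto intro!: derivative_eq_intros)
      show ?thesis
        using has_derivative_compose[OF 1 schwartz_has_derivative[OF g]]
          linear_cmul[OF has_derivative_linear[OF schwartz_has_derivative[OF g]]] by simp
    qed
    show "norm (s *\<^sub>R dderiv v g (x + t *\<^sub>R v)) \<le> ?H x * norm s" if "t \<in> ball 0 1" for x t s
    proof -
      have *: "1 / b \<le> c / a" if "a \<le> c * b" "0 < a" "0 < b" for a b c :: real
        using that by (simp add: field_simps)
      \<comment> \<open>A translation by at most \<open>norm v\<close> changes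
        \<open>1 + norm x\<close> by at most the factor \<open>1 + norm v\<close>; this makes the
        dominating function independent of \<open>t\<close>.\<close>
      have "norm x \<le> norm (x + t *\<^sub>R v) + norm (t *\<^sub>R v)"
        using norm_triangle_ineq4[of "x + t *\<^sub>R v" "t *\<^sub>R v"] by simp
      also have "norm (t *\<^sub>R v) \<le> norm v" using that by (simp add: mult_left_le_one_le)
      finally have "1 + norm x \<le> (1 + norm v) * (1 + norm (x + t *\<^sub>R v))"
        using mult_nonneg_nonneg[OF norm_ge_zero[of v] norm_ge_zero[of "x + t *\<^sub>R v"]]
        unfolding ring_distribs by linarith
      then have "(1 + norm x) ^ ?m \<le> ((1 + norm v) * (1 + norm (x + t *\<^sub>R v))) ^ ?m"
        by (intro power_mono) auto
      then have "1 / (1 + norm (x + t *\<^sub>R v)) ^ ?m \<le> (1 + norm v) ^ ?m / (1 + norm x) ^ ?m"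
        unfolding power_mult_distrib by (intro *) (auto intro!: zero_less_power add_pos_nonneg)
      then have "C * (1 / (1 + norm (x + t *\<^sub>R v)) ^ ?m) \<le> C * ((1 + norm v) ^ ?m / (1 + norm x) ^ ?m)"
        using C(1) by (intro mult_left_mono) auto
      then have "norm (dderiv v g (x + t *\<^sub>R v)) \<le> ?H x"
        using C(2)[of "x + t *\<^sub>R v"] by (simp only: times_divide_eq_right mult_1_right)
      from mult_left_mono[OF this, of "\<bar>s\<bar>"] show ?thesis
        unfolding norm_scaleR real_norm_def by (simp only: abs_ge_zero mult.commute)
    qed
    show "integrable lborel ?H"
      using integrable_inverse_norm_power[of ?m] by (intro integrable_mult_right) auto
  qed simp
  moreover have "(LBINT x. g (x + t *\<^sub>R v)) = (LBINT x. g x)" for t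
    using integral_lborel_affine[of 1 g "t *\<^sub>R v"] schwartz_measurable[OF g] by (simp add: add.commute)
  ultimately have "((\<lambda>t::real. LBINT x. g x) has_derivative (\<lambda>s. LBINT x. s *\<^sub>R dderiv v g (x + 0 *\<^sub>R v))) (at 0)"
    by simp
  from has_derivative_unique[OF this has_derivative_const]
  have "(LBINT x. 1 *\<^sub>R dderiv v g (x + 0 *\<^sub>R v)) = 0" by (rule fun_cong)
  then show ?thesis by simp
qed

lemma fourier_eq: "fourier f \<xi> = (LBINT x. cis (x \<bullet> - \<xi>) * f x)"
  by (simp add: fourier_def mult.commute)

text \<open>Integration by parts, in the form that the derivative of the Schwartz function
  \<open>cis (x \<bullet> - \<xi>) * f x\<close> has integral zero.\<close>

lemma fourier_dderiv:
  fixes f :: "'a::euclidean_space \<Rightarrow> complex"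
  assumes f: "f \<in> schwartz"
  shows "fourier (dderiv v f) \<xi> = \<i> * of_real (v \<bullet> \<xi>) * fourier f \<xi>"
proof -
  let ?g = "\<lambda>x. cis (x \<bullet> - \<xi>) * f x"
  have g: "?g \<in> schwartz" by (rule schwartz_cis_mult[OF f])
  have 1: "((\<lambda>x. cis (x \<bullet> - \<xi>)) has_derivative (\<lambda>u. \<i> * of_real (u \<bullet> - \<xi>) * cis (x \<bullet> - \<xi>))) (at x)" for x
    by (rule has_derivative_cis) (auto intro!: derivative_eq_intros)
  have "dderiv v ?g x = cis (x \<bullet> - \<xi>) * dderiv v f x + \<i> * of_real (v \<bullet> - \<xi>) * cis (x \<bullet> - \<xi>) * f x" for x
    by (rule dderiv_eq[OF has_derivative_mult[OF 1 schwartz_has_derivative[OF f]]])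
  then have "0 = (LBINT x. cis (x \<bullet> - \<xi>) * dderiv v f x + (\<i> * of_real (v \<bullet> - \<xi>)) * ?g x)"
    using integral_dderiv_eq_0[OF g, of v] by (simp add: mult.assoc)
  also have "\<dots> = (LBINT x. cis (x \<bullet> - \<xi>) * dderiv v f x) + (LBINT x. (\<i> * of_real (v \<bullet> - \<xi>)) * ?g x)"
    by (intro Bochner_Integration.integral_add schwartz_integrable schwartz_cmult g schwartz_cis_mult schwartz_dderiv_gen f)
  also have "\<dots> = fourier (dderiv v f) \<xi> + (\<i> * of_real (v \<bullet> - \<xi>)) * fourier f \<xi>"
    unfolding fourier_eq by simp
  finally show ?thesis by (simp add: algebra_simps add_eq_0_iff2)
qed

lemma fourier_norm_le: "f \<in> schwartz \<Longrightarrow> norm (fourier f \<xi>) \<le> (LBINT x. norm (f x))"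
  unfolding fourier_eq by (rule order_trans[OF integral_norm_bound]) (simp add: norm_mult)

text \<open>Induction on \<open>N\<close>: a further factor \<open>1 + norm \<xi>\<close> is bounded
  by 1 plus the sum of the \<open>\<bar>\<xi> \<bullet> b\<bar>\<close>, and each of these is traded
  for a derivative of \<open>f\<close>. The family index makes the constant uniform, so that a
  frozen second variable can later play its role.\<close>

lemma fourier_decay:
  fixes f :: "'i \<Rightarrow> 'a::euclidean_space \<Rightarrow> complex"
  assumes "\<And>i. f i \<in> schwartz"
    and "\<And>bs. set bs \<subseteq> Basis \<Longrightarrow> \<exists>C. \<forall>i x. (1 + norm x) ^ (2 * DIM('a)) * norm (partials bs (f i) x) \<le> C"
  shows "\<exists>C. \<forall>i \<xi>. (1 + norm \<xi>) ^ N * norm (fourier (f i) \<xi>) \<le> C"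
  using assms
proof (induction N arbitrary: f)
  case 0
  let ?k = "\<lambda>x::'a. 1 / (1 + norm x) ^ (2 * DIM('a))"
  from "0.prems"(2)[of "[]"] obtain C where C: "\<And>i x. (1 + norm x) ^ (2 * DIM('a)) * norm (f i x) \<le> C" by auto
  have "norm (fourier (f i) \<xi>) \<le> (LBINT x. C * ?k x)" for i \<xi>
  proof (rule order_trans[OF fourier_norm_le[OF "0.prems"(1)] integral_mono])
    show "integrable lborel (\<lambda>x::'a. C * ?k x)"
      using integrable_inverse_norm_power[of "2 * DIM('a)"] by (intro integrable_mult_right) auto
    show "norm (f i x) \<le> C * ?k x" for x
      using C[of x i] by (simp add: field_simps add_pos_nonneg)
  qed (use "0.prems"(1) schwartz_integrable in auto)
  then show ?case by auto
next
  case (Suc N)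
  obtain C where C: "\<And>i \<xi>. (1 + norm \<xi>) ^ N * norm (fourier (f i) \<xi>) \<le> C"
    using Suc.IH[OF Suc.prems] by blast
  have "\<exists>D. \<forall>i \<xi>. (1 + norm \<xi>) ^ N * norm (fourier (dderiv b (f i)) \<xi>) \<le> D" if b: "b \<in> Basis" for b
  proof (rule Suc.IH)
    show "dderiv b (f i) \<in> schwartz" for i using b Suc.prems by (intro schwartz_dderiv)
    show "\<exists>C. \<forall>i x. (1 + norm x) ^ (2 * DIM('a)) * norm (partials bs (dderiv b (f i)) x) \<le> C" if "set bs \<subseteq> Basis" for bs
      unfolding partials_snoc[symmetric] using that b by (intro Suc.prems) auto
  qed
  then obtain D where D: "\<And>b i \<xi>. b \<in> Basis \<Longrightarrow> (1 + norm \<xi>) ^ N * norm (fourier (dderiv b (f i)) \<xi>) \<le> D b"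
    by metis
  have "(1 + norm \<xi>) ^ Suc N * norm (fourier (f i) \<xi>) \<le> C + (\<Sum>b\<in>Basis. D b)" for i \<xi>
  proof -
    have "(1 + norm \<xi>) ^ Suc N * norm (fourier (f i) \<xi>) =
       (1 + norm \<xi>) * ((1 + norm \<xi>) ^ N * norm (fourier (f i) \<xi>))" by simp
    also have "\<dots> \<le> (1 + (\<Sum>b\<in>Basis. \<bar>\<xi> \<bullet> b\<bar>)) * ((1 + norm \<xi>) ^ N * norm (fourier (f i) \<xi>))"
      using norm_le_l1[of \<xi>] by (intro mult_right_mono) auto
    also have "\<dots> = (1 + norm \<xi>) ^ N * norm (fourier (f i) \<xi>)
        + (\<Sum>b\<in>Basis. (1 + norm \<xi>) ^ N * norm (fourier (dderiv b (f i)) \<xi>))"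
      using Suc.prems(1)
      by (simp add: fourier_dderiv norm_mult inner_commute algebra_simps sum_distrib_left)
    also have "\<dots> \<le> C + (\<Sum>b\<in>Basis. D b)" by (intro add_mono sum_mono C D)
    finally show ?thesis .
  qed
  then show ?case by blast
qed

lemma fourier_has_derivative:
  fixes f :: "'a::euclidean_space \<Rightarrow> complex"
  assumes f: "f \<in> schwartz"
  shows "(fourier f has_derivative (\<lambda>v. fourier (\<lambda>x. - \<i> * (of_real (x \<bullet> v) * f x)) \<xi>)) (at \<xi>)"
proof -
  have "((\<lambda>\<xi>. LBINT x. f x * cis (- (x \<bullet> \<xi>))) has_derivative
      (\<lambda>v. LBINT x. (- \<i> * (of_real (x \<bullet> v) * f x)) * cis (- (x \<bullet> \<xi>)))) (at \<xi>)"
  proof (rule has_derivative_under_integral[where r=1 and H="\<lambda>x. norm (of_real (norm x) * f x)"])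
    show "integrable lborel (\<lambda>x. f x * cis (- (x \<bullet> \<xi>)))" for \<xi>
      using schwartz_integrable[OF schwartz_cis_mult[OF f, of "-\<xi>"]] by (simp add: mult.commute)
    show "integrable lborel (\<lambda>x. (- \<i> * (of_real (x \<bullet> v) * f x)) * cis (- (x \<bullet> \<xi>)))" for v
      using schwartz_integrable[OF schwartz_cis_mult[OF schwartz_cmult[OF schwartz_inner_mult[OF f, of v]], of "-\<xi>" "-\<i>"]]
      by (simp add: mult_ac)
    show "((\<lambda>\<xi>. f x * cis (- (x \<bullet> \<xi>))) has_derivative (\<lambda>v. (- \<i> * (of_real (x \<bullet> v) * f x)) * cis (- (x \<bullet> \<xi>)))) (at \<xi>)" for \<xi> x
    proof -
      have "((\<lambda>\<xi>. cis (- (x \<bullet> \<xi>))) has_derivative (\<lambda>v. \<i> * of_real (- (x \<bullet> v)) * cis (- (x \<bullet> \<xi>)))) (at \<xi>)"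
        by (rule has_derivative_cis) (auto intro!: derivative_eq_intros)
      from has_derivative_mult_right[OF this, of "f x"] show ?thesis by (simp add: mult_ac)
    qed
    show "norm ((- \<i> * (of_real (x \<bullet> v) * f x)) * cis (- (x \<bullet> \<xi>))) \<le> norm (of_real (norm x) * f x) * norm v" for x v \<xi>
      using mult_right_mono[OF Cauchy_Schwarz_ineq2[of x v] norm_ge_zero[of "f x"]]
      by (simp add: norm_mult mult_ac)
    show "integrable lborel (\<lambda>x. norm (of_real (norm x) * f x))"
    proof (intro integrable_norm integrable_rapid)
      show "rapid (\<lambda>x. of_real (norm x) * f x)"
        by (rule rapid_growth[OF schwartz_rapid[OF f], of _ 1 1]) (simp add: norm_mult mult_right_mono)
    qed (use schwartz_measurable[OF f] in measurable)
  qed simp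
  then show ?thesis unfolding fourier_def[abs_def] .
qed

lemma fourier_schwartz:
  fixes f :: "'a::euclidean_space \<Rightarrow> complex"
  assumes f: "f \<in> schwartz"
  shows "fourier f \<in> schwartz"
proof (rule schwartz_coinduct[of "\<lambda>h. \<exists>f\<in>schwartz. h = fourier f"])
  fix h :: "'a \<Rightarrow> complex" assume "\<exists>f\<in>schwartz. h = fourier f"
  then obtain f where f: "f \<in> schwartz" and h: "h = fourier f" by blast
  show "rapid h" unfolding rapid_def h
  proof
    fix N
    have "\<exists>C. \<forall>(i::unit) \<xi>. (1 + norm \<xi>) ^ N * norm (fourier f \<xi>) \<le> C"
      by (rule fourier_decay) (use f schwartz_rapid[OF schwartz_partials[OF f]] in \<open>auto simp: rapid_def\<close>)
    then show "\<exists>C. \<forall>x. (1 + norm x) ^ N * norm (fourier f x) \<le> C" by simp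
  qed
  show "\<exists>D. (\<forall>x. (h has_derivative D x) (at x)) \<and> (\<forall>b\<in>Basis. \<exists>f\<in>schwartz. (\<lambda>x. D x b) = fourier f)"
  proof (intro exI conjI allI ballI)
    show "(h has_derivative (\<lambda>v. fourier (\<lambda>x. - \<i> * (of_real (x \<bullet> v) * f x)) \<xi>)) (at \<xi>)" for \<xi>
      unfolding h by (rule fourier_has_derivative[OF f])
    show "\<exists>f'\<in>schwartz. (\<lambda>\<xi>. fourier (\<lambda>x. - \<i> * (of_real (x \<bullet> b) * f x)) \<xi>) = fourier f'" for b
      by (rule bexI[OF _ schwartz_cmult[OF schwartz_inner_mult[OF f, of b], of "- \<i>"]]) simp
  qed
qed (use f in blast)

section \<open>Fourier inversion\<close>

lemma integrable_pair_mult: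
  fixes f :: "'a \<Rightarrow> complex" and g :: "'b \<Rightarrow> complex"
  assumes "sigma_finite_measure M" "sigma_finite_measure M'" and f: "integrable M f" and g: "integrable M' g"
  shows "integrable (M \<Otimes>\<^sub>M M') (\<lambda>z. f (fst z) * g (snd z))"
proof -
  interpret M: sigma_finite_measure M by fact
  interpret M': sigma_finite_measure M' by fact
  interpret pair_sigma_finite M M' ..
  have [measurable]: "f \<in> borel_measurable M" "g \<in> borel_measurable M'" using f g by auto
  show ?thesis
    by (rule Fubini_integrable) (use f g in \<open>auto simp: norm_mult\<close>)
qed

text \<open>The Gaussian factor makes the double integral absolutely convergent, so that Fubini
  applies and the inner integral over the frequency becomes a Gaussian of width \<open>t\<close>
  around \<open>x\<close>. The substitution \<open>y = x + t z\<close> then removes \<open>t\<close>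
  from that Gaussian.\<close>

lemma gaussian_fourier_swap:
  fixes f :: "'a::euclidean_space \<Rightarrow> complex"
  assumes f: "f \<in> schwartz" and t: "t > 0"
  shows "(LBINT \<xi>. fourier f \<xi> * cis (x \<bullet> \<xi>) * of_real (exp (- (t * norm \<xi>)\<^sup>2 / 2)))
    = of_real (sqrt (2 * pi) ^ DIM('a)) * (LBINT z. f (x + t *\<^sub>R z) * of_real (exp (- (norm z)\<^sup>2 / 2)))"
proof -
  let ?g = "\<lambda>\<xi>::'a. complex_of_real (exp (- (t * norm \<xi>)\<^sup>2 / 2))"
  let ?F = "\<lambda>\<xi> y. f y * (cis (\<xi> \<bullet> (x - y)) * ?g \<xi>)"
  have [measurable]: "f \<in> borel_measurable borel" by (rule schwartz_measurable[OF f])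
  have g: "integrable lborel ?g"
    using integrable_gaussian_cis_euclidean[OF t, of 0] by simp
  have int: "integrable (lborel \<Otimes>\<^sub>M lborel) (case_prod ?F)"
  proof (rule Bochner_Integration.integrable_bound)
    show "integrable (lborel \<Otimes>\<^sub>M lborel) (\<lambda>z. ?g (fst z) * f (snd z))"
      by (intro integrable_pair_mult g schwartz_integrable f lborel.sigma_finite_measure_axioms)
  qed (auto simp: norm_mult)
  have "(LBINT \<xi>. fourier f \<xi> * cis (x \<bullet> \<xi>) * ?g \<xi>) = (LBINT \<xi>. LBINT y. ?F \<xi> y)"
  proof (rule Bochner_Integration.integral_cong[OF refl])
    fix \<xi>
    have *: "cis (\<xi> \<bullet> (x - y)) = cis (- (y \<bullet> \<xi>)) * cis (x \<bullet> \<xi>)" for y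
      by (simp add: cis_mult inner_diff_right inner_commute)
    have "(LBINT y. ?F \<xi> y) = (LBINT y. (f y * cis (- (y \<bullet> \<xi>))) * (cis (x \<bullet> \<xi>) * ?g \<xi>))"
      unfolding * by (simp only: mult.assoc)
    also have "\<dots> = fourier f \<xi> * (cis (x \<bullet> \<xi>) * ?g \<xi>)"
      unfolding fourier_def by (rule integral_mult_left_zero)
    finally show "fourier f \<xi> * cis (x \<bullet> \<xi>) * ?g \<xi> = (LBINT y. ?F \<xi> y)" by (simp add: mult.assoc)
  qed
  also have "\<dots> = (LBINT y. LBINT \<xi>. ?F \<xi> y)"
    by (rule lborel_pair.Fubini_integral[OF int, symmetric])
  also have "\<dots> = (LBINT y. f y * of_real ((sqrt (2 * pi) / t) ^ DIM('a) * exp (- (norm (x - y) / t)\<^sup>2 / 2)))"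
    by (simp add: integral_gaussian_cis_euclidean[OF t, simplified])
  also have "\<dots> = t ^ DIM('a) *\<^sub>R (LBINT z. f (x + t *\<^sub>R z) * of_real ((sqrt (2 * pi) / t) ^ DIM('a) * exp (- (norm (x - (x + t *\<^sub>R z)) / t)\<^sup>2 / 2)))"
    by (rule integral_lborel_affine[OF t]) measurable
  also have "\<dots> = t ^ DIM('a) *\<^sub>R (LBINT z. of_real ((sqrt (2 * pi) / t) ^ DIM('a)) * (f (x + t *\<^sub>R z) * of_real (exp (- (norm z)\<^sup>2 / 2))))"
    using t by (simp add: mult_ac)
  also have "\<dots> = of_real (t ^ DIM('a) * (sqrt (2 * pi) / t) ^ DIM('a)) * (LBINT z. f (x + t *\<^sub>R z) * of_real (exp (- (norm z)\<^sup>2 / 2)))"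
    by (simp add: scaleR_conv_of_real)
  also have "t ^ DIM('a) * (sqrt (2 * pi) / t) ^ DIM('a) = sqrt (2 * pi) ^ DIM('a)"
    using t by (simp add: power_divide)
  finally show ?thesis .
qed

text \<open>Both sides of \<open>gaussian_fourier_swap\<close> converge as the width tends to 0. The
  constant is \<open>sqrt (2 * pi) ^ d\<close> from the Fourier transform of the Gaussian times the
  same number as its total mass.\<close>

theorem fourier_inversion:
  fixes f :: "'a::euclidean_space \<Rightarrow> complex"
  assumes f: "f \<in> schwartz"
  shows "(LBINT \<xi>. fourier f \<xi> * cis (x \<bullet> \<xi>)) = of_real ((2 * pi) ^ DIM('a)) * f x"
proof -
  define t where "t n = inverse (real (Suc n))" for n
  have t: "t n > 0" for n by (simp add: t_def)
  have t0: "t \<longlonglongrightarrow> 0" unfolding t_def by (rule LIMSEQ_inverse_real_of_nat)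
  let ?I = "\<lambda>n. LBINT \<xi>. fourier f \<xi> * cis (x \<bullet> \<xi>) * of_real (exp (- (t n * norm \<xi>)\<^sup>2 / 2))"
  let ?G = "\<lambda>z::'a. complex_of_real (exp (- (norm z)\<^sup>2 / 2))"
  have [measurable]: "f \<in> borel_measurable borel" "fourier f \<in> borel_measurable borel"
    by (auto intro: schwartz_measurable f fourier_schwartz)
  have "?I \<longlonglongrightarrow> (LBINT \<xi>. fourier f \<xi> * cis (x \<bullet> \<xi>))"
  proof (rule integral_dominated_convergence[where w="\<lambda>\<xi>. norm (fourier f \<xi>)"])
    show "integrable lborel (\<lambda>\<xi>. norm (fourier f \<xi>))"
      by (intro integrable_norm schwartz_integrable fourier_schwartz f)
    show "AE \<xi> in lborel. (\<lambda>n. fourier f \<xi> * cis (x \<bullet> \<xi>) * of_real (exp (- (t n * norm \<xi>)\<^sup>2 / 2))) \<longlonglongrightarrow> fourier f \<xi> * cis (x \<bullet> \<xi>)"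
      by (auto intro!: always_eventually tendsto_eq_intros t0)
    show "AE \<xi> in lborel. norm (fourier f \<xi> * cis (x \<bullet> \<xi>) * of_real (exp (- (t n * norm \<xi>)\<^sup>2 / 2))) \<le> norm (fourier f \<xi>)" for n
      by (auto intro!: always_eventually mult_right_le_one_le simp: norm_mult)
  qed measurable
  moreover have "?I \<longlonglongrightarrow> of_real (sqrt (2 * pi) ^ DIM('a)) * (LBINT z. f x * ?G z)"
    unfolding gaussian_fourier_swap[OF f t]
  proof (intro tendsto_mult tendsto_const)
    obtain C where C: "C > 0" "\<And>x. norm (f x) \<le> C / (1 + norm x) ^ 0" using schwartz_bound[OF f] by metis
    show "(\<lambda>n. LBINT z. f (x + t n *\<^sub>R z) * ?G z) \<longlonglongrightarrow> (LBINT z. f x * ?G z)"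
    proof (rule integral_dominated_convergence[where w="\<lambda>z. C * norm (?G z)"])
      show "integrable lborel (\<lambda>z. C * norm (?G z))"
        using integrable_gaussian_cis_euclidean[of 1 "0::'a"] by (intro integrable_mult_right integrable_norm) simp
      show "AE z in lborel. (\<lambda>n. f (x + t n *\<^sub>R z) * ?G z) \<longlonglongrightarrow> f x * ?G z"
      proof (intro always_eventually allI tendsto_mult tendsto_const)
        fix z
        have "(\<lambda>n. x + t n *\<^sub>R z) \<longlonglongrightarrow> x" by (auto intro!: tendsto_eq_intros t0)
        moreover have "isCont f x" using schwartz_continuous[OF f] by (simp add: continuous_on_eq_continuous_at)
        ultimately show "(\<lambda>n. f (x + t n *\<^sub>R z)) \<longlonglongrightarrow> f x" by (rule isCont_tendsto_compose[rotated])
      qed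
      show "AE z in lborel. norm (f (x + t n *\<^sub>R z) * ?G z) \<le> C * norm (?G z)" for n
        using C by (auto intro!: always_eventually mult_right_mono simp: norm_mult)
    qed measurable
  qed
  ultimately have "(LBINT \<xi>. fourier f \<xi> * cis (x \<bullet> \<xi>)) = of_real (sqrt (2 * pi) ^ DIM('a)) * (LBINT z. f x * ?G z)"
    by (rule LIMSEQ_unique)
  also have "(LBINT z. f x * ?G z) = f x * of_real (sqrt (2 * pi) ^ DIM('a))"
    using integral_gaussian_cis_euclidean[of 1 "0::'a"] by simp
  finally have "(LBINT \<xi>. fourier f \<xi> * cis (x \<bullet> \<xi>))
      = of_real (sqrt (2 * pi) ^ DIM('a) * sqrt (2 * pi) ^ DIM('a)) * f x"
    unfolding of_real_mult by (simp only: mult_ac)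
  also have "sqrt (2 * pi) ^ DIM('a) * sqrt (2 * pi) ^ DIM('a) = (2 * pi) ^ DIM('a)"
    unfolding power_mult_distrib[symmetric] by simp
  finally show ?thesis .
qed

definition inv_fourier :: "('a::euclidean_space \<Rightarrow> complex) \<Rightarrow> 'a \<Rightarrow> complex" where
  "inv_fourier f \<xi> = of_real (1 / (2 * pi) ^ DIM('a)) * (LBINT x. f x * cis (x \<bullet> \<xi>))"

lemma
  fixes f :: "'a::euclidean_space \<Rightarrow> complex"
  assumes f: "f \<in> schwartz"
  shows inv_fourier_schwartz: "inv_fourier f \<in> schwartz"
    and fourier_inv_fourier: "fourier (inv_fourier f) = f"
proof -
  have eq: "inv_fourier f = (\<lambda>\<xi>. of_real (1 / (2 * pi) ^ DIM('a)) * fourier f (- \<xi>))"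
    by (auto simp: inv_fourier_def fourier_def)
  have "(\<lambda>\<xi>. fourier f (- \<xi> + 0)) \<in> schwartz"
    by (rule schwartz_compose_affine[OF fourier_schwartz[OF f], of _ 1]) (auto simp: linear_iff)
  then show "inv_fourier f \<in> schwartz" unfolding eq by (intro schwartz_cmult) simp
  have [measurable]: "fourier f \<in> borel_measurable borel"
    by (auto intro: schwartz_measurable f fourier_schwartz)
  show "fourier (inv_fourier f) = f"
  proof
    fix x
    have "fourier (inv_fourier f) x = (LBINT \<xi>. of_real (1 / (2 * pi) ^ DIM('a)) * (fourier f (0 - \<xi>) * cis (x \<bullet> (0 - \<xi>))))"
      unfolding fourier_def[of "inv_fourier f"]
      by (intro Bochner_Integration.integral_cong) (auto simp: eq inner_commute)
    also have "\<dots> = of_real (1 / (2 * pi) ^ DIM('a)) * (LBINT \<xi>. fourier f (0 - \<xi>) * cis (x \<bullet> (0 - \<xi>)))"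
      by simp
    also have "(LBINT \<xi>. fourier f (0 - \<xi>) * cis (x \<bullet> (0 - \<xi>))) = (LBINT \<xi>. fourier f \<xi> * cis (x \<bullet> \<xi>))"
      by (rule integral_lborel_uminus) measurable
    finally show "fourier (inv_fourier f) x = f x" by (simp add: fourier_inversion[OF f])
  qed
qed

text \<open>\<open>F\<close> describes \<open>u\<close> only on Fourier transforms of Schwartz
  functions; by inversion every Schwartz function is one.\<close>

lemma has_fourier_function_apply:
  assumes "has_fourier_function u F" "f \<in> schwartz"
  shows "u f = (LBINT \<xi>. F \<xi> * inv_fourier f \<xi>)"
proof -
  have "u f = td_fourier u (inv_fourier f)"
    by (simp add: td_fourier_def fourier_inv_fourier[OF assms(2)])
  then show ?thesis
    using assms inv_fourier_schwartz[OF assms(2)] by (simp add: has_fourier_function_def)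
qed


section \<open>Integrals with a parameter and completeness of the Schwartz space\<close>

lemma schwartz_prod_bound:
  fixes a :: "'a::euclidean_space \<times> 'b::euclidean_space \<Rightarrow> complex"
  assumes a: "a \<in> schwartz"
  obtains C where "C > 0" "\<And>x y. (1 + norm x) ^ N * (1 + norm y) ^ M * norm (a (x, y)) \<le> C"
proof -
  obtain C where C: "C > 0" "\<And>z. (1 + norm z) ^ (N + M) * norm (a z) \<le> C"
    using rapidD[OF schwartz_rapid[OF a]] by metis
  have "(1 + norm x) ^ N * (1 + norm y) ^ M * norm (a (x, y)) \<le> C" for x y
  proof -
    have "norm x \<le> norm (x, y)" "norm y \<le> norm (x, y)" by (auto simp: norm_Pair)
    then have "(1 + norm x) ^ N * (1 + norm y) ^ M \<le> (1 + norm (x, y)) ^ N * (1 + norm (x, y)) ^ M"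
      by (intro mult_mono power_mono) auto
    from mult_right_mono[OF this, of "norm (a (x, y))"] show ?thesis
      using C(2)[of "(x, y)"] by (simp add: power_add)
  qed
  then show thesis using C(1) that by blast
qed

text \<open>The Fourier transform of \<open>\<phi>\<close> need not be continuous or bounded, so its
  growth is measured in an integrated sense. Multiplication by characters and other bounded factors
  preserves the class.\<close>

definition tempered_density :: "('b::euclidean_space \<Rightarrow> complex) \<Rightarrow> bool" where
  "tempered_density \<Omega> \<longleftrightarrow> \<Omega> \<in> borel_measurable borel \<and>
    (\<exists>M. integrable lborel (\<lambda>y. norm (\<Omega> y) / (1 + norm y) ^ M))"

definition param_integral ::
  "('b::euclidean_space \<Rightarrow> complex) \<Rightarrow> ('a \<times> 'b \<Rightarrow> complex) \<Rightarrow> 'a \<Rightarrow> complex" where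
  "param_integral \<Omega> a x = (LBINT y. \<Omega> y * a (x, y))"

lemma
  fixes a :: "'a::euclidean_space \<times> 'b::euclidean_space \<Rightarrow> complex"
  assumes \<Omega>: "tempered_density \<Omega>" and a: "a \<in> schwartz"
  shows tempered_density_integrable: "integrable lborel (\<lambda>y. \<Omega> y * a (x, y))"
    and tempered_density_integrable_pair: "integrable (lborel \<Otimes>\<^sub>M lborel) (\<lambda>z. \<Omega> (snd z) * a z)"
    and param_integral_bound: "\<exists>C. \<forall>x. (1 + norm x) ^ N * norm (param_integral \<Omega> a x) \<le> C"
proof -
  have [measurable]: "\<Omega> \<in> borel_measurable borel" using \<Omega> by (simp add: tempered_density_def)
  have [measurable]: "a \<in> borel_measurable borel" by (rule schwartz_measurable[OF a])
  obtain M where M: "integrable lborel (\<lambda>y. norm (\<Omega> y) / (1 + norm y) ^ M)"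
    using \<Omega> by (auto simp: tempered_density_def)
  \<comment> \<open>The decay of \<open>a\<close> is shared out: \<open>M\<close> powers in
    \<open>y\<close> pay for \<open>\<Omega>\<close>, and any number \<open>N\<close> of powers in
    \<open>x\<close> is left over.\<close>
  have bound: "\<exists>C>0. \<forall>x y. norm (\<Omega> y * a (x, y)) \<le> C / (1 + norm x) ^ N * (norm (\<Omega> y) / (1 + norm y) ^ M)" for N
  proof -
    obtain C where C: "C > 0" "\<And>x y. (1 + norm x) ^ N * (1 + norm y) ^ M * norm (a (x, y)) \<le> C"
      using schwartz_prod_bound[OF a] by metis
    have "norm (\<Omega> y * a (x, y)) \<le> C / (1 + norm x) ^ N * (norm (\<Omega> y) / (1 + norm y) ^ M)" for x y
    proof -
      have "norm (a (x, y)) \<le> C / ((1 + norm x) ^ N * (1 + norm y) ^ M)"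
        using C(2)[of x y] by (subst pos_le_divide_eq) (auto simp: mult.commute intro!: mult_pos_pos zero_less_power add_pos_nonneg)
      from mult_left_mono[OF this, of "norm (\<Omega> y)"] show ?thesis
        by (simp add: norm_mult mult.commute)
    qed
    with C(1) show ?thesis by blast
  qed
  have bound_int: "integrable lborel (\<lambda>y. C / (1 + norm x) ^ N * (norm (\<Omega> y) / (1 + norm y) ^ M))" for C N and x :: 'a
    using M by (rule integrable_mult_right)
  show int: "integrable lborel (\<lambda>y. \<Omega> y * a (x, y))" for x
  proof -
    obtain C where C: "C > 0" "\<And>x y. norm (\<Omega> y * a (x, y)) \<le> C / (1 + norm x) ^ 0 * (norm (\<Omega> y) / (1 + norm y) ^ M)"
      using bound by blast
    show ?thesis
    proof (rule Bochner_Integration.integrable_bound[OF bound_int])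
      show "AE y in lborel. norm (\<Omega> y * a (x, y)) \<le> norm (C / (1 + norm x) ^ 0 * (norm (\<Omega> y) / (1 + norm y) ^ M))"
        unfolding real_norm_def by (intro always_eventually allI order_trans[OF C(2)[of _ x] abs_ge_self])
    qed measurable
  qed
  show "integrable (lborel \<Otimes>\<^sub>M lborel) (\<lambda>z. \<Omega> (snd z) * a z)"
  proof -
    let ?N = "2 * DIM('a)"
    obtain C where C: "C > 0" "\<And>x y. norm (\<Omega> y * a (x, y)) \<le> C / (1 + norm x) ^ ?N * (norm (\<Omega> y) / (1 + norm y) ^ M)"
      using bound by blast
    have 1: "integrable lborel (\<lambda>x::'a. complex_of_real (C / (1 + norm x) ^ ?N))"
    proof -
      have "integrable lborel (\<lambda>x::'a. 1 / (1 + norm x) ^ ?N)"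
        by (rule integrable_inverse_norm_power) simp
      from integrable_mult_right[OF this, of C] show ?thesis by (intro integrable_of_real) simp
    qed
    show ?thesis
    proof (rule Bochner_Integration.integrable_bound)
      show "integrable (lborel \<Otimes>\<^sub>M lborel) (\<lambda>z. complex_of_real (C / (1 + norm (fst z :: 'a)) ^ ?N) * complex_of_real (norm (\<Omega> (snd z)) / (1 + norm (snd z)) ^ M))"
        using M by (intro integrable_pair_mult 1 integrable_of_real lborel.sigma_finite_measure_axioms)
      have [measurable]: "a \<in> borel_measurable (borel \<Otimes>\<^sub>M borel)"
        by (simp add: borel_prod)
      show "(\<lambda>z. \<Omega> (snd z) * a z) \<in> borel_measurable (lborel \<Otimes>\<^sub>M lborel)" by measurable
      have "norm (\<Omega> (snd z) * a z) \<le> norm (complex_of_real (C / (1 + norm (fst z :: 'a)) ^ ?N) * complex_of_real (norm (\<Omega> (snd z)) / (1 + norm (snd z)) ^ M))" for z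
        unfolding of_real_mult[symmetric] norm_of_real
        using order_trans[OF C(2)[of "snd z" "fst z"] abs_ge_self] by simp
      then show "AE z in lborel \<Otimes>\<^sub>M lborel. norm (\<Omega> (snd z) * a z) \<le> norm (complex_of_real (C / (1 + norm (fst z :: 'a)) ^ ?N) * complex_of_real (norm (\<Omega> (snd z)) / (1 + norm (snd z)) ^ M))"
        by simp
    qed
  qed
  obtain C where C: "C > 0" "\<And>x y. norm (\<Omega> y * a (x, y)) \<le> C / (1 + norm x) ^ N * (norm (\<Omega> y) / (1 + norm y) ^ M)"
    using bound by blast
  have "(1 + norm x) ^ N * norm (param_integral \<Omega> a x) \<le> C * (LBINT y. norm (\<Omega> y) / (1 + norm y) ^ M)" for x
  proof -
    have "norm (param_integral \<Omega> a x) \<le> (LBINT y. norm (\<Omega> y * a (x, y)))"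
      unfolding param_integral_def by (rule integral_norm_bound)
    also have "\<dots> \<le> (LBINT y. C / (1 + norm x) ^ N * (norm (\<Omega> y) / (1 + norm y) ^ M))"
      using int bound_int C(2) by (intro integral_mono integrable_norm) auto
    also have "\<dots> = C * (LBINT y. norm (\<Omega> y) / (1 + norm y) ^ M) / (1 + norm x) ^ N"
      unfolding integral_mult_right_zero by simp
    finally show ?thesis by (simp add: pos_le_divide_eq add_pos_nonneg mult.commute)
  qed
  then show "\<exists>C. \<forall>x. (1 + norm x) ^ N * norm (param_integral \<Omega> a x) \<le> C" by blast
qed

lemma param_integral_has_derivative:
  fixes a :: "'a::euclidean_space \<times> 'b::euclidean_space \<Rightarrow> complex"
  assumes \<Omega>: "tempered_density \<Omega>" and a: "a \<in> schwartz"
  shows "(param_integral \<Omega> a has_derivative (\<lambda>v. param_integral \<Omega> (dderiv (v, 0) a) x)) (at x)"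
proof -
  obtain M where M: "integrable lborel (\<lambda>y. norm (\<Omega> y) / (1 + norm y) ^ M)"
    using \<Omega> by (auto simp: tempered_density_def)
  have "\<exists>C. \<forall>z. (1 + norm z) ^ M * norm (dderiv b a z) \<le> C" if "b \<in> Basis" for b
    using schwartz_rapid[OF schwartz_dderiv[OF a that]] by (auto simp: rapid_def)
  then obtain C where C: "\<And>b z. b \<in> Basis \<Longrightarrow> (1 + norm z) ^ M * norm (dderiv b a z) \<le> C b" by metis
  let ?K = "\<Sum>b\<in>(Basis::('a \<times> 'b) set). C b"
  have d: "norm (dderiv (v, 0) a (x, y)) \<le> ?K / (1 + norm y) ^ M * norm v" for v x y
  proof -
    have "norm (dderiv (v, 0) a (x, y)) \<le> (\<Sum>b\<in>Basis. norm (of_real ((v, 0) \<bullet> b) * dderiv b a (x, y)))"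
      unfolding dderiv_expand[OF a, of "(v, 0)"] by (rule norm_sum)
    also have "\<dots> \<le> (\<Sum>b\<in>(Basis::('a \<times> 'b) set). norm v * (C b / (1 + norm y) ^ M))"
    proof (rule sum_mono)
      fix b :: "'a \<times> 'b" assume b: "b \<in> Basis"
      have "(1 + norm y) ^ M * norm (dderiv b a (x, y)) \<le> (1 + norm (x, y)) ^ M * norm (dderiv b a (x, y))"
        by (intro mult_right_mono power_mono) (auto simp: norm_Pair)
      also have "\<dots> \<le> C b" by (rule C[OF b])
      finally have 1: "norm (dderiv b a (x, y)) \<le> C b / (1 + norm y) ^ M"
        by (subst pos_le_divide_eq) (auto simp: mult.commute intro!: zero_less_power add_pos_nonneg)
      have "\<bar>(v, 0) \<bullet> b\<bar> \<le> norm v"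
        using Basis_le_norm[OF b, of "(v, 0)"] by (simp add: norm_Pair)
      then show "norm (of_real ((v, 0) \<bullet> b) * dderiv b a (x, y)) \<le> norm v * (C b / (1 + norm y) ^ M)"
        unfolding norm_mult norm_of_real by (intro mult_mono 1) auto
    qed
    finally show ?thesis by (simp add: sum_distrib_left sum_divide_distrib sum_distrib_right mult.commute)
  qed
  have "((\<lambda>x. LBINT y. \<Omega> y * a (x, y)) has_derivative (\<lambda>v. LBINT y. \<Omega> y * dderiv (v, 0) a (x, y))) (at x)"
  proof (rule has_derivative_under_integral[where r=1 and H="\<lambda>y. ?K * (norm (\<Omega> y) / (1 + norm y) ^ M)"])
    show "integrable lborel (\<lambda>y. \<Omega> y * a (x, y))" for x by (rule tempered_density_integrable[OF \<Omega> a])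
    show "integrable lborel (\<lambda>y. \<Omega> y * dderiv (v, 0) a (x, y))" for v
      by (rule tempered_density_integrable[OF \<Omega> schwartz_dderiv_gen[OF a]])
    show "((\<lambda>x. \<Omega> y * a (x, y)) has_derivative (\<lambda>v. \<Omega> y * dderiv (v, 0) a (x, y))) (at x)" for x y
      using schwartz_has_derivative[OF schwartz_slice_fst[OF a, of y], of x]
      by (intro has_derivative_mult_right) (simp add: dderiv_slice_fst[OF a])
    show "norm (\<Omega> y * dderiv (v, 0) a (x, y)) \<le> ?K * (norm (\<Omega> y) / (1 + norm y) ^ M) * norm v" for x y v
      using mult_left_mono[OF d[of v x y] norm_ge_zero[of "\<Omega> y"]] by (simp add: norm_mult mult_ac)
    show "integrable lborel (\<lambda>y. ?K * (norm (\<Omega> y) / (1 + norm y) ^ M))"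
      using M by (rule integrable_mult_right)
  qed simp
  then show ?thesis by (simp add: param_integral_def[abs_def])
qed

lemma Pair_0_Basis: "b \<in> Basis \<Longrightarrow> (b, 0) \<in> Basis"
  by (simp add: Basis_prod_def)

text \<open>Derivatives fall on the test function alone, so an estimate of
  \<open>param_integral\<close> for all Schwartz functions is at once an estimate of all its
  derivatives.\<close>

lemma partials_param_integral:
  fixes a :: "'a::euclidean_space \<times> 'b::euclidean_space \<Rightarrow> complex"
  assumes \<Omega>: "tempered_density \<Omega>" and a: "a \<in> schwartz" and bs: "set bs \<subseteq> Basis"
  shows "partials bs (param_integral \<Omega> a) = param_integral \<Omega> (partials (map (\<lambda>b. (b, 0)) bs) a)"
  using bs
proof (induction bs)
  case (Cons b bs)
  have "partials (map (\<lambda>b. (b, 0)) bs) a \<in> schwartz"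
    using Cons.prems by (intro schwartz_partials a) (auto intro: Pair_0_Basis)
  from dderiv_fun_eq[OF param_integral_has_derivative[OF \<Omega> this], of b] Cons show ?case
    by (simp add: partials_Cons del: partials.simps)
qed simp

lemma param_integral_schwartz:
  fixes a :: "'a::euclidean_space \<times> 'b::euclidean_space \<Rightarrow> complex"
  assumes \<Omega>: "tempered_density \<Omega>" and a: "a \<in> schwartz"
  shows "param_integral \<Omega> a \<in> schwartz"
proof (rule schwartz_coinduct[of "\<lambda>h. \<exists>a\<in>schwartz. h = param_integral \<Omega> a"])
  fix h :: "'a \<Rightarrow> complex" assume "\<exists>a\<in>schwartz. h = param_integral \<Omega> a"
  then obtain a where a: "a \<in> schwartz" and h: "h = param_integral \<Omega> a" by blast
  show "rapid h" unfolding rapid_def h using param_integral_bound[OF \<Omega> a] by blast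
  show "\<exists>D. (\<forall>x. (h has_derivative D x) (at x)) \<and> (\<forall>b\<in>Basis. \<exists>a\<in>schwartz. (\<lambda>x. D x b) = param_integral \<Omega> a)"
    unfolding h using param_integral_has_derivative[OF \<Omega> a] schwartz_dderiv_gen[OF a]
    by (intro exI[of _ "\<lambda>x v. param_integral \<Omega> (dderiv (v, 0) a) x"]) auto
qed (use a in blast)

section \<open>The Fourier transform in the first of two variables\<close>

definition partial_fourier ::
  "('a::euclidean_space \<times> 'b \<Rightarrow> complex) \<Rightarrow> 'a \<Rightarrow> 'b \<Rightarrow> complex" where
  "partial_fourier a p y = fourier (\<lambda>x. a (x, y)) p"

lemma partials_slice_fst:
  fixes a :: "'a::euclidean_space \<times> 'b::euclidean_space \<Rightarrow> complex"
  assumes a: "a \<in> schwartz" and bs: "set bs \<subseteq> Basis"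
  shows "partials bs (\<lambda>x. c * a (x, y)) = (\<lambda>x. c * partials (map (\<lambda>b. (b, 0)) bs) a (x, y))"
  using bs
proof (induction bs)
  case (Cons b bs)
  have *: "partials (map (\<lambda>b. (b, 0)) bs) a \<in> schwartz"
    using Cons.prems by (intro schwartz_partials a) (auto intro: Pair_0_Basis)
  have "((\<lambda>x. c * partials (map (\<lambda>b. (b, 0)) bs) a (x, y)) has_derivative
      (\<lambda>v. c * dderiv (v, 0) (partials (map (\<lambda>b. (b, 0)) bs) a) (x, y))) (at x)" for x
    using schwartz_has_derivative[OF schwartz_slice_fst[OF *, of y], of x]
    by (intro has_derivative_mult_right) (simp add: dderiv_slice_fst[OF *])
  from dderiv_fun_eq[OF this, of b] Cons show ?case
    by (simp add: partials_Cons del: partials.simps)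
qed simp

text \<open>\<open>fourier_decay\<close> for the slices of \<open>a\<close>, with \<open>y\<close>
  as family index and each slice multiplied by \<open>(1 + norm y)^M\<close>. This factor is
  constant in \<open>x\<close>, hence passes through the transform, and the joint decay of
  \<open>a\<close> keeps the family bounded.\<close>

lemma partial_fourier_decay:
  fixes a :: "'a::euclidean_space \<times> 'b::euclidean_space \<Rightarrow> complex"
  assumes a: "a \<in> schwartz"
  shows "\<exists>C. \<forall>p y. (1 + norm p) ^ N * (1 + norm y) ^ M * norm (partial_fourier a p y) \<le> C"
proof -
  have "\<exists>C. \<forall>y p. (1 + norm p) ^ N * norm (fourier (\<lambda>x. of_real ((1 + norm y) ^ M) * a (x, y)) p) \<le> C"
  proof (rule fourier_decay)
    show "(\<lambda>x. complex_of_real ((1 + norm y) ^ M) * a (x, y)) \<in> schwartz" for y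
      by (intro schwartz_cmult schwartz_slice_fst a)
    fix bs :: "'a list" assume bs: "set bs \<subseteq> Basis"
    have "partials (map (\<lambda>b. (b, 0)) bs) a \<in> schwartz"
      using bs by (intro schwartz_partials a) (auto intro: Pair_0_Basis)
    then obtain C where "\<And>x y. (1 + norm x) ^ (2 * DIM('a)) * (1 + norm y) ^ M * norm (partials (map (\<lambda>b. (b, 0)) bs) a (x, y)) \<le> C"
      using schwartz_prod_bound by metis
    then show "\<exists>C. \<forall>y x. (1 + norm x) ^ (2 * DIM('a)) * norm (partials bs (\<lambda>x. complex_of_real ((1 + norm y) ^ M) * a (x, y)) x) \<le> C"
      unfolding partials_slice_fst[OF a bs] norm_mult norm_of_real by (intro exI[of _ C]) (simp add: mult.assoc)
  qed
  then obtain C where C: "\<And>y p. (1 + norm p) ^ N * norm (fourier (\<lambda>x. of_real ((1 + norm y) ^ M) * a (x, y)) p) \<le> C"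
    by blast
  have eq: "norm (fourier (\<lambda>x. of_real ((1 + norm y) ^ M) * a (x, y)) p) = (1 + norm y) ^ M * norm (partial_fourier a p y)" for p y
    unfolding fourier_def partial_fourier_def mult.assoc integral_mult_right_zero norm_mult norm_of_real by simp
  show ?thesis
    using C unfolding eq mult.assoc[symmetric] by blast
qed

lemma partial_fourier_measurable:
  fixes a :: "'a::euclidean_space \<times> 'b::euclidean_space \<Rightarrow> complex"
  assumes a: "a \<in> schwartz"
  shows "(\<lambda>z. partial_fourier a (fst z) (snd z)) \<in> borel_measurable (borel \<Otimes>\<^sub>M borel)"
proof -
  have [measurable]: "a \<in> borel_measurable (borel \<Otimes>\<^sub>M borel)"
    using schwartz_measurable[OF a] by (simp add: borel_prod)
  show ?thesis unfolding partial_fourier_def fourier_def by measurable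
qed

lemma partial_fourier_inversion:
  fixes a :: "'a::euclidean_space \<times> 'b::euclidean_space \<Rightarrow> complex"
  assumes a: "a \<in> schwartz"
  shows "(LBINT p. partial_fourier a p y * cis (x \<bullet> p)) = of_real ((2 * pi) ^ DIM('a)) * a (x, y)"
  unfolding partial_fourier_def by (rule fourier_inversion[OF schwartz_slice_fst[OF a]])

section \<open>Limits in the Schwartz space\<close>

lemma partials_diff:
  assumes "f \<in> schwartz" "g \<in> schwartz" "set bs \<subseteq> Basis"
  shows "partials bs (\<lambda>x. f x - g x) = (\<lambda>x. partials bs f x - partials bs g x)"
  using assms(3)
proof (induction bs)
  case (Cons b bs)
  have "((\<lambda>x. partials bs f x - partials bs g x) has_derivative
      (\<lambda>v. dderiv v (partials bs f) x - dderiv v (partials bs g) x)) (at x)" for x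
    using Cons.prems by (intro has_derivative_diff schwartz_has_derivative schwartz_partials assms) auto
  from dderiv_fun_eq[OF this, of b] Cons show ?case
    by (simp add: partials_Cons del: partials.simps)
qed simp

text \<open>The limits \<open>G bs\<close> of the derivatives are first obtained pointwise from the
  Cauchy condition and then identified with the derivatives of \<open>g\<close> by uniform
  convergence. Rapid decay survives because the weighted distance to some \<open>f J\<close> is at
  most 1.\<close>

lemma
  fixes f :: "nat \<Rightarrow> 'a::euclidean_space \<Rightarrow> complex"
  assumes f: "\<And>j. f j \<in> schwartz"
    and lim: "\<And>x. (\<lambda>j. f j x) \<longlonglongrightarrow> g x"
    and Cauchy: "\<And>bs N e. set bs \<subseteq> Basis \<Longrightarrow> e > 0 \<Longrightarrow>
      \<exists>J. \<forall>i\<ge>J. \<forall>j\<ge>J. \<forall>x. (1 + norm x) ^ N * norm (partials bs (f i) x - partials bs (f j) x) \<le> e"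
  shows schwartz_limit: "g \<in> schwartz"
    and schwartz_limit_partials: "set bs \<subseteq> Basis \<Longrightarrow> e > 0 \<Longrightarrow>
      \<exists>J. \<forall>j\<ge>J. \<forall>x. (1 + norm x) ^ N * norm (partials bs (f j) x - partials bs g x) \<le> e"
proof -
  define G where "G bs x = lim (\<lambda>j. partials bs (f j) x)" for bs x
  have G: "(\<lambda>j. partials bs (f j) x) \<longlonglongrightarrow> G bs x" if bs: "set bs \<subseteq> Basis" for bs x
  proof -
    have "Cauchy (\<lambda>j. partials bs (f j) x)"
    proof (rule CauchyI)
      fix e :: real assume "e > 0"
      then obtain J where J: "\<forall>i\<ge>J. \<forall>j\<ge>J. \<forall>x. (1 + norm x) ^ 0 * norm (partials bs (f i) x - partials bs (f j) x) \<le> e / 2"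
        using Cauchy[OF bs, of "e / 2" 0] by auto
      have "norm (partials bs (f m) x - partials bs (f n) x) < e" if "m \<ge> J" "n \<ge> J" for m n
      proof -
        have "norm (partials bs (f m) x - partials bs (f n) x) \<le> e / 2" using J that by simp
        then show ?thesis using \<open>e > 0\<close> by linarith
      qed
      then show "\<exists>M. \<forall>m\<ge>M. \<forall>n\<ge>M. norm (partials bs (f m) x - partials bs (f n) x) < e"
        by blast
    qed
    from Cauchy_convergent[OF this] show ?thesis unfolding G_def by (simp only: convergent_LIMSEQ_iff)
  qed
  have unif: "\<exists>J. \<forall>j\<ge>J. \<forall>x. (1 + norm x) ^ N * norm (partials bs (f j) x - G bs x) \<le> e"
    if bs: "set bs \<subseteq> Basis" and e: "e > 0" for bs N e
  proof -
    obtain J where J: "\<And>i j x. i \<ge> J \<Longrightarrow> j \<ge> J \<Longrightarrow> (1 + norm x) ^ N * norm (partials bs (f j) x - partials bs (f i) x) \<le> e"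
      using Cauchy[OF bs e] by blast
    have "(1 + norm x) ^ N * norm (partials bs (f j) x - G bs x) \<le> e" if "j \<ge> J" for j x
    proof (rule LIMSEQ_le_const2)
      show "(\<lambda>i. (1 + norm x) ^ N * norm (partials bs (f j) x - partials bs (f i) x)) \<longlonglongrightarrow> (1 + norm x) ^ N * norm (partials bs (f j) x - G bs x)"
        by (intro tendsto_intros G bs)
    qed (use J that in blast)
    then show ?thesis by blast
  qed
  have deriv: "(G bs has_derivative (\<lambda>v. \<Sum>b\<in>Basis. of_real (v \<bullet> b) * G (b # bs) x)) (at x)" if bs: "set bs \<subseteq> Basis" for bs x
  proof -
    have S: "partials bs (f j) \<in> schwartz" for j using f bs by (rule schwartz_partials)
    have "\<exists>g. \<forall>x\<in>UNIV. (\<lambda>n. partials bs (f n) x) \<longlonglongrightarrow> g x \<and>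
        (g has_derivative (\<lambda>v. \<Sum>b\<in>Basis. of_real (v \<bullet> b) * G (b # bs) x)) (at x within UNIV)"
    proof (rule has_derivative_sequence)
      show "(partials bs (f n) has_derivative (\<lambda>v. dderiv v (partials bs (f n)) x)) (at x within UNIV)" for n x
        using schwartz_has_derivative[OF S] by simp
      show "(\<lambda>n. partials bs (f n) 0) \<longlonglongrightarrow> G bs 0" by (rule G[OF bs])
      fix e :: real assume e: "e > 0"
      \<comment> \<open>A directional derivative is a sum of \<open>DIM('a)\<close> partial
        derivatives, each of which may be off by \<open>e'\<close>.\<close>
      define e' where "e' = e / DIM('a)"
      have e': "e' > 0" using e by (simp add: e'_def)
      have "\<forall>b\<in>Basis. eventually (\<lambda>j. \<forall>x. norm (partials (b # bs) (f j) x - G (b # bs) x) \<le> e') sequentially"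
      proof
        fix b :: 'a assume "b \<in> Basis"
        then show "eventually (\<lambda>j. \<forall>x. norm (partials (b # bs) (f j) x - G (b # bs) x) \<le> e') sequentially"
          using unif[of "b # bs" e' 0] bs e' by (simp add: eventually_sequentially del: partials.simps)
      qed
      then have "eventually (\<lambda>j. \<forall>b\<in>Basis. \<forall>x. norm (partials (b # bs) (f j) x - G (b # bs) x) \<le> e') sequentially"
        by (simp add: eventually_ball_finite del: partials.simps)
      then show "eventually (\<lambda>n. \<forall>x\<in>UNIV. \<forall>h. norm (dderiv h (partials bs (f n)) x - (\<Sum>b\<in>Basis. of_real (h \<bullet> b) * G (b # bs) x)) \<le> e * norm h) sequentially"
      proof eventually_elim
        case (elim j)
        show ?case
        proof (intro ballI allI)
          fix x h :: 'a
          have "dderiv h (partials bs (f j)) x - (\<Sum>b\<in>Basis. of_real (h \<bullet> b) * G (b # bs) x)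
            = (\<Sum>b\<in>Basis. of_real (h \<bullet> b) * (partials (b # bs) (f j) x - G (b # bs) x))"
            unfolding dderiv_expand[OF S, of h] partials_Cons by (simp add: algebra_simps sum_subtractf)
          also have "norm \<dots> \<le> (\<Sum>b\<in>(Basis::'a set). norm h * e')"
            using elim unfolding norm_mult norm_of_real
            by (intro sum_norm_le) (auto simp: norm_mult Basis_le_norm intro!: mult_mono simp del: partials.simps)
          also have "\<dots> = e * norm h" by (simp add: e'_def)
          finally show "norm (dderiv h (partials bs (f j)) x - (\<Sum>b\<in>Basis. of_real (h \<bullet> b) * G (b # bs) x)) \<le> e * norm h" .
        qed
      qed
    qed auto
    then obtain g' where g': "\<And>x. (\<lambda>n. partials bs (f n) x) \<longlonglongrightarrow> g' x"
      "\<And>x. (g' has_derivative (\<lambda>v. \<Sum>b\<in>Basis. of_real (v \<bullet> b) * G (b # bs) x)) (at x)" by auto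
    have "g' = G bs" using LIMSEQ_unique[OF g'(1) G[OF bs]] by auto
    then show ?thesis using g'(2) by simp
  qed
  have dderiv_G: "(\<lambda>x. \<Sum>b'\<in>Basis. of_real (b \<bullet> b') * G (b' # bs) x) = G (b # bs)" if "b \<in> Basis" for b bs
    using that by (auto simp: fun_eq_iff inner_Basis if_distrib[of of_real] if_distrib[of "\<lambda>x. x * _"] cong: if_cong)
  have G_Nil: "G [] = g"
    using LIMSEQ_unique[OF G[of "[]"]] lim by fastforce
  show "g \<in> schwartz"
  proof (rule schwartz_coinduct[of "\<lambda>h. \<exists>bs. set bs \<subseteq> Basis \<and> h = G bs"])
    fix h assume "\<exists>bs. set bs \<subseteq> Basis \<and> h = G bs"
    then obtain bs where bs: "set bs \<subseteq> Basis" and h: "h = G bs" by blast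
    show "rapid h" unfolding rapid_def
    proof
      fix N
      obtain J where J: "\<And>x. (1 + norm x) ^ N * norm (partials bs (f J) x - G bs x) \<le> 1"
        using unif[OF bs zero_less_one] by blast
      obtain C where C: "\<And>x. (1 + norm x) ^ N * norm (partials bs (f J) x) \<le> C"
        using schwartz_rapid[OF schwartz_partials[OF f bs]] unfolding rapid_def by blast
      have "(1 + norm x) ^ N * norm (h x) \<le> C + 1" for x
      proof -
        have "norm (h x) \<le> norm (partials bs (f J) x) + norm (partials bs (f J) x - G bs x)"
          unfolding h by norm
        from mult_left_mono[OF this, of "(1 + norm x) ^ N"] show ?thesis
          using J[of x] C[of x] by (simp add: distrib_left)
      qed
      then show "\<exists>C. \<forall>x. (1 + norm x) ^ N * norm (h x) \<le> C" by blast
    qed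
    show "\<exists>D. (\<forall>x. (h has_derivative D x) (at x)) \<and> (\<forall>b\<in>Basis. \<exists>bs. set bs \<subseteq> Basis \<and> (\<lambda>x. D x b) = G bs)"
    proof (intro exI conjI allI ballI)
      show "(h has_derivative (\<lambda>v. \<Sum>b\<in>Basis. of_real (v \<bullet> b) * G (b # bs) x)) (at x)" for x
        unfolding h by (rule deriv[OF bs])
      fix b :: 'a assume b: "b \<in> Basis"
      show "set (b # bs) \<subseteq> Basis" using b bs by simp
      show "(\<lambda>x. \<Sum>b'\<in>Basis. of_real (b \<bullet> b') * G (b' # bs) x) = G (b # bs)" by (rule dderiv_G[OF b])
    qed
  qed (use G_Nil in \<open>auto intro!: exI[of _ "[]"]\<close>)
  have "partials bs g = G bs" if "set bs \<subseteq> Basis" for bs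
    using that
  proof (induction bs)
    case (Cons b bs)
    then have "dderiv b (G bs) = G (b # bs)"
      using dderiv_fun_eq[OF deriv, of bs b] dderiv_G[of b bs] by simp
    with Cons show ?case by (simp add: partials_Cons del: partials.simps)
  qed (simp add: G_Nil)
  then show "\<exists>J. \<forall>j\<ge>J. \<forall>x. (1 + norm x) ^ N * norm (partials bs (f j) x - partials bs g x) \<le> e"
    if "set bs \<subseteq> Basis" "e > 0" for bs e N
    using unif[OF that] that by simp
qed

text \<open>One seminorm involves only finitely many lists of directions, so convergence list by
  list forces it to 0, and \<open>u\<close> is bounded by one such seminorm.\<close>

lemma tempered_distribution_limit:
  fixes f :: "nat \<Rightarrow> 'a::euclidean_space \<Rightarrow> complex"
  assumes u: "tempered_distribution u" and f: "\<And>j. f j \<in> schwartz" and g: "g \<in> schwartz"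
    and lim: "\<And>bs N e. set bs \<subseteq> Basis \<Longrightarrow> e > 0 \<Longrightarrow>
      \<exists>J. \<forall>j\<ge>J. \<forall>x. (1 + norm x) ^ N * norm (partials bs (f j) x - partials bs g x) \<le> e"
  shows "(\<lambda>j. u (f j)) \<longlonglongrightarrow> u g"
proof -
  obtain N C where C: "\<And>f. f \<in> schwartz \<Longrightarrow> norm (u f) \<le> C * schwartz_seminorm N f"
    using u unfolding tempered_distribution_def by blast
  have bdd: "bdd_above (range (\<lambda>x. (1 + norm x) ^ N * norm (partials bs h x)))"
    if "h \<in> schwartz" "set bs \<subseteq> Basis" for N bs and h :: "'a \<Rightarrow> complex"
    using that by (auto simp: schwartz_def)
  have add: "\<forall>f\<in>schwartz. \<forall>g\<in>schwartz. u (\<lambda>x. f x + g x) = u f + u g"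
    using u by (simp add: tempered_distribution_def)
  let ?B = "{bs::'a list. set bs \<subseteq> Basis \<and> length bs \<le> N}"
  have fin: "finite ?B" by (rule finite_lists_length_le) simp
  have sn: "eventually (\<lambda>j. schwartz_seminorm N (\<lambda>x. f j x - g x) \<le> card ?B * e) sequentially" if "e > 0" for e :: real
  proof -
    have "\<forall>bs\<in>?B. eventually (\<lambda>j. \<forall>x. (1 + norm x) ^ N * norm (partials bs (f j) x - partials bs g x) \<le> e) sequentially"
      using lim[OF _ \<open>e > 0\<close>] by (auto simp: eventually_sequentially)
    then have "eventually (\<lambda>j. \<forall>bs\<in>?B. \<forall>x. (1 + norm x) ^ N * norm (partials bs (f j) x - partials bs g x) \<le> e) sequentially"
      by (rule eventually_ball_finite[OF fin])
    then show ?thesis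
    proof eventually_elim
      case (elim j)
      have "schwartz_seminorm N (\<lambda>x. f j x - g x) \<le> (\<Sum>bs\<in>?B. e)"
        unfolding schwartz_seminorm_def
        by (intro sum_mono cSUP_least) (use elim in \<open>auto simp: partials_diff[OF f g]\<close>)
      then show ?case by simp
    qed
  qed
  have "(\<lambda>j. u (f j) - u g) \<longlonglongrightarrow> 0"
  proof (rule LIMSEQ_I)
    fix r :: real assume r: "r > 0"
    \<comment> \<open>The added ones keep the denominator positive for every value of
      \<open>C\<close>; the final estimate is \<open>r / 2\<close>, which leaves room for a strict
      inequality.\<close>
    define e where "e = r / (2 * (1 + \<bar>C\<bar>) * (1 + card ?B))"
    have e: "e > 0" using r unfolding e_def by (intro divide_pos_pos mult_pos_pos) auto
    have "eventually (\<lambda>j. norm (u (f j) - u g) < r) sequentially"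
      using sn[OF e]
    proof eventually_elim
      case (elim j)
      have d: "(\<lambda>x. f j x - g x) \<in> schwartz" by (intro schwartz_diff f g)
      have "u (\<lambda>x. (f j x - g x) + g x) = u (\<lambda>x. f j x - g x) + u g"
        by (rule bspec[OF bspec[OF add d] g])
      then have "norm (u (f j) - u g) = norm (u (\<lambda>x. f j x - g x))" by simp
      also have "\<dots> \<le> C * schwartz_seminorm N (\<lambda>x. f j x - g x)" by (rule C[OF d])
      \<comment> \<open>\<open>C\<close> may be negative. Passing to its absolute value requires a
        nonnegative seminorm, hence suprema over bounded sets.\<close>
      also have "\<dots> \<le> \<bar>C\<bar> * (card ?B * e)"
      proof (rule mult_mono)
        show "0 \<le> schwartz_seminorm N (\<lambda>x. f j x - g x)"
          unfolding schwartz_seminorm_def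
        proof (intro sum_nonneg)
          fix bs :: "'a list" assume "bs \<in> {bs. set bs \<subseteq> Basis \<and> length bs \<le> N}"
          then have "bdd_above (range (\<lambda>x. (1 + norm x) ^ N * norm (partials bs (\<lambda>x. f j x - g x) x)))"
            by (intro bdd d) auto
          from cSUP_upper[OF UNIV_I this, of 0]
          show "0 \<le> (SUP x. (1 + norm x) ^ N * norm (partials bs (\<lambda>x. f j x - g x) x))"
            by (rule order_trans[rotated]) simp
        qed
      qed (use elim in auto)
      also have "\<dots> \<le> (1 + \<bar>C\<bar>) * ((1 + card ?B) * e)" using e by (intro mult_mono) auto
      also have "\<dots> = r / 2"
      proof -
        have "a * (b * (r / (2 * a * b))) = r / 2" if "a > 0" "b > 0" for a b :: real
          using that by simp
        from this[of "1 + \<bar>C\<bar>" "1 + card ?B"] show ?thesis unfolding e_def by (simp add: add_pos_nonneg)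
      qed
      also have "\<dots> < r" using r by simp
      finally show ?case .
    qed
    then show "\<exists>no. \<forall>n\<ge>no. norm (u (f n) - u g - 0) < r"
      by (simp add: eventually_sequentially)
  qed
  then show ?thesis by (simp add: LIM_zero_iff)
qed


section \<open>Trigonometric polynomials and the condition (BP)\<close>

text \<open>Half-open, so that every point lies in exactly one translate by a vector of the lattice
  of periods.\<close>

definition period_cube :: "'a::euclidean_space set" where
  "period_cube = {x. \<forall>b\<in>Basis. 0 \<le> x \<bullet> b \<and> x \<bullet> b < 2 * pi}"

lemma indicator_period_cube:
  "indicator period_cube x = (\<Prod>b\<in>Basis. indicator {0..<2 * pi} (x \<bullet> b) :: real)"
  by (auto simp: period_cube_def indicator_def prod_zero_iff)

lemma period_cube_borel [measurable]: "period_cube \<in> sets borel"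
  unfolding period_cube_def by measurable

lemma
  fixes j :: int
  shows integrable_cis_period: "integrable lborel (\<lambda>t::real. indicator {0..<2 * pi} t *\<^sub>R cis (- (of_int j * t)))"
    and integral_cis_period: "(LBINT t. indicator {0..<2 * pi} t *\<^sub>R cis (- (of_int j * t))) = (if j = 0 then of_real (2 * pi) else 0)"
proof -
  let ?f = "\<lambda>t::real. cis (- (of_int j * t))"
  \<comment> \<open>The tiling needs the half-open interval, the fundamental theorem of calculus the
    closed one; they differ by a null set.\<close>
  have AE: "AE t in lborel. indicator {0..2 * pi} t *\<^sub>R ?f t = indicator {0..<2 * pi} t *\<^sub>R ?f t"
    using AE_lborel_singleton[of "2 * pi"] by eventually_elim (auto simp: indicator_def)
  have int: "integrable lborel (\<lambda>t::real. indicator {0..2 * pi} t *\<^sub>R ?f t)"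
    by (rule borel_integrable_compact) (auto intro!: continuous_intros)
  show "integrable lborel (\<lambda>t::real. indicator {0..<2 * pi} t *\<^sub>R ?f t)"
    by (rule iffD1[OF integrable_cong_AE[OF _ _ AE] int]) measurable
  have "(LBINT t. indicator {0..2 * pi} t *\<^sub>R ?f t) = (if j = 0 then of_real (2 * pi) else 0)"
  proof (cases "j = 0")
    case False
    let ?F = "\<lambda>t::real. \<i> / of_int j * ?f t"
    have "(?F has_vector_derivative ?f t) (at t within {0..2 * pi})" for t
    proof -
      have "((\<lambda>t. ?f t) has_derivative (\<lambda>v. \<i> * of_real (- (of_int j * v)) * ?f t)) (at t within {0..2 * pi})"
        by (rule has_derivative_at_withinI, rule has_derivative_cis) (auto intro!: derivative_eq_intros)
      from has_derivative_mult_right[OF this, of "\<i> / of_int j"] show ?thesis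
        unfolding has_vector_derivative_def using False by (simp add: scaleR_conv_of_real field_simps)
    qed
    then have "(LBINT t. indicator {0..2 * pi} t *\<^sub>R ?f t) = ?F (2 * pi) - ?F 0"
      by (intro integral_FTC_atLeastAtMost) (auto intro!: continuous_intros)
    also have "?f (2 * pi) = 1"
      using cis_multiple_2pi[of "- of_int j"] by (simp add: mult.commute)
    finally show ?thesis using False by simp
  qed (simp add: scaleR_conv_of_real)
  with AE show "(LBINT t. indicator {0..<2 * pi} t *\<^sub>R ?f t) = (if j = 0 then of_real (2 * pi) else 0)"
    by (subst integral_cong_AE[where g="\<lambda>t. indicator {0..2 * pi} t *\<^sub>R ?f t"]) (auto elim: eventually_mono)
qed

lemma
  fixes k :: "int ^ 'd::finite"
  shows integrable_cis_cube: "integrable lborel (\<lambda>x::real^'d. indicator period_cube x *\<^sub>R cis (- (real_vec k \<bullet> x)))"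
    and integral_cis_cube: "(LBINT x. indicator period_cube (x::real^'d) *\<^sub>R cis (- (real_vec k \<bullet> x)))
      = (if k = 0 then of_real ((2 * pi) ^ CARD('d)) else 0)"
proof -
  have j: "\<exists>j::int. real_vec k \<bullet> b = of_int j" if "b \<in> Basis" for b
    using that by (auto simp: Basis_vec_def inner_axis real_vec_def)
  \<comment> \<open>The product formula for integrals is indexed by \<open>Basis\<close>, so the
    integer coordinates of \<open>k\<close> are indexed by basis vectors too.\<close>
  define j where "j b = (SOME j::int. real_vec k \<bullet> b = of_int j)" for b
  have j: "real_vec k \<bullet> b = of_int (j b)" if "b \<in> Basis" for b
    unfolding j_def by (rule someI_ex[OF j[OF that]])
  have eq: "(\<Prod>b\<in>Basis. indicator {0..<2 * pi} (x \<bullet> b) *\<^sub>R cis (- (of_int (j b) * (x \<bullet> b))))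
      = indicator period_cube x *\<^sub>R cis (- (real_vec k \<bullet> x))" for x :: "real^'d"
  proof -
    have "- (real_vec k \<bullet> x) = (\<Sum>b\<in>Basis. - (of_int (j b) * (x \<bullet> b)))"
      by (subst euclidean_inner) (simp add: j sum_negf)
    then show ?thesis
      unfolding indicator_period_cube by (simp add: cis_sum scaleR_conv_of_real prod.distrib)
  qed
  have k: "(\<forall>b\<in>Basis. j b = 0) \<longleftrightarrow> k = 0"
  proof
    assume "\<forall>b\<in>Basis. j b = 0"
    moreover have "axis i 1 \<in> (Basis :: (real^'d) set)" for i by (auto simp: Basis_vec_def)
    ultimately have "real_vec k \<bullet> axis i 1 = 0" for i using j[of "axis i 1"] by (metis of_int_0)
    then show "k = 0" by (simp add: inner_axis real_vec_def vec_eq_iff)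
  next
    assume "k = 0"
    then show "\<forall>b\<in>Basis. j b = 0" using j by (simp add: real_vec_def vec_eq_iff inner_vec_def)
  qed
  note 1 = lborel_integrable_prod[where 'a="real^'d", where f="\<lambda>b t. indicator {0..<2 * pi} t *\<^sub>R cis (- (of_int (j b) * t))", OF integrable_cis_period]
  note 2 = lborel_integral_prod[where 'a="real^'d", where f="\<lambda>b t. indicator {0..<2 * pi} t *\<^sub>R cis (- (of_int (j b) * t))", OF integrable_cis_period]
  show "integrable lborel (\<lambda>x::real^'d. indicator period_cube x *\<^sub>R cis (- (real_vec k \<bullet> x)))"
    using 1 unfolding eq .
  have "(\<Prod>b\<in>(Basis::(real^'d) set). if j b = 0 then complex_of_real (2 * pi) else 0) = (if k = 0 then of_real ((2 * pi) ^ CARD('d)) else 0)"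
  proof (cases "k = 0")
    case True
    then have "(\<Prod>b\<in>(Basis::(real^'d) set). if j b = 0 then complex_of_real (2 * pi) else 0) = (\<Prod>b\<in>(Basis::(real^'d) set). complex_of_real (2 * pi))"
      using k by (intro prod.cong) auto
    then show ?thesis using True by simp
  next
    case False
    then show ?thesis using k by (auto simp: prod_zero_iff)
  qed
  then show "(LBINT x. indicator period_cube (x::real^'d) *\<^sub>R cis (- (real_vec k \<bullet> x)))
      = (if k = 0 then of_real ((2 * pi) ^ CARD('d)) else 0)"
    using 2 unfolding eq integral_cis_period by simp
qed

section \<open>Trigonometric polynomials\<close>

definition trig_poly :: "(int ^ 'd) set \<Rightarrow> (int ^ 'd \<Rightarrow> complex) \<Rightarrow> real ^ 'd::finite \<Rightarrow> complex" where
  "trig_poly A c x = (\<Sum>n\<in>A. c n * cis (- (real_vec n \<bullet> x)))"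

lemma trig_poly_measurable [measurable]: "trig_poly A c \<in> borel_measurable borel"
  unfolding trig_poly_def[abs_def] by measurable

lemma real_vec_diff: "real_vec (m - n) = real_vec m - real_vec n"
  by (auto simp: real_vec_def vec_eq_iff)

lemma real_vec_inner_int: "real_vec m \<bullet> real_vec n \<in> \<int>"
  unfolding real_vec_def inner_vec_def by (intro Ints_sum) auto

lemma trig_poly_periodic: "trig_poly A c (x + (2 * pi) *\<^sub>R real_vec k) = trig_poly A c x"
proof -
  have "cis (- (real_vec n \<bullet> (x + (2 * pi) *\<^sub>R real_vec k))) = cis (- (real_vec n \<bullet> x))" for n
  proof -
    have "- (real_vec n \<bullet> (x + (2 * pi) *\<^sub>R real_vec k)) = - (real_vec n \<bullet> x) + 2 * pi * (- (real_vec n \<bullet> real_vec k))"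
      by (simp add: inner_add_right)
    then show ?thesis
      using cis_multiple_2pi[of "- (real_vec n \<bullet> real_vec k)"] real_vec_inner_int[of n k]
      by (simp only: cis_mult[symmetric] Ints_minus mult_1_right)
  qed
  then show ?thesis by (simp add: trig_poly_def)
qed

text \<open>Expanding the square yields characters with index \<open>n - m\<close>, and only those
  with \<open>n = m\<close> survive the integration over the period cube.\<close>

lemma trig_poly_Parseval:
  fixes c :: "int ^ 'd::finite \<Rightarrow> complex"
  assumes A: "finite A"
  shows "(\<integral>\<^sup>+x. ennreal (indicator period_cube x * (norm (trig_poly A c x))\<^sup>2) \<partial>lborel)
    = ennreal ((2 * pi) ^ CARD('d) * (\<Sum>n\<in>A. (norm (c n))\<^sup>2))"
proof -
  let ?e = "\<lambda>k x::real^'d. indicator period_cube x *\<^sub>R cis (- (real_vec k \<bullet> x))"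
  have eq: "complex_of_real (indicator period_cube x * (norm (trig_poly A c x))\<^sup>2)
      = (\<Sum>n\<in>A. \<Sum>m\<in>A. c n * cnj (c m) * ?e (n - m) x)" for x
  proof -
    have *: "cis (- (real_vec n \<bullet> x)) * cnj (cis (- (real_vec m \<bullet> x))) = cis (- (real_vec (n - m) \<bullet> x))" for n m
      by (simp add: cis_cnj cis_mult real_vec_diff inner_diff_left)
    have "complex_of_real ((norm (trig_poly A c x))\<^sup>2) = trig_poly A c x * cnj (trig_poly A c x)"
      by (rule complex_norm_square)
    also have "\<dots> = (\<Sum>n\<in>A. \<Sum>m\<in>A. (c n * cis (- (real_vec n \<bullet> x))) * cnj (c m * cis (- (real_vec m \<bullet> x))))"
      unfolding trig_poly_def by (simp add: sum_product)
    also have "\<dots> = (\<Sum>n\<in>A. \<Sum>m\<in>A. c n * cnj (c m) * cis (- (real_vec (n - m) \<bullet> x)))"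
      by (intro sum.cong refl) (simp add: *[symmetric] mult_ac)
    finally show ?thesis
      by (simp add: scaleR_conv_of_real sum_distrib_left mult_ac)
  qed
  have int: "integrable lborel (\<lambda>x. c n * cnj (c m) * ?e (n - m) x)" for n m
    by (intro integrable_mult_right integrable_cis_cube)
  have "integrable lborel (\<lambda>x. complex_of_real (indicator period_cube x * (norm (trig_poly A c x))\<^sup>2))"
    unfolding eq by (intro Bochner_Integration.integrable_sum int)
  then have int': "integrable lborel (\<lambda>x. indicator period_cube x * (norm (trig_poly A c x))\<^sup>2)"
    by (simp only: complex_of_real_integrable_eq)
  have "complex_of_real (LBINT x. indicator period_cube x * (norm (trig_poly A c x))\<^sup>2)
      = (LBINT x. complex_of_real (indicator period_cube x * (norm (trig_poly A c x))\<^sup>2))"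
    by (rule integral_complex_of_real[symmetric])
  also have "\<dots> = (\<Sum>n\<in>A. \<Sum>m\<in>A. c n * cnj (c m) * (LBINT x. ?e (n - m) x))"
    unfolding eq integral_mult_right_zero[symmetric]
    by (subst Bochner_Integration.integral_sum, intro Bochner_Integration.integrable_sum int)
      (intro sum.cong refl Bochner_Integration.integral_sum int)
  also have "\<dots> = (\<Sum>n\<in>A. \<Sum>m\<in>A. if m = n then c n * cnj (c m) * of_real ((2 * pi) ^ CARD('d)) else 0)"
    unfolding integral_cis_cube by (intro sum.cong) auto
  also have "\<dots> = (\<Sum>n\<in>A. c n * cnj (c n) * of_real ((2 * pi) ^ CARD('d)))"
    using A by (simp add: sum.delta)
  also have "\<dots> = of_real ((2 * pi) ^ CARD('d) * (\<Sum>n\<in>A. (norm (c n))\<^sup>2))"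
    unfolding complex_norm_square[symmetric] by (simp add: sum_distrib_right mult.commute)
  finally have "(LBINT x. indicator period_cube x * (norm (trig_poly A c x))\<^sup>2) = (2 * pi) ^ CARD('d) * (\<Sum>n\<in>A. (norm (c n))\<^sup>2)"
    unfolding of_real_eq_iff .
  with int' show ?thesis
    by (subst nn_integral_eq_integral) auto
qed

section \<open>Periodization of integrals\<close>

lemma period_cube_tiling:
  fixes x :: "real ^ 'd::finite"
  shows "(\<integral>\<^sup>+k. indicator period_cube (x - (2 * pi) *\<^sub>R real_vec k) \<partial>count_space UNIV) = (1::ennreal)"
proof -
  define k0 :: "int ^ 'd" where "k0 = (\<chi> i. \<lfloor>x $ i / (2 * pi)\<rfloor>)"
  have "x - (2 * pi) *\<^sub>R real_vec k \<in> period_cube \<longleftrightarrow> k = k0" for k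
  proof -
    have "x - (2 * pi) *\<^sub>R real_vec k \<in> period_cube \<longleftrightarrow> (\<forall>i. 0 \<le> x $ i - 2 * pi * k $ i \<and> x $ i - 2 * pi * k $ i < 2 * pi)"
      by (auto simp: period_cube_def Basis_vec_def inner_axis real_vec_def)
    also have "\<dots> \<longleftrightarrow> (\<forall>i. \<lfloor>x $ i / (2 * pi)\<rfloor> = k $ i)"
      by (auto simp: floor_eq_iff field_simps)
    finally show ?thesis by (auto simp: k0_def vec_eq_iff)
  qed
  then have "(\<integral>\<^sup>+k. indicator period_cube (x - (2 * pi) *\<^sub>R real_vec k) \<partial>count_space UNIV)
      = (\<integral>\<^sup>+k. indicator {k0} k \<partial>count_space UNIV :: ennreal)"
    by (intro nn_integral_cong) (auto simp: indicator_def)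
  then show ?thesis by (simp add: one_ennreal_def)
qed

text \<open>Tonelli: the indicators of the translated cubes add up to 1; after inserting them, the
  sum and the integral are exchanged and each cube is moved back. The lattice sum is an integral
  over \<open>count_space\<close>, so that no summability has to be known.\<close>

lemma nn_integral_unfold:
  fixes f :: "real ^ 'd::finite \<Rightarrow> ennreal"
  assumes [measurable]: "f \<in> borel_measurable borel"
  shows "(\<integral>\<^sup>+x. f x \<partial>lborel)
    = (\<integral>\<^sup>+x. indicator period_cube x * (\<integral>\<^sup>+k. f (x + (2 * pi) *\<^sub>R real_vec k) \<partial>count_space UNIV) \<partial>lborel)"
proof -
  have "(\<integral>\<^sup>+x. f x \<partial>lborel) = (\<integral>\<^sup>+x. (\<integral>\<^sup>+k. f x * indicator period_cube (x - (2 * pi) *\<^sub>R real_vec k) \<partial>count_space UNIV) \<partial>lborel)"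
    by (simp add: nn_integral_cmult period_cube_tiling)
  also have "\<dots> = (\<integral>\<^sup>+k. (\<integral>\<^sup>+x. f x * indicator period_cube (x - (2 * pi) *\<^sub>R real_vec k) \<partial>lborel) \<partial>count_space UNIV)"
    by (rule nn_integral_count_space_nn_integral) auto
  also have "\<dots> = (\<integral>\<^sup>+k. (\<integral>\<^sup>+x. f (x + (2 * pi) *\<^sub>R real_vec k) * indicator period_cube x \<partial>lborel) \<partial>count_space UNIV)"
  proof (rule nn_integral_cong)
    fix k :: "int ^ 'd"
    show "(\<integral>\<^sup>+x. f x * indicator period_cube (x - (2 * pi) *\<^sub>R real_vec k) \<partial>lborel)
        = (\<integral>\<^sup>+x. f (x + (2 * pi) *\<^sub>R real_vec k) * indicator period_cube x \<partial>lborel)"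
      by (subst nn_integral_lborel_affine[of 1 _ "(2 * pi) *\<^sub>R real_vec k"]) (simp_all add: add.commute)
  qed
  also have "\<dots> = (\<integral>\<^sup>+x. (\<integral>\<^sup>+k. f (x + (2 * pi) *\<^sub>R real_vec k) * indicator period_cube x \<partial>count_space UNIV) \<partial>lborel)"
    by (rule nn_integral_count_space_nn_integral[symmetric]) auto
  finally show ?thesis
    by (simp add: nn_integral_cmult mult.commute)
qed

text \<open>Says that trigonometric polynomials with square summable coefficients are controlled in
  the weighted space \<open>L^2\<close> with weight \<open>\<rho>^2\<close>. The lattice bound of
  (BP) enters the later estimates through this property. It is phrased with the nonnegative
  integral, so integrability is a consequence rather than a side condition.\<close>

definition trig_bounded :: "(real ^ 'd::finite \<Rightarrow> real) \<Rightarrow> real \<Rightarrow> bool" where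
  "trig_bounded \<rho> B \<longleftrightarrow> \<rho> \<in> borel_measurable borel \<and> 0 \<le> B \<and> (\<forall>x. 0 \<le> \<rho> x) \<and>
    (\<forall>A c. finite A \<longrightarrow>
      (\<integral>\<^sup>+x. ennreal ((norm (trig_poly A c x) * \<rho> x)\<^sup>2) \<partial>lborel) \<le> ennreal (B * (\<Sum>n\<in>A. (norm (c n))\<^sup>2)))"

text \<open>The polynomial is periodic, so after unfolding it leaves the lattice sum. What remains
  of the sum is at most \<open>B\<close>, and Parseval on the cube supplies the factor
  \<open>(2 * pi) ^ d\<close>.\<close>

lemma trig_boundedI:
  fixes \<rho> :: "real ^ 'd::finite \<Rightarrow> real"
  assumes [measurable]: "\<rho> \<in> borel_measurable borel" and nonneg: "\<And>x. 0 \<le> \<rho> x" and B: "0 \<le> B"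
    and AE: "AE x in lborel. (\<integral>\<^sup>+k. ennreal ((\<rho> (x + (2 * pi) *\<^sub>R real_vec k))\<^sup>2) \<partial>count_space UNIV) \<le> ennreal B"
  shows "trig_bounded \<rho> (B * (2 * pi) ^ CARD('d))"
proof -
  have "(\<integral>\<^sup>+x. ennreal ((norm (trig_poly A c x) * \<rho> x)\<^sup>2) \<partial>lborel) \<le> ennreal (B * (2 * pi) ^ CARD('d) * (\<Sum>n\<in>A. (norm (c n))\<^sup>2))"
    if A: "finite A" for A :: "(int ^ 'd) set" and c
  proof -
    have "(\<integral>\<^sup>+x. ennreal ((norm (trig_poly A c x) * \<rho> x)\<^sup>2) \<partial>lborel)
      = (\<integral>\<^sup>+x. indicator period_cube x * (\<integral>\<^sup>+k. ennreal ((norm (trig_poly A c x))\<^sup>2) * ennreal ((\<rho> (x + (2 * pi) *\<^sub>R real_vec k))\<^sup>2) \<partial>count_space UNIV) \<partial>lborel)"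
      by (subst nn_integral_unfold) (simp_all add: trig_poly_periodic power_mult_distrib ennreal_mult)
    also have "\<dots> = (\<integral>\<^sup>+x. ennreal (indicator period_cube x * (norm (trig_poly A c x))\<^sup>2) * (\<integral>\<^sup>+k. ennreal ((\<rho> (x + (2 * pi) *\<^sub>R real_vec k))\<^sup>2) \<partial>count_space UNIV) \<partial>lborel)"
      by (simp add: nn_integral_cmult ennreal_mult ennreal_indicator mult.assoc)
    also have "\<dots> \<le> (\<integral>\<^sup>+x. ennreal (indicator period_cube x * (norm (trig_poly A c x))\<^sup>2) * ennreal B \<partial>lborel)"
      by (rule nn_integral_mono_AE, use AE in eventually_elim) (rule mult_left_mono, auto)
    also have "\<dots> = ennreal ((2 * pi) ^ CARD('d) * (\<Sum>n\<in>A. (norm (c n))\<^sup>2)) * ennreal B"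
      by (subst nn_integral_multc) (simp_all add: trig_poly_Parseval[OF A])
    also have "\<dots> = ennreal (B * (2 * pi) ^ CARD('d) * (\<Sum>n\<in>A. (norm (c n))\<^sup>2))"
      using B by (subst ennreal_mult[symmetric]) (auto simp: mult_ac intro!: mult_nonneg_nonneg sum_nonneg)
    finally show ?thesis .
  qed
  then show ?thesis using nonneg B by (auto simp: trig_bounded_def)
qed

text \<open>A lattice sum is compared with an integral. Shifting the argument by a point of the
  period cube changes the weight by at most a constant factor, so the sum is bounded by a multiple
  of its average over such shifts, and the average unfolds to the integral over the whole space. The
  lemma serves the constant part of the error kernel.\<close>

lemma trig_bounded_power:
  assumes M: "CARD('d::finite) \<le> M"
  shows "\<exists>B. trig_bounded (\<lambda>x::real^'d. 1 / (1 + norm x) ^ M) B"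
proof -
  let ?\<psi> = "\<lambda>x::real^'d. 1 / (1 + norm x) ^ (2 * M)"
  \<comment> \<open>Bounds the norm on the period cube through the sum of the coordinates, each of
    which is below \<open>2 * pi\<close>. The exponent \<open>2 * M\<close> of
    \<open>?\<psi>\<close> appears because \<open>trig_bounded\<close> squares the weight.\<close>
  define R where "R = 2 * pi * CARD('d)"
  define V where "V = (2 * pi) ^ CARD('d)"
  have R: "R \<ge> 0" by (simp add: R_def)
  have V: "V > 0" by (simp add: V_def)
  have vol: "(\<integral>\<^sup>+x. indicator period_cube (x::real^'d) \<partial>lborel) = ennreal V"
    using trig_poly_Parseval[of "{0::int^'d}" "\<lambda>_. 1"]
    by (simp add: V_def trig_poly_def ennreal_indicator del: nn_integral_indicator)
  have int: "integrable lborel ?\<psi>" using M by (intro integrable_inverse_norm_power) simp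
  define I where "I = (LBINT x. ?\<psi> x)"
  have I: "(\<integral>\<^sup>+x. ennreal (?\<psi> x) \<partial>lborel) = ennreal I" "I \<ge> 0"
    unfolding I_def by (auto intro!: nn_integral_eq_integral int integral_nonneg)
  let ?B = "(1 + R) ^ (2 * M) * I / V"
  have Peetre: "?\<psi> y \<le> (1 + R) ^ (2 * M) * ?\<psi> (y + \<theta>)" if "\<theta> \<in> period_cube" for y \<theta> :: "real^'d"
  proof -
    have "norm \<theta> \<le> (\<Sum>b\<in>Basis. \<bar>\<theta> \<bullet> b\<bar>)" by (rule norm_le_l1)
    also have "\<dots> \<le> (\<Sum>b\<in>(Basis::(real^'d) set). 2 * pi)"
      using that by (intro sum_mono) (auto simp: period_cube_def)
    also have "\<dots> = R" by (simp add: R_def)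
    finally have "norm \<theta> \<le> R" .
    then have "norm (y + \<theta>) \<le> norm y + R" using norm_triangle_ineq[of y \<theta>] by linarith
    moreover have "0 \<le> R * norm y" using R by simp
    ultimately have "1 + norm (y + \<theta>) \<le> (1 + R) * (1 + norm y)"
      unfolding ring_distribs by linarith
    then have "(1 + norm (y + \<theta>)) ^ (2 * M) \<le> (1 + R) ^ (2 * M) * (1 + norm y) ^ (2 * M)"
      unfolding power_mult_distrib[symmetric] by (intro power_mono) auto
    moreover have *: "1 / b \<le> c * (1 / a)" if "a \<le> c * b" "0 < a" "0 < b" for a b c :: real
      using that by (simp add: field_simps)
    ultimately show ?thesis by (intro *) (auto intro!: zero_less_power add_pos_nonneg)
  qed
  have bound: "(\<integral>\<^sup>+k. ennreal (?\<psi> (x + (2 * pi) *\<^sub>R real_vec k)) \<partial>count_space (UNIV::(int^'d) set)) \<le> ennreal ?B" for x :: "real^'d"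
  proof -
    \<comment> \<open>\<open>V\<close> is the volume of the cube: the sum does not depend on
      \<open>\<theta>\<close>, so integrating it over the cube multiplies it by \<open>V\<close>.
      This is divided out at the end.\<close>
    have "ennreal V * (\<integral>\<^sup>+k. ennreal (?\<psi> (x + (2 * pi) *\<^sub>R real_vec k)) \<partial>count_space (UNIV::(int^'d) set))
       = (\<integral>\<^sup>+\<theta>. indicator period_cube (\<theta>::real^'d) * (\<integral>\<^sup>+k. ennreal (?\<psi> (x + (2 * pi) *\<^sub>R real_vec k)) \<partial>count_space (UNIV::(int^'d) set)) \<partial>lborel)"
      by (simp add: nn_integral_multc vol del: nn_integral_indicator)
    also have "\<dots> \<le> (\<integral>\<^sup>+\<theta>. indicator period_cube \<theta> * (\<integral>\<^sup>+k. ennreal ((1 + R) ^ (2 * M) * ?\<psi> (x + \<theta> + (2 * pi) *\<^sub>R real_vec k)) \<partial>count_space (UNIV::(int^'d) set)) \<partial>lborel)"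
    proof (intro nn_integral_mono)
      fix \<theta> :: "real^'d"
      show "indicator period_cube \<theta> * (\<integral>\<^sup>+k. ennreal (?\<psi> (x + (2 * pi) *\<^sub>R real_vec k)) \<partial>count_space (UNIV::(int^'d) set))
        \<le> indicator period_cube \<theta> * (\<integral>\<^sup>+k. ennreal ((1 + R) ^ (2 * M) * ?\<psi> (x + \<theta> + (2 * pi) *\<^sub>R real_vec k)) \<partial>count_space (UNIV::(int^'d) set))"
      proof (cases "\<theta> \<in> period_cube")
        case True
        have "?\<psi> (x + (2 * pi) *\<^sub>R real_vec k) \<le> (1 + R) ^ (2 * M) * ?\<psi> (x + \<theta> + (2 * pi) *\<^sub>R real_vec k)" for k
          using Peetre[OF True, of "x + (2 * pi) *\<^sub>R real_vec k"] by (simp add: add_ac)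
        then show ?thesis by (intro mult_left_mono nn_integral_mono ennreal_leI) auto
      qed simp
    qed
    also have "\<dots> = (\<integral>\<^sup>+\<theta>. ennreal ((1 + R) ^ (2 * M) * ?\<psi> (x + \<theta>)) \<partial>lborel)"
      using nn_integral_unfold[of "\<lambda>\<theta>. ennreal ((1 + R) ^ (2 * M) * ?\<psi> (x + \<theta>))"] by (simp add: add.assoc)
    also have "\<dots> = (\<integral>\<^sup>+y. ennreal ((1 + R) ^ (2 * M) * ?\<psi> y) \<partial>lborel)"
      using nn_integral_lborel_affine[of 1 "\<lambda>y. ennreal ((1 + R) ^ (2 * M) * ?\<psi> y)" x] by simp
    also have "\<dots> = ennreal ((1 + R) ^ (2 * M) * I)"
      using R I(2) by (simp add: ennreal_mult nn_integral_cmult I(1)[simplified] del: times_divide_eq_right)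
    finally have *: "ennreal V * (\<integral>\<^sup>+k. ennreal (?\<psi> (x + (2 * pi) *\<^sub>R real_vec k)) \<partial>count_space (UNIV::(int^'d) set)) \<le> ennreal ((1 + R) ^ (2 * M) * I)" .
    have "ennreal (1 / V) * (ennreal V * (\<integral>\<^sup>+k. ennreal (?\<psi> (x + (2 * pi) *\<^sub>R real_vec k)) \<partial>count_space (UNIV::(int^'d) set))) \<le> ennreal (1 / V) * ennreal ((1 + R) ^ (2 * M) * I)"
      by (rule mult_left_mono[OF *]) simp
    then show ?thesis
      using V R I(2) by (simp add: mult.assoc[symmetric] ennreal_mult[symmetric])
  qed
  have "trig_bounded (\<lambda>x::real^'d. 1 / (1 + norm x) ^ M) (?B * (2 * pi) ^ CARD('d))"
    by (rule trig_boundedI) (use bound V R I(2) in \<open>auto simp: power_divide power_mult[symmetric] mult.commute\<close>)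
  then show ?thesis by blast
qed

lemma bracket_bounds: "1 \<le> bracket x" "bracket x \<le> 1 + norm x"
proof -
  have eq: "bracket x = sqrt (1 + (norm x)\<^sup>2)"
    unfolding bracket_def by (rule powr_half_sqrt) simp
  show "1 \<le> bracket x" unfolding eq by simp
  show "bracket x \<le> 1 + norm x" unfolding eq by (rule real_le_lsqrt) (auto simp: power2_sum)
qed

text \<open>Because \<open>bracket\<close> is at least 1, only the size of \<open>s\<close> matters,
  and one weight covers positive and negative orders alike.\<close>

lemma inverse_power_le_bracket_powr:
  assumes "\<bar>s\<bar> \<le> real M"
  shows "1 / (1 + norm x) ^ M \<le> bracket x powr s"
proof -
  have "1 / (1 + norm x) ^ M \<le> 1 / bracket x ^ M"
    using bracket_bounds[of x] by (intro divide_left_mono power_mono mult_pos_pos zero_less_power add_pos_nonneg) auto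
  also have "\<dots> = bracket x powr (- real M)"
    using bracket_bounds(1)[of x] by (simp add: powr_minus powr_realpow field_simps)
  also have "\<dots> \<le> bracket x powr s"
    using bracket_bounds(1)[of x] assms by (intro powr_mono) auto
  finally show ?thesis .
qed

text \<open>A high inverse power of \<open>1 + norm x\<close> is dominated by the weight
  \<open>bracket x powr s\<close>. All large \<open>M\<close> are offered because a second weight
  will impose its own lower bound on \<open>M\<close>.\<close>

lemma BP_trig_bounded:
  fixes \<phi> :: "(real ^ 'd::finite) functional"
  assumes BP: "BP \<phi>" and F: "has_fourier_function \<phi> F"
  shows "\<exists>M0. \<forall>M\<ge>M0. \<exists>B. trig_bounded (\<lambda>x. norm (F x) / (1 + norm x) ^ M) B"
proof -
  let ?g = "\<lambda>s \<xi> k. (norm (of_real (bracket (\<xi> + (2 * pi) *\<^sub>R real_vec k) powr s) * F (\<xi> + (2 * pi) *\<^sub>R real_vec (k::int^'d))))\<^sup>2"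
  obtain s B where B: "0 < B" and AE: "AE \<xi> in lborel. ?g s \<xi> summable_on UNIV \<and> (\<Sum>\<^sub>\<infinity>k. ?g s \<xi> k) \<le> B"
    using BP F unfolding BP_def by blast
  have [measurable]: "F \<in> borel_measurable borel" using F by (simp add: has_fourier_function_def)
  have "\<exists>B. trig_bounded (\<lambda>x. norm (F x) / (1 + norm x) ^ M) B" if M: "nat \<lceil>\<bar>s\<bar>\<rceil> \<le> M" for M
  proof -
    have "trig_bounded (\<lambda>x. norm (F x) / (1 + norm x) ^ M) (B * (2 * pi) ^ CARD('d))"
    proof (rule trig_boundedI)
      show "AE x in lborel. (\<integral>\<^sup>+k. ennreal ((norm (F (x + (2 * pi) *\<^sub>R real_vec k)) / (1 + norm (x + (2 * pi) *\<^sub>R real_vec k)) ^ M)\<^sup>2) \<partial>count_space UNIV) \<le> ennreal B"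
        using AE
      proof eventually_elim
        case (elim x)
        have "(\<integral>\<^sup>+k. ennreal ((norm (F (x + (2 * pi) *\<^sub>R real_vec k)) / (1 + norm (x + (2 * pi) *\<^sub>R real_vec k)) ^ M)\<^sup>2) \<partial>count_space UNIV)
          \<le> (\<integral>\<^sup>+k. ennreal (?g s x k) \<partial>count_space UNIV)"
        proof (intro nn_integral_mono ennreal_leI power_mono)
          fix k :: "int ^ 'd"
          let ?y = "x + (2 * pi) *\<^sub>R real_vec k"
          have "\<bar>s\<bar> \<le> real M" using M by linarith
          from mult_left_mono[OF inverse_power_le_bracket_powr[OF this, of ?y], of "norm (F ?y)"]
          show "norm (F ?y) / (1 + norm ?y) ^ M \<le> norm (of_real (bracket ?y powr s) * F ?y)"
            by (simp add: norm_mult mult.commute)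
        qed auto
        \<comment> \<open>Here the summability in (BP) is essential: an \<open>infsum\<close> that
          does not converge is 0 by default, and its bound by \<open>B\<close> would carry no
          information.\<close>
        also have "\<dots> = ennreal (\<Sum>\<^sub>\<infinity>k. ?g s x k)"
        proof -
          have "Infinite_Set_Sum.abs_summable_on (?g s x) UNIV"
            using elim by (simp add: abs_summable_equivalent[symmetric])
          then show ?thesis
            by (subst nn_integral_conv_infsetsum) (auto simp: infsetsum_infsum)
        qed
        also have "\<dots> \<le> ennreal B" using elim by (intro ennreal_leI) blast
        finally show ?case .
      qed
    qed (use B in auto)
    then show ?thesis by blast
  qed
  then show ?thesis by blast
qed

text \<open>From \<open>(a + b)^2 \<le> 2 a^2 + 2 b^2\<close>. It merges the weight with
  \<open>F\<close> and the constant weight into a single one.\<close>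

lemma trig_bounded_add:
  fixes \<rho> \<sigma> :: "real ^ 'd::finite \<Rightarrow> real"
  assumes \<rho>: "trig_bounded \<rho> B" and \<sigma>: "trig_bounded \<sigma> C" and c: "0 \<le> c"
  shows "trig_bounded (\<lambda>x. \<rho> x + c * \<sigma> x) (2 * B + 2 * c\<^sup>2 * C)"
proof -
  have [measurable]: "\<rho> \<in> borel_measurable borel" "\<sigma> \<in> borel_measurable borel" using \<rho> \<sigma> by (auto simp: trig_bounded_def)
  have BC: "0 \<le> B" "0 \<le> C" using \<rho> \<sigma> by (auto simp: trig_bounded_def)
  have "(\<integral>\<^sup>+x. ennreal ((norm (trig_poly A e x) * (\<rho> x + c * \<sigma> x))\<^sup>2) \<partial>lborel)
      \<le> ennreal ((2 * B + 2 * c\<^sup>2 * C) * (\<Sum>n\<in>A. (norm (e n))\<^sup>2))" if A: "finite A" for A :: "(int^'d) set" and e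
  proof -
    let ?S = "\<Sum>n\<in>A. (norm (e n))\<^sup>2"
    have S: "0 \<le> ?S" by (intro sum_nonneg) auto
    have "(\<integral>\<^sup>+x. ennreal ((norm (trig_poly A e x) * (\<rho> x + c * \<sigma> x))\<^sup>2) \<partial>lborel)
      \<le> (\<integral>\<^sup>+x. ennreal 2 * ennreal ((norm (trig_poly A e x) * \<rho> x)\<^sup>2) + ennreal (2 * c\<^sup>2) * ennreal ((norm (trig_poly A e x) * \<sigma> x)\<^sup>2) \<partial>lborel)"
    proof (rule nn_integral_mono)
      fix x
      have "(p * (r + c * t))\<^sup>2 \<le> 2 * (p * r)\<^sup>2 + 2 * c\<^sup>2 * (p * t)\<^sup>2" for p r t :: real
        using zero_le_power2[of "p * r - c * (p * t)"] by (simp add: power2_eq_square algebra_simps)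
      then show "ennreal ((norm (trig_poly A e x) * (\<rho> x + c * \<sigma> x))\<^sup>2) \<le> ennreal 2 * ennreal ((norm (trig_poly A e x) * \<rho> x)\<^sup>2) + ennreal (2 * c\<^sup>2) * ennreal ((norm (trig_poly A e x) * \<sigma> x)\<^sup>2)"
        by (subst (1 2) ennreal_mult[symmetric], simp_all, subst ennreal_plus[symmetric]) (auto intro!: ennreal_leI simp del: ennreal_plus)
    qed
    also have "\<dots> = ennreal 2 * (\<integral>\<^sup>+x. ennreal ((norm (trig_poly A e x) * \<rho> x)\<^sup>2) \<partial>lborel) + ennreal (2 * c\<^sup>2) * (\<integral>\<^sup>+x. ennreal ((norm (trig_poly A e x) * \<sigma> x)\<^sup>2) \<partial>lborel)"
      by (subst nn_integral_add) (auto simp: nn_integral_cmult)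
    also have "\<dots> \<le> ennreal 2 * ennreal (B * ?S) + ennreal (2 * c\<^sup>2) * ennreal (C * ?S)"
      using \<rho> \<sigma> A unfolding trig_bounded_def by (intro add_mono mult_left_mono) auto
    also have "\<dots> = ennreal (2 * (B * ?S) + 2 * c\<^sup>2 * (C * ?S))"
      using BC S by (subst ennreal_plus) (auto simp: ennreal_mult mult_nonneg_nonneg)
    finally show ?thesis by (simp add: algebra_simps)
  qed
  then show ?thesis using \<rho> \<sigma> c BC by (auto simp: trig_bounded_def)
qed


section \<open>Sesquilinear forms on grid functions\<close>

text \<open>The signs are such that summation against \<open>cnj (c m) * e n\<close> gives the
  integral of \<open>cnj (trig_poly A c \<eta>) * trig_poly A' e \<xi> * H \<eta>
  \<xi>\<close>.\<close>

definition grid_form ::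
  "(real ^ 'd \<Rightarrow> real ^ 'd \<Rightarrow> complex) \<Rightarrow> int ^ 'd \<Rightarrow> int ^ 'd::finite \<Rightarrow> complex" where
  "grid_form H m n = (LINT z|(lborel \<Otimes>\<^sub>M lborel).
     H (fst z) (snd z) * cis (real_vec m \<bullet> fst z) * cis (- (real_vec n \<bullet> snd z)))"

definition decay_mass :: "'a::euclidean_space itself \<Rightarrow> real" where
  "decay_mass _ = (LINT x::'a|lborel. 1 / (1 + norm x) ^ (2 * DIM('a)))"

lemma decay_mass_nonneg: "0 \<le> decay_mass TYPE('a::euclidean_space)"
  unfolding decay_mass_def by (rule Bochner_Integration.integral_nonneg) auto

lemma nn_integral_decay_mass:
  fixes y :: "'a::euclidean_space"
  assumes h: "h > 0"
  shows "(\<integral>\<^sup>+x. ennreal (1 / (1 + norm (y - x) / h) ^ (2 * DIM('a))) \<partial>lborel) = ennreal (h ^ DIM('a) * decay_mass TYPE('a))"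
proof -
  have "(\<integral>\<^sup>+x. ennreal (1 / (1 + norm (y - x) / h) ^ (2 * DIM('a))) \<partial>lborel)
    = ennreal (h ^ DIM('a)) * (\<integral>\<^sup>+x. ennreal (1 / (1 + norm (y - (y + h *\<^sub>R x)) / h) ^ (2 * DIM('a))) \<partial>(lborel :: 'a measure))"
    by (rule nn_integral_lborel_affine[OF h]) measurable
  also have "\<dots> = ennreal (h ^ DIM('a)) * (\<integral>\<^sup>+x. ennreal (1 / (1 + norm x) ^ (2 * DIM('a))) \<partial>(lborel :: 'a measure))"
    using h by simp
  also have "(\<integral>\<^sup>+x. ennreal (1 / (1 + norm x) ^ (2 * DIM('a))) \<partial>(lborel :: 'a measure)) = ennreal (decay_mass TYPE('a))"
    unfolding decay_mass_def
    by (intro nn_integral_eq_integral integrable_inverse_norm_power) auto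
  finally show ?thesis using h by (simp add: ennreal_mult decay_mass_nonneg)
qed

text \<open>Schur's test, with the quadratic form split by the arithmetic-geometric mean inequality.\<close>

lemma trig_poly_form_nn_bound:
  fixes H :: "real ^ 'd::finite \<Rightarrow> real ^ 'd \<Rightarrow> complex"
  assumes \<rho>: "trig_bounded \<rho> B" and h: "h > 0" and \<theta>: "0 \<le> \<theta>"
    and H: "\<And>\<eta> \<xi>. norm (H \<eta> \<xi>) \<le> \<theta> * (\<rho> \<eta> * \<rho> \<xi> / (1 + norm (\<eta> - \<xi>) / h) ^ (2 * CARD('d)))"
    and A: "finite A" "finite A'"
  shows "(\<integral>\<^sup>+z. ennreal (norm (trig_poly A c (fst z)) * norm (trig_poly A' e (snd z)) * norm (H (fst z) (snd z))) \<partial>(lborel \<Otimes>\<^sub>M lborel))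
    \<le> ennreal (\<theta> * h ^ CARD('d) * decay_mass TYPE(real^'d) * B / 2 * ((\<Sum>m\<in>A. (norm (c m))\<^sup>2) + (\<Sum>n\<in>A'. (norm (e n))\<^sup>2)))"
proof -
  let ?k = "\<lambda>\<eta> \<xi>::real^'d. 1 / (1 + norm (\<eta> - \<xi>) / h) ^ (2 * CARD('d))"
  let ?\<kappa> = "h ^ CARD('d) * decay_mass TYPE(real^'d)"
  let ?p = "\<lambda>\<eta>. (norm (trig_poly A c \<eta>) * \<rho> \<eta>)\<^sup>2"
  let ?q = "\<lambda>\<xi>. (norm (trig_poly A' e \<xi>) * \<rho> \<xi>)\<^sup>2"
  let ?S = "\<Sum>m\<in>A. (norm (c m))\<^sup>2" and ?T = "\<Sum>n\<in>A'. (norm (e n))\<^sup>2"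
  have [measurable]: "\<rho> \<in> borel_measurable borel" and B: "0 \<le> B" and \<rho>0: "\<And>x. 0 \<le> \<rho> x"
    using \<rho> by (auto simp: trig_bounded_def)
  have k0: "0 \<le> ?k \<eta> \<xi>" for \<eta> \<xi> using h by simp
  have S0: "0 \<le> ?S" "0 \<le> ?T" by (auto intro: sum_nonneg)
  have \<kappa>0: "0 \<le> ?\<kappa>" using h by (intro mult_nonneg_nonneg decay_mass_nonneg) auto
  have k1: "(\<integral>\<^sup>+\<xi>. ennreal (?k \<eta> \<xi>) \<partial>lborel) = ennreal ?\<kappa>" for \<eta>
    using nn_integral_decay_mass[OF h, of \<eta>] by simp
  have k2: "(\<integral>\<^sup>+\<eta>. ennreal (?k \<eta> \<xi>) \<partial>lborel) = ennreal ?\<kappa>" for \<xi>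
    using nn_integral_decay_mass[OF h, of \<xi>] by (simp add: norm_minus_commute)
  have P: "(\<integral>\<^sup>+\<eta>. ennreal (?p \<eta>) \<partial>lborel) \<le> ennreal (B * ?S)" and Q: "(\<integral>\<^sup>+\<xi>. ennreal (?q \<xi>) \<partial>lborel) \<le> ennreal (B * ?T)"
    using \<rho> A by (auto simp: trig_bounded_def)
  have "(\<integral>\<^sup>+z. ennreal (norm (trig_poly A c (fst z)) * norm (trig_poly A' e (snd z)) * norm (H (fst z) (snd z))) \<partial>(lborel \<Otimes>\<^sub>M lborel))
    \<le> (\<integral>\<^sup>+z. ennreal (\<theta> / 2) * (ennreal (?p (fst z)) * ennreal (?k (fst z) (snd z)) + ennreal (?q (snd z)) * ennreal (?k (fst z) (snd z))) \<partial>(lborel \<Otimes>\<^sub>M lborel))"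
  proof (rule nn_integral_mono)
    fix z :: "(real^'d) \<times> (real^'d)"
    obtain \<eta> \<xi> where z: "z = (\<eta>, \<xi>)" by force
    let ?x = "norm (trig_poly A c \<eta>)" and ?y = "norm (trig_poly A' e \<xi>)"
    have "?x * ?y * norm (H \<eta> \<xi>) \<le> ?x * ?y * (\<theta> * (\<rho> \<eta> * \<rho> \<xi> / (1 + norm (\<eta> - \<xi>) / h) ^ (2 * CARD('d))))"
      by (intro mult_left_mono H) auto
    also have "\<dots> = \<theta> * ?k \<eta> \<xi> * ((?x * \<rho> \<eta>) * (?y * \<rho> \<xi>))" by (simp add: mult_ac)
    also have "\<dots> \<le> \<theta> * ?k \<eta> \<xi> * ((?p \<eta> + ?q \<xi>) / 2)"
    proof (rule mult_left_mono)
      show "(?x * \<rho> \<eta>) * (?y * \<rho> \<xi>) \<le> (?p \<eta> + ?q \<xi>) / 2"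
        using sum_squares_bound[of "?x * \<rho> \<eta>" "?y * \<rho> \<xi>"] by simp
      show "0 \<le> \<theta> * ?k \<eta> \<xi>" using \<theta> k0 by (intro mult_nonneg_nonneg)
    qed
    also have "\<dots> = \<theta> / 2 * (?p \<eta> * ?k \<eta> \<xi> + ?q \<xi> * ?k \<eta> \<xi>)"
    proof -
      have "\<theta> * k * ((p + q) / 2) = \<theta> / 2 * (p * k + q * k)" for k p q :: real
        by (simp add: algebra_simps)
      then show ?thesis .
    qed
    finally have "ennreal (?x * ?y * norm (H \<eta> \<xi>)) \<le> ennreal (\<theta> / 2 * (?p \<eta> * ?k \<eta> \<xi> + ?q \<xi> * ?k \<eta> \<xi>))"
      by (rule ennreal_leI)
    also have "\<dots> = ennreal (\<theta> / 2) * (ennreal (?p \<eta>) * ennreal (?k \<eta> \<xi>) + ennreal (?q \<xi>) * ennreal (?k \<eta> \<xi>))"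
      using \<theta> k0[of \<eta> \<xi>]
      by (simp only: ennreal_mult ennreal_plus mult_nonneg_nonneg zero_le_power2 add_nonneg_nonneg divide_nonneg_nonneg zero_le_numeral)
    finally show "ennreal (norm (trig_poly A c (fst z)) * norm (trig_poly A' e (snd z)) * norm (H (fst z) (snd z))) \<le>
        ennreal (\<theta> / 2) * (ennreal (?p (fst z)) * ennreal (?k (fst z) (snd z)) + ennreal (?q (snd z)) * ennreal (?k (fst z) (snd z)))"
      by (simp add: z)
  qed
  also have "\<dots> = ennreal (\<theta> / 2) * ((\<integral>\<^sup>+z. ennreal (?p (fst z)) * ennreal (?k (fst z) (snd z)) \<partial>(lborel \<Otimes>\<^sub>M lborel))
      + (\<integral>\<^sup>+z. ennreal (?q (snd z)) * ennreal (?k (fst z) (snd z)) \<partial>(lborel \<Otimes>\<^sub>M lborel)))"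
    by (subst nn_integral_cmult, measurable, subst nn_integral_add, measurable)
  also have "(\<integral>\<^sup>+z. ennreal (?p (fst z)) * ennreal (?k (fst z) (snd z)) \<partial>(lborel \<Otimes>\<^sub>M lborel))
      = (\<integral>\<^sup>+\<eta>. (\<integral>\<^sup>+\<xi>. ennreal (?p \<eta>) * ennreal (?k \<eta> \<xi>) \<partial>lborel) \<partial>lborel)"
    by (subst lborel.nn_integral_fst[symmetric]) auto
  also have "\<dots> = (\<integral>\<^sup>+\<eta>. ennreal (?p \<eta>) \<partial>lborel) * ennreal ?\<kappa>"
    by (subst nn_integral_cmult, measurable) (simp only: k1, rule nn_integral_multc, measurable)
  also have "(\<integral>\<^sup>+z. ennreal (?q (snd z)) * ennreal (?k (fst z) (snd z)) \<partial>(lborel \<Otimes>\<^sub>M lborel))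
      = (\<integral>\<^sup>+\<xi>. (\<integral>\<^sup>+\<eta>. ennreal (?q \<xi>) * ennreal (?k \<eta> \<xi>) \<partial>lborel) \<partial>lborel)"
    by (subst lborel_pair.nn_integral_snd[symmetric]) auto
  also have "\<dots> = (\<integral>\<^sup>+\<xi>. ennreal (?q \<xi>) \<partial>lborel) * ennreal ?\<kappa>"
    by (subst nn_integral_cmult, measurable) (simp only: k2, rule nn_integral_multc, measurable)
  also have "ennreal (\<theta> / 2) * ((\<integral>\<^sup>+\<eta>. ennreal (?p \<eta>) \<partial>lborel) * ennreal ?\<kappa> + (\<integral>\<^sup>+\<xi>. ennreal (?q \<xi>) \<partial>lborel) * ennreal ?\<kappa>)
     \<le> ennreal (\<theta> / 2) * (ennreal (B * ?S) * ennreal ?\<kappa> + ennreal (B * ?T) * ennreal ?\<kappa>)"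
    by (intro mult_left_mono add_mono mult_right_mono P Q) auto
  also have "\<dots> = ennreal (\<theta> / 2 * ((B * ?S) * ?\<kappa> + (B * ?T) * ?\<kappa>))"
    using \<theta> B S0 \<kappa>0 by (simp only: ennreal_mult ennreal_plus mult_nonneg_nonneg add_nonneg_nonneg divide_nonneg_nonneg zero_le_numeral)
  also have "\<theta> / 2 * ((B * ?S) * ?\<kappa> + (B * ?T) * ?\<kappa>) = \<theta> * h ^ CARD('d) * decay_mass TYPE(real^'d) * B / 2 * (?S + ?T)"
    by (simp add: algebra_simps)
  finally show ?thesis .
qed

text \<open>Summed against finitely many coefficients, the entries combine to the integral of two
  trigonometric polynomials against \<open>H\<close>, to which Schur's test applies.\<close>

lemma
  fixes H :: "real ^ 'd::finite \<Rightarrow> real ^ 'd \<Rightarrow> complex"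
  assumes \<rho>: "trig_bounded \<rho> B" and h: "h > 0" and \<theta>: "0 \<le> \<theta>"
    and Hm: "(\<lambda>z. H (fst z) (snd z)) \<in> borel_measurable (borel \<Otimes>\<^sub>M borel)"
    and H: "\<And>\<eta> \<xi>. norm (H \<eta> \<xi>) \<le> \<theta> * (\<rho> \<eta> * \<rho> \<xi> / (1 + norm (\<eta> - \<xi>) / h) ^ (2 * CARD('d)))"
  shows grid_form_integrable: "integrable (lborel \<Otimes>\<^sub>M lborel)
      (\<lambda>z. H (fst z) (snd z) * cis (real_vec m \<bullet> fst z) * cis (- (real_vec n \<bullet> snd z)))"
    and grid_form_bound: "finite A \<Longrightarrow> finite A' \<Longrightarrow> norm (\<Sum>m\<in>A. \<Sum>n\<in>A'. cnj (c m) * e n * grid_form H m n)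
      \<le> \<theta> * h ^ CARD('d) * decay_mass TYPE(real^'d) * B / 2 * ((\<Sum>m\<in>A. (norm (c m))\<^sup>2) + (\<Sum>n\<in>A'. (norm (e n))\<^sup>2))"
proof -
  note [measurable] = Hm
  have B: "0 \<le> B" using \<rho> by (auto simp: trig_bounded_def)
  show int: "integrable (lborel \<Otimes>\<^sub>M lborel)
      (\<lambda>z. H (fst z) (snd z) * cis (real_vec m \<bullet> fst z) * cis (- (real_vec n \<bullet> snd z)))" for m n
  \<comment> \<open>Characters have modulus 1, so a single entry is covered by the same bound with
    the constant polynomial 1 in both places.\<close>
  proof (rule integrableI_bounded)
    have "(\<integral>\<^sup>+z. ennreal (norm (H (fst z) (snd z) * cis (real_vec m \<bullet> fst z) * cis (- (real_vec n \<bullet> snd z)))) \<partial>(lborel \<Otimes>\<^sub>M lborel))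
      = (\<integral>\<^sup>+z. ennreal (norm (trig_poly {0} (\<lambda>_. 1) (fst z)) * norm (trig_poly {0} (\<lambda>_. 1) (snd z)) * norm (H (fst z) (snd z))) \<partial>(lborel \<Otimes>\<^sub>M lborel))"
      by (simp add: trig_poly_def norm_mult)
    also have "\<dots> < \<infinity>"
      by (rule le_less_trans[OF trig_poly_form_nn_bound[OF \<rho> h \<theta> H]]) auto
    finally show "(\<integral>\<^sup>+z. ennreal (norm (H (fst z) (snd z) * cis (real_vec m \<bullet> fst z) * cis (- (real_vec n \<bullet> snd z)))) \<partial>(lborel \<Otimes>\<^sub>M lborel)) < \<infinity>" .
  qed measurable
  assume A: "finite A" "finite A'"
  have eq: "cnj (trig_poly A c (fst z)) * trig_poly A' e (snd z) * H (fst z) (snd z)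
    = (\<Sum>m\<in>A. \<Sum>n\<in>A'. cnj (c m) * e n * (H (fst z) (snd z) * cis (real_vec m \<bullet> fst z) * cis (- (real_vec n \<bullet> snd z))))" for z
    unfolding trig_poly_def cnj_sum sum_product unfolding sum_distrib_right
    by (intro sum.cong refl) (simp add: cis_cnj mult_ac)
  have "(\<Sum>m\<in>A. \<Sum>n\<in>A'. cnj (c m) * e n * grid_form H m n)
    = (LINT z|(lborel \<Otimes>\<^sub>M lborel). cnj (trig_poly A c (fst z)) * trig_poly A' e (snd z) * H (fst z) (snd z))"
    unfolding eq grid_form_def integral_mult_right_zero[symmetric]
    by (subst Bochner_Integration.integral_sum, intro Bochner_Integration.integrable_sum integrable_mult_right int)
      (intro sum.cong refl Bochner_Integration.integral_sum[symmetric] integrable_mult_right int)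
  then have "ennreal (norm (\<Sum>m\<in>A. \<Sum>n\<in>A'. cnj (c m) * e n * grid_form H m n))
     \<le> (\<integral>\<^sup>+z. ennreal (norm (cnj (trig_poly A c (fst z)) * trig_poly A' e (snd z) * H (fst z) (snd z))) \<partial>(lborel \<Otimes>\<^sub>M lborel))"
    using integral_norm_bound_ennreal[of "lborel \<Otimes>\<^sub>M lborel" "\<lambda>z. cnj (trig_poly A c (fst z)) * trig_poly A' e (snd z) * H (fst z) (snd z)"]
    unfolding eq by (simp add: int Bochner_Integration.integrable_sum)
  also have "\<dots> = (\<integral>\<^sup>+z. ennreal (norm (trig_poly A c (fst z)) * norm (trig_poly A' e (snd z)) * norm (H (fst z) (snd z))) \<partial>(lborel \<Otimes>\<^sub>M lborel))"
    by (simp add: norm_mult)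
  also have "\<dots> \<le> ennreal (\<theta> * h ^ CARD('d) * decay_mass TYPE(real^'d) * B / 2 * ((\<Sum>m\<in>A. (norm (c m))\<^sup>2) + (\<Sum>n\<in>A'. (norm (e n))\<^sup>2)))"
    by (rule trig_poly_form_nn_bound[OF \<rho> h \<theta> H A])
  finally show "norm (\<Sum>m\<in>A. \<Sum>n\<in>A'. cnj (c m) * e n * grid_form H m n)
      \<le> \<theta> * h ^ CARD('d) * decay_mass TYPE(real^'d) * B / 2 * ((\<Sum>m\<in>A. (norm (c m))\<^sup>2) + (\<Sum>n\<in>A'. (norm (e n))\<^sup>2))"
    using \<theta> h B decay_mass_nonneg by (subst (asm) ennreal_le_iff) (auto intro!: mult_nonneg_nonneg divide_nonneg_nonneg add_nonneg_nonneg sum_nonneg)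
qed

section \<open>From finite coefficient families to square summable ones\<close>

text \<open>A form bound valid for arbitrary coefficients absorbs the phases \<open>p\<close>; it
  thereby bounds sums of norms and yields absolute summability.\<close>

lemma finite_sum_phase:
  fixes f :: "'i \<Rightarrow> complex"
  obtains p where "\<And>i. norm (p i) \<le> 1" "(\<Sum>i\<in>A. norm (f i)) = norm (\<Sum>i\<in>A. p i * f i)"
proof -
  let ?p = "\<lambda>i. cnj (sgn (f i))"
  have "?p i * f i = of_real (norm (f i))" for i
    by (cases "f i = 0") (auto simp: sgn_div_norm scaleR_conv_of_real complex_norm_square[symmetric] power2_eq_square field_simps mult.commute[of "cnj _"])
  then have eq: "(\<Sum>i\<in>A. ?p i * f i) = of_real (\<Sum>i\<in>A. norm (f i))" by simp
  have "norm (\<Sum>i\<in>A. ?p i * f i) = (\<Sum>i\<in>A. norm (f i))"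
    unfolding eq norm_of_real by (simp add: sum_nonneg)
  with eq show thesis by (intro that[of ?p]) (auto simp: norm_sgn)
qed

lemma abs_summable_onI_bound:
  fixes f :: "'i \<Rightarrow> complex"
  assumes "\<And>A. finite A \<Longrightarrow> (\<Sum>i\<in>A. norm (f i)) \<le> C"
  shows "(\<lambda>i. norm (f i)) summable_on UNIV" "f summable_on UNIV" "norm (\<Sum>\<^sub>\<infinity>i. f i) \<le> C"
proof -
  show 1: "(\<lambda>i. norm (f i)) summable_on UNIV"
    by (rule nonneg_bdd_above_summable_on) (auto intro!: bdd_aboveI2 assms)
  then show "f summable_on UNIV" by (rule abs_summable_summable)
  show "norm (\<Sum>\<^sub>\<infinity>i. f i) \<le> C"
    by (rule order_trans[OF norm_infsum_bound[OF 1] infsum_le_finite_sums[OF 1 assms]])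
qed

text \<open>Extends a form bound from finitely supported to square summable grid functions.
  Summability is proved alongside, since a divergent \<open>infsum\<close> is 0 by default and a
  bound on it would be empty.\<close>

lemma
  fixes d :: "'i \<Rightarrow> 'j \<Rightarrow> complex"
  assumes bound: "\<And>A A' c e. finite A \<Longrightarrow> finite A' \<Longrightarrow>
      norm (\<Sum>m\<in>A. \<Sum>n\<in>A'. cnj (c m) * e n * d m n) \<le> C * ((\<Sum>m\<in>A. (norm (c m))\<^sup>2) + (\<Sum>n\<in>A'. (norm (e n))\<^sup>2))"
    and C: "0 \<le> C"
    and U: "(\<lambda>m. (norm (U m))\<^sup>2) summable_on UNIV" and V: "(\<lambda>n. (norm (V n))\<^sup>2) summable_on UNIV"
  shows form_inner_summable: "(\<lambda>n. V n * d m n) summable_on UNIV"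
    and form_outer_summable: "(\<lambda>m. cnj (U m) * (\<Sum>\<^sub>\<infinity>n. V n * d m n)) summable_on UNIV"
    and form_infsum_bound: "norm (\<Sum>\<^sub>\<infinity>m. cnj (U m) * (\<Sum>\<^sub>\<infinity>n. V n * d m n))
        \<le> C * ((\<Sum>\<^sub>\<infinity>m. (norm (U m))\<^sup>2) + (\<Sum>\<^sub>\<infinity>n. (norm (V n))\<^sup>2))"
proof -
  let ?S = "\<Sum>\<^sub>\<infinity>m. (norm (U m))\<^sup>2" and ?T = "\<Sum>\<^sub>\<infinity>n. (norm (V n))\<^sup>2"
  have phase: "(\<Sum>i\<in>A. (norm (p i * W i))\<^sup>2) \<le> (\<Sum>\<^sub>\<infinity>i. (norm (W i))\<^sup>2)"
    if "finite A" "\<And>i. norm (p i) \<le> 1" "(\<lambda>i. (norm (W i))\<^sup>2) summable_on UNIV" for A and p W :: "'k \<Rightarrow> complex"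
  proof -
    have "(\<Sum>i\<in>A. (norm (p i * W i))\<^sup>2) \<le> (\<Sum>i\<in>A. (norm (W i))\<^sup>2)"
      using that by (intro sum_mono power_mono) (auto simp: norm_mult mult_left_le_one_le)
    also have "\<dots> \<le> (\<Sum>\<^sub>\<infinity>i. (norm (W i))\<^sup>2)"
      using that by (intro finite_sum_le_infsum) auto
    finally show ?thesis .
  qed
  show inner: "(\<lambda>n. V n * d m n) summable_on UNIV" for m
  proof (rule abs_summable_onI_bound)
    fix A :: "'j set" assume A: "finite A"
    obtain p where p: "\<And>i. norm (p i) \<le> 1" "(\<Sum>n\<in>A. norm (V n * d m n)) = norm (\<Sum>n\<in>A. p n * (V n * d m n))"
      by (rule finite_sum_phase[where f="\<lambda>n. V n * d m n" and A=A]) (rule that, auto)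
    \<comment> \<open>A single row is a form supported on \<open>{m}\<close> with coefficient 1;
      this is where the summand 1 in the bound comes from.\<close>
    have "(\<Sum>n\<in>A. norm (V n * d m n)) = norm (\<Sum>m'\<in>{m}. \<Sum>n\<in>A. cnj 1 * (p n * V n) * d m' n)"
      unfolding p(2) by (simp add: mult.assoc)
    also have "\<dots> \<le> C * ((\<Sum>m'\<in>{m}. (norm (1::complex))\<^sup>2) + (\<Sum>n\<in>A. (norm (p n * V n))\<^sup>2))"
      by (rule bound) (use A in auto)
    also have "\<dots> \<le> C * (1 + ?T)"
      using C phase[OF A p(1) V] by (intro mult_left_mono) auto
    finally show "(\<Sum>n\<in>A. norm (V n * d m n)) \<le> C * (1 + ?T)" .
  qed
  let ?w = "\<lambda>m. \<Sum>\<^sub>\<infinity>n. V n * d m n"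
  have outer: "(\<Sum>m\<in>A. norm (cnj (U m) * ?w m)) \<le> C * (?S + ?T)" if A: "finite A" for A
  proof -
    obtain p where p: "\<And>i. norm (p i) \<le> 1" "(\<Sum>m\<in>A. norm (cnj (U m) * ?w m)) = norm (\<Sum>m\<in>A. p m * (cnj (U m) * ?w m))"
      by (rule finite_sum_phase[where f="\<lambda>m. cnj (U m) * ?w m" and A=A]) (rule that, auto)
    let ?c = "\<lambda>m. cnj (p m) * U m"
    \<comment> \<open>With \<open>A\<close> fixed only finitely many inner sums are involved, so the
      bound for finite \<open>A'\<close> passes to the complete inner sums.\<close>
    have "((\<lambda>A'. norm (\<Sum>m\<in>A. cnj (?c m) * (\<Sum>n\<in>A'. V n * d m n))) \<longlongrightarrow> norm (\<Sum>m\<in>A. cnj (?c m) * ?w m)) (finite_subsets_at_top UNIV)"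
      using has_sum_infsum[OF inner] unfolding has_sum_def by (intro tendsto_intros)
    then have "norm (\<Sum>m\<in>A. cnj (?c m) * ?w m) \<le> C * (?S + ?T)"
    proof (rule tendsto_upperbound)
      show "\<forall>\<^sub>F A' in finite_subsets_at_top UNIV. norm (\<Sum>m\<in>A. cnj (?c m) * (\<Sum>n\<in>A'. V n * d m n)) \<le> C * (?S + ?T)"
      proof (rule eventually_finite_subsets_at_top_weakI)
        fix A' :: "'j set" assume A': "finite A'"
        have "norm (\<Sum>m\<in>A. cnj (?c m) * (\<Sum>n\<in>A'. V n * d m n)) = norm (\<Sum>m\<in>A. \<Sum>n\<in>A'. cnj (?c m) * V n * d m n)"
          by (simp add: sum_distrib_left mult.assoc)
        also have "\<dots> \<le> C * ((\<Sum>m\<in>A. (norm (?c m))\<^sup>2) + (\<Sum>n\<in>A'. (norm (V n))\<^sup>2))"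
          by (rule bound[OF A A'])
        also have "\<dots> \<le> C * (?S + ?T)"
          using phase[OF A _ U, of "\<lambda>m. cnj (p m)"] phase[OF A' _ V, of "\<lambda>_. 1"] p(1) C by (intro mult_left_mono add_mono) auto
        finally show "norm (\<Sum>m\<in>A. cnj (?c m) * (\<Sum>n\<in>A'. V n * d m n)) \<le> C * (?S + ?T)" .
      qed
    qed simp
    then show ?thesis unfolding p(2) by (simp add: mult.assoc)
  qed
  show "(\<lambda>m. cnj (U m) * ?w m) summable_on UNIV" by (rule abs_summable_onI_bound[OF outer])
  show "norm (\<Sum>\<^sub>\<infinity>m. cnj (U m) * ?w m) \<le> C * (?S + ?T)" by (rule abs_summable_onI_bound[OF outer])
qed

section \<open>The kernel common to both transforms\<close>

definition wigner_kernel ::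
  "real \<Rightarrow> real \<Rightarrow> ((real ^ 'd) \<times> (real ^ 'd) \<Rightarrow> complex) \<Rightarrow> real ^ 'd \<Rightarrow> real ^ 'd::finite \<Rightarrow> complex" where
  "wigner_kernel h \<epsilon> a \<eta> \<xi> = partial_fourier a ((1 / h) *\<^sub>R (\<eta> - \<xi>)) ((\<epsilon> / h) *\<^sub>R \<xi>)"

lemma wigner_kernel_measurable:
  fixes a :: "(real ^ 'd::finite) \<times> (real ^ 'd) \<Rightarrow> complex"
  assumes "a \<in> schwartz"
  shows "(\<lambda>z. wigner_kernel h \<epsilon> a (fst z) (snd z)) \<in> borel_measurable (borel \<Otimes>\<^sub>M borel)"
proof -
  have "(\<lambda>z::(real^'d) \<times> (real^'d). ((1 / h) *\<^sub>R (fst z - snd z), (\<epsilon> / h) *\<^sub>R snd z)) \<in> borel \<Otimes>\<^sub>M borel \<rightarrow>\<^sub>M borel \<Otimes>\<^sub>M borel"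
    by measurable
  from measurable_compose[OF this partial_fourier_measurable[OF assms]] show ?thesis
    by (simp add: wigner_kernel_def)
qed

text \<open>The two factors in front of the kernel are the reserve that later produces smallness
  away from the origin; the right side supplies the weights and the kernel for Schur's test. The
  constant does not depend on \<open>h\<close> and \<open>\<epsilon>\<close>.\<close>

lemma wigner_kernel_bound:
  fixes a :: "(real ^ 'd::finite) \<times> (real ^ 'd) \<Rightarrow> complex"
  assumes a: "a \<in> schwartz"
  obtains C where "C > 0"
    "\<And>h \<epsilon> \<eta> \<xi>. 0 < h \<Longrightarrow> h \<le> 1 \<Longrightarrow> h \<le> \<epsilon> \<Longrightarrow>
      (1 + norm (\<eta> - \<xi>) / h) * (1 + \<epsilon> / h * norm \<xi>) * norm (wigner_kernel h \<epsilon> a \<eta> \<xi>)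
      \<le> C * (1 / (1 + norm \<eta>) ^ M * (1 / (1 + norm \<xi>) ^ M) / (1 + norm (\<eta> - \<xi>) / h) ^ (2 * CARD('d)))"
proof -
  \<comment> \<open>In \<open>p\<close>: \<open>M\<close> powers for the weight in
    \<open>\<eta>\<close>, \<open>2 d\<close> for Schur's test, one in reserve. In
    \<open>\<zeta>\<close>: \<open>M\<close> powers for \<open>\<eta>\<close>, \<open>M\<close> for
    \<open>\<xi>\<close>, one in reserve.\<close>
  obtain C where C: "\<And>p \<zeta>. (1 + norm p) ^ (M + (2 * CARD('d) + 1)) * (1 + norm \<zeta>) ^ (M + (M + 1)) * norm (partial_fourier a p \<zeta>) \<le> C"
    using partial_fourier_decay[OF a] by metis
  have "(1 + norm (\<eta> - \<xi>) / h) * (1 + \<epsilon> / h * norm \<xi>) * norm (wigner_kernel h \<epsilon> a \<eta> \<xi>)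
      \<le> (\<bar>C\<bar> + 1) * (1 / (1 + norm \<eta>) ^ M * (1 / (1 + norm \<xi>) ^ M) / (1 + norm (\<eta> - \<xi>) / h) ^ (2 * CARD('d)))"
    if h: "0 < h" "h \<le> 1" "h \<le> \<epsilon>" for h \<epsilon> and \<eta> \<xi> :: "real^'d"
  proof -
    let ?p = "(1 / h) *\<^sub>R (\<eta> - \<xi>)" and ?\<zeta> = "(\<epsilon> / h) *\<^sub>R \<xi>"
    let ?K = "norm (partial_fourier a ?p ?\<zeta>)"
    have np: "norm ?p = norm (\<eta> - \<xi>) / h" and n\<zeta>: "norm ?\<zeta> = \<epsilon> / h * norm \<xi>" using h by auto
    \<comment> \<open>\<open>h \<le> \<epsilon>\<close> bounds \<open>norm \<xi>\<close> by
      \<open>norm ?\<zeta>\<close>, and \<open>h \<le> 1\<close> bounds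
      \<open>norm (\<eta> - \<xi>)\<close> by \<open>norm ?p\<close>; hence decay in the rescaled
      variables implies decay in the original ones.\<close>
    have \<xi>: "norm \<xi> \<le> norm ?\<zeta>"
      using mult_right_mono[of 1 "\<epsilon> / h" "norm \<xi>"] h unfolding n\<zeta> by simp
    have "norm (\<eta> - \<xi>) \<le> norm ?p"
      unfolding np using h by (simp add: pos_le_divide_eq mult_left_le)
    then have "norm \<eta> \<le> norm ?p + norm ?\<zeta>" using \<xi> norm_triangle_ineq2[of \<eta> \<xi>] by linarith
    moreover have "0 \<le> norm ?p * norm ?\<zeta>" by simp
    ultimately have \<eta>: "1 + norm \<eta> \<le> (1 + norm ?p) * (1 + norm ?\<zeta>)" unfolding ring_distribs by linarith
    have "((1 + norm ?p) * (1 + norm ?\<zeta>)) * ?K * ((1 + norm \<eta>) ^ M * (1 + norm \<xi>) ^ M * (1 + norm ?p) ^ (2 * CARD('d)))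
      \<le> ((1 + norm ?p) * (1 + norm ?\<zeta>)) * ?K * (((1 + norm ?p) * (1 + norm ?\<zeta>)) ^ M * (1 + norm ?\<zeta>) ^ M * (1 + norm ?p) ^ (2 * CARD('d)))"
      using \<eta> \<xi> by (intro mult_left_mono mult_mono power_mono order_refl) auto
    also have "\<dots> = (1 + norm ?p) ^ (M + (2 * CARD('d) + 1)) * (1 + norm ?\<zeta>) ^ (M + (M + 1)) * ?K"
      unfolding power_mult_distrib power_add power_one_right by (simp only: mult_ac)
    also have "\<dots> \<le> \<bar>C\<bar> + 1" using C[of ?p ?\<zeta>] by linarith
    finally have *: "((1 + norm ?p) * (1 + norm ?\<zeta>)) * ?K * ((1 + norm \<eta>) ^ M * (1 + norm \<xi>) ^ M * (1 + norm ?p) ^ (2 * CARD('d))) \<le> \<bar>C\<bar> + 1" .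
    have pos: "0 < (1 + norm \<eta>) ^ M * (1 + norm \<xi>) ^ M * (1 + norm ?p) ^ (2 * CARD('d))"
      by (intro mult_pos_pos zero_less_power add_pos_nonneg) auto
    have "((1 + norm ?p) * (1 + norm ?\<zeta>)) * ?K \<le> (\<bar>C\<bar> + 1) / ((1 + norm \<eta>) ^ M * (1 + norm \<xi>) ^ M * (1 + norm ?p) ^ (2 * CARD('d)))"
      using * by (subst pos_le_divide_eq[OF pos])
    then show ?thesis unfolding wigner_kernel_def np n\<zeta> by simp
  qed
  then show thesis using that[of "\<bar>C\<bar> + 1"] by auto
qed


section \<open>The grid Wigner transform as a form\<close>

text \<open>The substitution \<open>\<eta> = \<xi> + h p\<close> isolates the first argument of the
  partial Fourier transform, and inversion in \<open>p\<close> evaluates \<open>a\<close> at the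
  grid point \<open>h m\<close>. The Jacobian gives the power of \<open>h\<close>, inversion that of
  \<open>2 * pi\<close>.\<close>

lemma grid_form_wigner_kernel:
  fixes a :: "(real ^ 'd::finite) \<times> (real ^ 'd) \<Rightarrow> complex"
  assumes a: "a \<in> schwartz" and h: "h > 0"
    and int: "integrable (lborel \<Otimes>\<^sub>M lborel)
      (\<lambda>z. wigner_kernel h \<epsilon> a (fst z) (snd z) * cis (real_vec m \<bullet> fst z) * cis (- (real_vec n \<bullet> snd z)))"
  shows "grid_form (wigner_kernel h \<epsilon> a) m n = of_real ((2 * pi) ^ CARD('d) * h ^ CARD('d)) *
    (LBINT \<xi>. cis (- (real_vec n \<bullet> \<xi>)) * (cis (real_vec m \<bullet> \<xi>) * a (h *\<^sub>R real_vec m, (\<epsilon> / h) *\<^sub>R \<xi>)))"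
proof -
  have inner: "(LBINT \<eta>. wigner_kernel h \<epsilon> a \<eta> \<xi> * cis (real_vec m \<bullet> \<eta>) * cis (- (real_vec n \<bullet> \<xi>)))
    = of_real ((2 * pi) ^ CARD('d) * h ^ CARD('d)) * (cis (- (real_vec n \<bullet> \<xi>)) * (cis (real_vec m \<bullet> \<xi>) * a (h *\<^sub>R real_vec m, (\<epsilon> / h) *\<^sub>R \<xi>)))" for \<xi>
  proof -
    let ?\<zeta> = "(\<epsilon> / h) *\<^sub>R \<xi>"
    have [measurable]: "(\<lambda>p. partial_fourier a p ?\<zeta>) \<in> borel_measurable borel"
      unfolding partial_fourier_def by (intro schwartz_measurable fourier_schwartz schwartz_slice_fst a)
    have "(LBINT \<eta>. wigner_kernel h \<epsilon> a \<eta> \<xi> * cis (real_vec m \<bullet> \<eta>) * cis (- (real_vec n \<bullet> \<xi>)))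
      = h ^ DIM(real^'d) *\<^sub>R (LBINT p. wigner_kernel h \<epsilon> a (\<xi> + h *\<^sub>R p) \<xi> * cis (real_vec m \<bullet> (\<xi> + h *\<^sub>R p)) * cis (- (real_vec n \<bullet> \<xi>)))"
      unfolding wigner_kernel_def by (rule integral_lborel_affine[OF h]) measurable
    also have "\<dots> = h ^ DIM(real^'d) *\<^sub>R (LBINT p. (cis (- (real_vec n \<bullet> \<xi>)) * cis (real_vec m \<bullet> \<xi>)) * (partial_fourier a p ?\<zeta> * cis ((h *\<^sub>R real_vec m) \<bullet> p)))"
      using h by (simp add: wigner_kernel_def inner_add_right cis_mult[symmetric] mult_ac)
    also have "\<dots> = h ^ DIM(real^'d) *\<^sub>R ((cis (- (real_vec n \<bullet> \<xi>)) * cis (real_vec m \<bullet> \<xi>)) * (LBINT p. partial_fourier a p ?\<zeta> * cis ((h *\<^sub>R real_vec m) \<bullet> p)))"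
      unfolding integral_mult_right_zero ..
    also have "\<dots> = of_real ((2 * pi) ^ CARD('d) * h ^ CARD('d)) * (cis (- (real_vec n \<bullet> \<xi>)) * (cis (real_vec m \<bullet> \<xi>) * a (h *\<^sub>R real_vec m, ?\<zeta>)))"
      unfolding partial_fourier_inversion[OF a] by (simp add: scaleR_conv_of_real)
    finally show ?thesis .
  qed
  have "grid_form (wigner_kernel h \<epsilon> a) m n
      = (LBINT \<xi>. LBINT \<eta>. wigner_kernel h \<epsilon> a \<eta> \<xi> * cis (real_vec m \<bullet> \<eta>) * cis (- (real_vec n \<bullet> \<xi>)))"
    unfolding grid_form_def using int
    by (subst lborel_pair.integral_snd) (auto simp: case_prod_beta')
  then show ?thesis unfolding inner integral_mult_right_zero .
qed

lemma grid_wigner_eq: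
  fixes a :: "(real ^ 'd::finite) \<times> (real ^ 'd) \<Rightarrow> complex"
  assumes a: "a \<in> schwartz" and h: "h > 0" and \<epsilon>: "\<epsilon> > 0"
    and int: "\<And>m n. integrable (lborel \<Otimes>\<^sub>M lborel)
      (\<lambda>z. wigner_kernel h \<epsilon> a (fst z) (snd z) * cis (real_vec m \<bullet> fst z) * cis (- (real_vec n \<bullet> snd z)))"
  shows "grid_wigner h \<epsilon> U a = of_real (1 / (2 * pi) ^ (2 * CARD('d))) *
    (\<Sum>\<^sub>\<infinity>m. cnj (U m) * (\<Sum>\<^sub>\<infinity>n. U n * grid_form (wigner_kernel h \<epsilon> a) m n))"
proof -
  let ?c = "(2 * pi) ^ CARD('d) * h ^ CARD('d)"
  let ?I = "\<lambda>m n. LBINT \<xi>. cis (- (real_vec n \<bullet> \<xi>)) * (cis (real_vec m \<bullet> \<xi>) * a (h *\<^sub>R real_vec m, (\<epsilon> / h) *\<^sub>R \<xi>))"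
  have I: "(\<Sum>\<^sub>\<infinity>n. U n * ?I m n) = of_real (1 / ?c) * (\<Sum>\<^sub>\<infinity>n. U n * grid_form (wigner_kernel h \<epsilon> a) m n)" for m
    unfolding infsum_cmult_right'[symmetric] using h
    by (intro infsum_cong) (simp add: grid_form_wigner_kernel[OF a h int])
  have "td_dilate (\<epsilon> / h) (grid_fourier U) (\<lambda>\<xi>. cis (h / \<epsilon> * (real_vec m \<bullet> \<xi>)) * a (h *\<^sub>R real_vec m, \<xi>))
    = of_real ((\<epsilon> / h) ^ CARD('d)) * (\<Sum>\<^sub>\<infinity>n. U n * ?I m n)" for m
    using h \<epsilon> by (simp add: td_dilate_def grid_fourier_def)
  then have "grid_wigner h \<epsilon> U a = of_real (h ^ (2 * CARD('d)) / (2 * pi * \<epsilon>) ^ CARD('d)) *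
     (\<Sum>\<^sub>\<infinity>m. cnj (U m) * (of_real ((\<epsilon> / h) ^ CARD('d)) * (of_real (1 / ?c) * (\<Sum>\<^sub>\<infinity>n. U n * grid_form (wigner_kernel h \<epsilon> a) m n))))"
    unfolding grid_wigner_def I by simp
  also have "\<dots> = of_real (h ^ (2 * CARD('d)) / (2 * pi * \<epsilon>) ^ CARD('d)) *
     (\<Sum>\<^sub>\<infinity>m. (of_real ((\<epsilon> / h) ^ CARD('d)) * of_real (1 / ?c)) * (cnj (U m) * (\<Sum>\<^sub>\<infinity>n. U n * grid_form (wigner_kernel h \<epsilon> a) m n)))"
    by (simp only: mult_ac)
  also have "\<dots> = of_real (h ^ (2 * CARD('d)) / (2 * pi * \<epsilon>) ^ CARD('d) * ((\<epsilon> / h) ^ CARD('d) * (1 / ?c))) *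
     (\<Sum>\<^sub>\<infinity>m. cnj (U m) * (\<Sum>\<^sub>\<infinity>n. U n * grid_form (wigner_kernel h \<epsilon> a) m n))"
    unfolding infsum_cmult_right' of_real_mult by (simp only: mult.assoc)
  \<comment> \<open>All powers of \<open>h\<close> and \<open>\<epsilon>\<close> cancel, so the
    prefactor of the form depends on the dimension only.\<close>
  also have "h ^ (2 * CARD('d)) / (2 * pi * \<epsilon>) ^ CARD('d) * ((\<epsilon> / h) ^ CARD('d) * (1 / ?c)) = 1 / (2 * pi) ^ (2 * CARD('d))"
  proof -
    have "x ^ (2 * n) = x ^ n * x ^ n" for x :: real and n
      by (metis mult_2 power_add)
    then show ?thesis using h \<epsilon> by (simp add: power_mult_distrib power_divide)
  qed
  finally show ?thesis .
qed

section \<open>Series of Schwartz functions with square summable coefficients\<close>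

lemma tempered_density_mult:
  assumes \<Omega>: "tempered_density \<Omega>" and [measurable]: "g \<in> borel_measurable borel" and g: "\<And>y. norm (g y) \<le> K"
  shows "tempered_density (\<lambda>y. \<Omega> y * g y)"
proof -
  have [measurable]: "\<Omega> \<in> borel_measurable borel" using \<Omega> by (simp add: tempered_density_def)
  obtain M where M: "integrable lborel (\<lambda>y. norm (\<Omega> y) / (1 + norm y) ^ M)" using \<Omega> by (auto simp: tempered_density_def)
  have "integrable lborel (\<lambda>y. norm (\<Omega> y * g y) / (1 + norm y) ^ M)"
  proof (rule Bochner_Integration.integrable_bound[OF integrable_mult_left[OF M, of K]])
    have "norm (\<Omega> y * g y) / (1 + norm y) ^ M \<le> norm (\<Omega> y) / (1 + norm y) ^ M * K" for y
      using mult_left_mono[OF g[of y], of "norm (\<Omega> y) / (1 + norm y) ^ M"] by (simp add: norm_mult)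
    then show "AE y in lborel. norm (norm (\<Omega> y * g y) / (1 + norm y) ^ M) \<le> norm (norm (\<Omega> y) / (1 + norm y) ^ M * K)"
      by (intro always_eventually allI) (use order_trans[OF _ abs_ge_self] in \<open>fastforce\<close>)
  qed measurable
  then show ?thesis unfolding tempered_density_def by (intro conjI exI[of _ M]) measurable
qed

lemma tempered_density_cnj: "tempered_density \<Omega> \<Longrightarrow> tempered_density (\<lambda>y. cnj (\<Omega> y))"
  by (auto simp: tempered_density_def)

lemma trig_poly_norm_le: "norm (trig_poly A c x) \<le> (\<Sum>n\<in>A. norm (c n))"
  unfolding trig_poly_def by (rule order_trans[OF norm_sum]) (simp add: norm_mult)

lemma trig_poly_singleton: "trig_poly {n} (\<lambda>_. 1) x = cis (- (real_vec n \<bullet> x))"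
  by (simp add: trig_poly_def)

text \<open>Testing \<open>trig_bounded\<close> with the constant polynomial 1 makes the weight
  square integrable. Its product with a square integrable power is then integrable, by
  \<open>p q \<le> p^2 + q^2\<close>.\<close>

lemma trig_bounded_tempered:
  fixes F :: "real ^ 'd::finite \<Rightarrow> complex"
  assumes [measurable]: "F \<in> borel_measurable borel"
    and F: "trig_bounded (\<lambda>x. norm (F x) / (1 + norm x) ^ M) B"
  shows "tempered_density F"
proof -
  let ?f = "\<lambda>x. norm (F x) / (1 + norm x) ^ M" and ?g = "\<lambda>x::real^'d. 1 / (1 + norm x) ^ (2 * CARD('d))"
  have "(\<integral>\<^sup>+x. ennreal ((norm (trig_poly {0} (\<lambda>_. 1) x) * ?f x)\<^sup>2) \<partial>lborel) \<le> ennreal (B * (\<Sum>n\<in>{0::int^'d}. (norm (1::complex))\<^sup>2))"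
    using F unfolding trig_bounded_def by blast
  also have "\<dots> < \<infinity>" by simp
  finally have "integrable lborel (\<lambda>x. (?f x)\<^sup>2)"
    by (intro integrableI_bounded) (auto simp: trig_poly_singleton norm_mult)
  moreover have "integrable lborel (\<lambda>x. (?g x)\<^sup>2)"
    using integrable_inverse_norm_power[where 'a="real^'d" and n="2 * CARD('d) * 2"] by (simp add: power_divide power_mult[symmetric])
  ultimately have int: "integrable lborel (\<lambda>x. (?f x)\<^sup>2 + (?g x)\<^sup>2)" by (rule Bochner_Integration.integrable_add)
  have "integrable lborel (\<lambda>x. norm (F x) / (1 + norm x) ^ (M + 2 * CARD('d)))"
  proof (rule Bochner_Integration.integrable_bound[OF int])
    have "norm (norm (F x) / (1 + norm x) ^ (M + 2 * CARD('d))) \<le> norm ((?f x)\<^sup>2 + (?g x)\<^sup>2)" for x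
    proof -
      have "norm (F x) / (1 + norm x) ^ (M + 2 * CARD('d)) = ?f x * ?g x" by (simp add: power_add)
      also have "\<dots> \<le> (?f x)\<^sup>2 + (?g x)\<^sup>2"
      proof -
        have "p * q \<le> p\<^sup>2 + q\<^sup>2" if "0 \<le> p" "0 \<le> q" for p q :: real
          using sum_squares_bound[of p q] mult_nonneg_nonneg[OF that] by linarith
        then show ?thesis by this (intro divide_nonneg_nonneg zero_le_power add_nonneg_nonneg norm_ge_zero zero_le_one)+
      qed
      finally show ?thesis by simp
    qed
    then show "AE x in lborel. norm (norm (F x) / (1 + norm x) ^ (M + 2 * CARD('d))) \<le> norm ((?f x)\<^sup>2 + (?g x)\<^sup>2)"
      by simp
  qed measurable
  then show ?thesis unfolding tempered_density_def using assms(1)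
    by (intro conjI exI[of _ "M + 2 * CARD('d)"])
qed

text \<open>Cauchy-Schwarz against a square integrable power puts the square sum of the coefficients
  into the bound. This is what membership in \<open>grid_L2\<close> controls; a termwise estimate
  would call for the sum of their norms.\<close>

lemma param_integral_trig_bound:
  fixes F :: "real ^ 'd::finite \<Rightarrow> complex" and b :: "'a::euclidean_space \<times> (real ^ 'd) \<Rightarrow> complex"
  assumes [measurable]: "F \<in> borel_measurable borel"
    and F: "trig_bounded (\<lambda>x. norm (F x) / (1 + norm x) ^ M) B" and b: "b \<in> schwartz"
  shows "\<exists>C\<ge>0. \<forall>A e x. finite A \<longrightarrow> (1 + norm x) ^ N * norm (param_integral (\<lambda>y. cnj (F y * trig_poly A e y)) b x)
    \<le> C * sqrt (\<Sum>n\<in>A. (norm (e n))\<^sup>2)"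
proof -
  have [measurable]: "b \<in> borel_measurable borel" by (rule schwartz_measurable[OF b])
  have B: "0 \<le> B" using F by (simp add: trig_bounded_def)
  let ?g = "\<lambda>y::real^'d. 1 / (1 + norm y) ^ (2 * CARD('d))"
  define \<kappa> where "\<kappa> = (LBINT y. (?g y)\<^sup>2)"
  have \<kappa>: "(\<integral>\<^sup>+y. ennreal ((?g y)\<^sup>2) \<partial>lborel) = ennreal \<kappa>" "0 \<le> \<kappa>"
    using integrable_inverse_norm_power[where 'a="real^'d" and n="2 * CARD('d) * 2"] unfolding \<kappa>_def
    by (auto intro!: nn_integral_eq_integral Bochner_Integration.integral_nonneg simp: power_divide power_mult[symmetric])
  obtain C where C: "C > 0" "\<And>x y. (1 + norm x) ^ N * (1 + norm y) ^ (M + 2 * CARD('d)) * norm (b (x, y)) \<le> C"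
    using schwartz_prod_bound[OF b] by metis
  have "(1 + norm x) ^ N * norm (param_integral (\<lambda>y. cnj (F y * trig_poly A e y)) b x)
    \<le> C * sqrt (B * \<kappa>) * sqrt (\<Sum>n\<in>A. (norm (e n))\<^sup>2)" if A: "finite A" for A e x
  proof -
    let ?S = "\<Sum>n\<in>A. (norm (e n))\<^sup>2"
    let ?f = "\<lambda>y. norm (trig_poly A e y) * (norm (F y) / (1 + norm y) ^ M)"
    have S: "0 \<le> ?S" by (intro sum_nonneg) auto
    \<comment> \<open>Cauchy-Schwarz is applied to the nonnegative integral first, because
      integrability of the product is one of its consequences; only then is \<open>J\<close>
      identified with that integral.\<close>
    define J where "J = (LBINT y. ?f y * ?g y)"
    have "(\<integral>\<^sup>+y. ennreal (?f y * ?g y) \<partial>lborel)\<^sup>2 = (\<integral>\<^sup>+y. ennreal (?f y) * ennreal (?g y) \<partial>lborel)\<^sup>2"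
      by (simp add: ennreal_mult[symmetric])
    also have "\<dots> \<le> (\<integral>\<^sup>+y. (ennreal (?f y))\<^sup>2 \<partial>lborel) * (\<integral>\<^sup>+y. (ennreal (?g y))\<^sup>2 \<partial>lborel)"
      by (rule Cauchy_Schwarz_nn_integral) measurable
    also have "\<dots> = (\<integral>\<^sup>+y. ennreal ((?f y)\<^sup>2) \<partial>lborel) * (\<integral>\<^sup>+y. ennreal ((?g y)\<^sup>2) \<partial>lborel)"
      by (simp add: ennreal_power)
    also have "\<dots> \<le> ennreal (B * ?S) * ennreal \<kappa>"
      unfolding \<kappa>(1) using F A by (intro mult_right_mono) (auto simp: trig_bounded_def)
    also have "\<dots> = ennreal (B * ?S * \<kappa>)" using B S \<kappa>(2) by (simp add: ennreal_mult)
    finally have CS: "(\<integral>\<^sup>+y. ennreal (?f y * ?g y) \<partial>lborel)\<^sup>2 \<le> ennreal (B * ?S * \<kappa>)" .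
    then have "(\<integral>\<^sup>+y. ennreal (?f y * ?g y) \<partial>lborel)\<^sup>2 < \<infinity>" by (rule le_less_trans) simp
    then have "(\<integral>\<^sup>+y. ennreal (?f y * ?g y) \<partial>lborel) < \<infinity>" by (simp add: power_less_top_ennreal)
    then have int: "integrable lborel (\<lambda>y. ?f y * ?g y)" by (intro integrableI_nonneg) auto
    have J: "(\<integral>\<^sup>+y. ennreal (?f y * ?g y) \<partial>lborel) = ennreal J" "0 \<le> J"
      unfolding J_def using int by (auto intro!: nn_integral_eq_integral Bochner_Integration.integral_nonneg)
    have "J\<^sup>2 \<le> B * ?S * \<kappa>"
      using CS B S \<kappa>(2) J(2) unfolding J(1) by (simp add: ennreal_power)
    then have "J \<le> sqrt (B * ?S * \<kappa>)" by (rule real_le_rsqrt)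
    also have "\<dots> = sqrt (B * \<kappa>) * sqrt ?S" by (simp add: real_sqrt_mult[symmetric] mult_ac)
    finally have J_le: "J \<le> sqrt (B * \<kappa>) * sqrt ?S" .
    have pointwise: "norm (cnj (F y * trig_poly A e y) * b (x, y)) \<le> C / (1 + norm x) ^ N * (?f y * ?g y)" for y
    proof -
      have pos: "0 < (1 + norm x) ^ N * (1 + norm y) ^ (M + 2 * CARD('d))"
        by (intro mult_pos_pos zero_less_power add_pos_nonneg) auto
      have "norm (b (x, y)) \<le> C / ((1 + norm x) ^ N * (1 + norm y) ^ (M + 2 * CARD('d)))"
        using C(2)[of x y] by (subst pos_le_divide_eq[OF pos]) (simp add: mult.commute)
      from mult_left_mono[OF this, of "norm (F y * trig_poly A e y)"] show ?thesis
        by (simp add: norm_mult power_add mult_ac)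
    qed
    have "norm (param_integral (\<lambda>y. cnj (F y * trig_poly A e y)) b x) \<le> (LBINT y. C / (1 + norm x) ^ N * (?f y * ?g y))"
      unfolding param_integral_def
    proof (rule order_trans[OF integral_norm_bound integral_mono])
      show "integrable lborel (\<lambda>y. C / (1 + norm x) ^ N * (?f y * ?g y))" by (rule integrable_mult_right[OF int])
      then show "integrable lborel (\<lambda>y. norm (cnj (F y * trig_poly A e y) * b (x, y)))"
      proof (rule Bochner_Integration.integrable_bound)
        show "AE y in lborel. norm (norm (cnj (F y * trig_poly A e y) * b (x, y))) \<le> norm (C / (1 + norm x) ^ N * (?f y * ?g y))"
          unfolding real_norm_def abs_norm_cancel
          by (intro always_eventually allI order_trans[OF pointwise abs_ge_self])
      qed measurable
    qed (rule pointwise)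
    also have "\<dots> = C * J / (1 + norm x) ^ N" unfolding integral_mult_right_zero J_def[symmetric] by simp
    finally have "(1 + norm x) ^ N * norm (param_integral (\<lambda>y. cnj (F y * trig_poly A e y)) b x) \<le> C * J"
      by (simp add: pos_le_divide_eq add_pos_nonneg mult.commute)
    also have "\<dots> \<le> C * (sqrt (B * \<kappa>) * sqrt ?S)" using C(1) J_le by (intro mult_left_mono) auto
    finally show ?thesis by (simp add: mult.assoc)
  qed
  moreover have "0 \<le> C * sqrt (B * \<kappa>)" using C(1) B \<kappa>(2) by simp
  ultimately show ?thesis by blast
qed

lemma tempered_distribution_sum:
  assumes u: "tempered_distribution u" and f: "\<And>n. n \<in> A \<Longrightarrow> f n \<in> schwartz"
  shows "u (\<lambda>x. \<Sum>n\<in>A. c n * f n x) = (\<Sum>n\<in>A. c n * u (f n))"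
proof -
  have add: "\<forall>f\<in>schwartz. \<forall>g\<in>schwartz. u (\<lambda>x. f x + g x) = u f + u g"
    and mult: "\<And>c. \<forall>f\<in>schwartz. u (\<lambda>x. c * f x) = c * u f"
    using u by (auto simp: tempered_distribution_def)
  have zero: "u (\<lambda>_. 0) = 0" using bspec[OF mult[of 0] schwartz_zero] by simp
  show ?thesis using f
  proof (induction A rule: infinite_finite_induct)
    case (insert n A)
    have 1: "(\<lambda>x. c n * f n x) \<in> schwartz" by (intro schwartz_cmult insert.prems) auto
    have 2: "(\<lambda>x. \<Sum>n\<in>A. c n * f n x) \<in> schwartz" by (intro schwartz_sum schwartz_cmult insert.prems) auto
    have 3: "f n \<in> schwartz" by (intro insert.prems) auto
    have "u (\<lambda>x. c n * f n x + (\<Sum>n\<in>A. c n * f n x)) = u (\<lambda>x. c n * f n x) + u (\<lambda>x. \<Sum>n\<in>A. c n * f n x)"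
      by (rule bspec[OF bspec[OF add 1] 2])
    then show ?case using insert bspec[OF mult 3] by simp
  qed (auto simp: zero)
qed

text \<open>An increasing exhaustion by finite sets: it turns an unordered sum into the limit of a
  sequence, the form in which completeness and continuity were proved.\<close>

definition nat_box :: "nat \<Rightarrow> 'i::countable set" where
  "nat_box j = {n. to_nat n < j}"

lemma finite_nat_box: "finite (nat_box j)"
  unfolding nat_box_def by (rule finite_imageD[of to_nat]) (auto intro: finite_subset[of _ "{..<j}"] inj_onI)

lemma nat_box_mono: "i \<le> j \<Longrightarrow> nat_box i \<subseteq> nat_box j"
  by (auto simp: nat_box_def)

lemma filterlim_nat_box: "filterlim nat_box (finite_subsets_at_top UNIV) sequentially"
proof (rule filterlim_finite_subsets_at_top[THEN iffD2], intro allI impI)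
  fix X :: "'a set" assume X: "finite X \<and> X \<subseteq> UNIV"
  then obtain j where j: "\<And>n. n \<in> X \<Longrightarrow> to_nat n < j"
    using finite_nat_set_iff_bounded[of "to_nat ` X"] by auto
  show "\<forall>\<^sub>F y in sequentially. finite (nat_box y :: 'a set) \<and> X \<subseteq> nat_box y \<and> nat_box y \<subseteq> UNIV"
    unfolding eventually_sequentially
    by (intro exI[of _ j] allI impI conjI finite_nat_box) (auto simp: nat_box_def dest!: j)
qed

lemma has_sum_nat_box: "(f has_sum s) UNIV \<Longrightarrow> (\<lambda>j. \<Sum>n\<in>nat_box j. f n) \<longlonglongrightarrow> s"
  unfolding has_sum_def by (rule filterlim_compose[OF _ filterlim_nat_box])

lemma tempered_param_series:
  fixes F :: "real ^ 'd::finite \<Rightarrow> complex" and b :: "'a::euclidean_space \<times> (real ^ 'd) \<Rightarrow> complex"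
    and U :: "int ^ 'd \<Rightarrow> complex"
  defines "f \<equiv> \<lambda>n. param_integral (\<lambda>y. cnj (F y * cis (- (real_vec n \<bullet> y)))) b"
  assumes u: "tempered_distribution u" and Fm: "F \<in> borel_measurable borel"
    and F: "trig_bounded (\<lambda>x. norm (F x) / (1 + norm x) ^ M) B" and b: "b \<in> schwartz"
    and U: "(\<lambda>n. (norm (U n))\<^sup>2) summable_on UNIV"
    and sum: "(\<lambda>n. cnj (U n) * u (f n)) summable_on UNIV"
  shows "(\<lambda>x. \<Sum>\<^sub>\<infinity>n. cnj (U n) * f n x) \<in> schwartz"
    and "u (\<lambda>x. \<Sum>\<^sub>\<infinity>n. cnj (U n) * f n x) = (\<Sum>\<^sub>\<infinity>n. cnj (U n) * u (f n))"
proof -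
  have FT: "tempered_density F" by (rule trig_bounded_tempered[OF Fm F])
  have \<Omega>: "tempered_density (\<lambda>y. cnj (F y * trig_poly A e y))" for A e
    by (intro tempered_density_cnj tempered_density_mult[OF FT] trig_poly_measurable) (rule trig_poly_norm_le)
  have \<Omega>1: "tempered_density (\<lambda>y. cnj (F y * cis (- (real_vec n \<bullet> y))))" for n
    using \<Omega>[of "{n}" "\<lambda>_. 1"] by (simp add: trig_poly_singleton)
  have lin: "param_integral (\<lambda>y. cnj (F y * trig_poly A e y)) b' x
      = (\<Sum>n\<in>A. cnj (e n) * param_integral (\<lambda>y. cnj (F y * cis (- (real_vec n \<bullet> y)))) b' x)"
    if b': "b' \<in> schwartz" for A e x and b' :: "'a \<times> (real ^ 'd) \<Rightarrow> complex"
  proof -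
    have eq: "cnj (F y * trig_poly A e y) * b' (x, y) = (\<Sum>n\<in>A. cnj (e n) * (cnj (F y * cis (- (real_vec n \<bullet> y))) * b' (x, y)))" for y
      by (simp add: trig_poly_def sum_distrib_left sum_distrib_right mult_ac)
    show ?thesis unfolding param_integral_def eq integral_mult_right_zero[symmetric]
      by (rule Bochner_Integration.integral_sum) (intro integrable_mult_right tempered_density_integrable[OF \<Omega>1 b'])
  qed
  let ?T = "\<Sum>\<^sub>\<infinity>n. (norm (U n))\<^sup>2"
  have f_schwartz: "f n \<in> schwartz" for n unfolding f_def by (rule param_integral_schwartz[OF \<Omega>1 b])
  have pointwise: "(\<lambda>n. cnj (U n) * f n x) summable_on UNIV" for x
  proof -
    obtain C where C: "C \<ge> 0" "\<And>A e x. finite A \<Longrightarrow> (1 + norm x) ^ 0 * norm (param_integral (\<lambda>y. cnj (F y * trig_poly A e y)) b x)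
      \<le> C * sqrt (\<Sum>n\<in>A. (norm (e n))\<^sup>2)"
      using param_integral_trig_bound[OF Fm F b, of 0] by blast
    show ?thesis
    proof (rule abs_summable_onI_bound)
      fix A :: "(int ^ 'd) set" assume A: "finite A"
      obtain p where p: "\<And>i. norm (p i) \<le> 1" "(\<Sum>n\<in>A. norm (cnj (U n) * f n x)) = norm (\<Sum>n\<in>A. p n * (cnj (U n) * f n x))"
        by (rule finite_sum_phase[where f="\<lambda>n. cnj (U n) * f n x" and A=A]) (rule that, auto)
      have "(\<Sum>n\<in>A. norm (cnj (U n) * f n x)) = norm (param_integral (\<lambda>y. cnj (F y * trig_poly A (\<lambda>n. cnj (p n) * U n) y)) b x)"
        unfolding p(2) unfolding lin[OF b] f_def by (simp add: mult.assoc)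
      also have "\<dots> \<le> C * sqrt (\<Sum>n\<in>A. (norm (cnj (p n) * U n))\<^sup>2)" using C(2)[OF A] by simp
      also have "\<dots> \<le> C * sqrt ?T"
      proof (intro mult_left_mono C real_sqrt_le_mono)
        have "(\<Sum>n\<in>A. (norm (cnj (p n) * U n))\<^sup>2) \<le> (\<Sum>n\<in>A. (norm (U n))\<^sup>2)"
          using p(1) by (intro sum_mono power_mono) (auto simp: norm_mult mult_left_le_one_le)
        also have "\<dots> \<le> ?T" using U A by (intro finite_sum_le_infsum) auto
        finally show "(\<Sum>n\<in>A. (norm (cnj (p n) * U n))\<^sup>2) \<le> ?T" .
      qed
      finally show "(\<Sum>n\<in>A. norm (cnj (U n) * f n x)) \<le> C * sqrt ?T" .
    qed
  qed
  define g where "g j = param_integral (\<lambda>y. cnj (F y * trig_poly (nat_box j) U y)) b" for j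
  have g_eq: "g j = (\<lambda>x. \<Sum>n\<in>nat_box j. cnj (U n) * f n x)" for j
    unfolding g_def f_def lin[OF b, abs_def] ..
  have g: "g j \<in> schwartz" for j unfolding g_def by (rule param_integral_schwartz[OF \<Omega> b])
  have lim: "(\<lambda>j. g j x) \<longlonglongrightarrow> (\<Sum>\<^sub>\<infinity>n. cnj (U n) * f n x)" for x
    unfolding g_eq by (rule has_sum_nat_box[OF has_sum_infsum[OF pointwise]])
  have Cauchy_g: "\<exists>J. \<forall>i\<ge>J. \<forall>j\<ge>J. \<forall>x. (1 + norm x) ^ N * norm (partials bs (g i) x - partials bs (g j) x) \<le> r"
    if bs: "set bs \<subseteq> Basis" and r: "r > 0" for bs N r
  proof -
    let ?b = "partials (map (\<lambda>b. (b, 0)) bs) b"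
    have b': "?b \<in> schwartz" using bs by (intro schwartz_partials b) (auto intro: Pair_0_Basis)
    obtain C where C: "C \<ge> 0" "\<And>A e x. finite A \<Longrightarrow> (1 + norm x) ^ N * norm (param_integral (\<lambda>y. cnj (F y * trig_poly A e y)) ?b x)
      \<le> C * sqrt (\<Sum>n\<in>A. (norm (e n))\<^sup>2)"
      using param_integral_trig_bound[OF Fm F b', of N] by blast
    let ?t = "\<lambda>j. \<Sum>n\<in>nat_box j. (norm (U n))\<^sup>2"
    have "Cauchy ?t" by (rule LIMSEQ_imp_Cauchy[OF has_sum_nat_box[OF has_sum_infsum[OF U]]])
    \<comment> \<open>The square anticipates the square root in the bound, and \<open>C + 1\<close>
      replaces \<open>C\<close> because \<open>C\<close> may be 0.\<close>
    moreover have "0 < (r / (C + 1))\<^sup>2" using r C(1) by simp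
    ultimately obtain J where J: "\<And>i j. i \<ge> J \<Longrightarrow> j \<ge> J \<Longrightarrow> norm (?t i - ?t j) < (r / (C + 1))\<^sup>2"
      by (meson CauchyD)
    have le: "(1 + norm x) ^ N * norm (partials bs (g i) x - partials bs (g j) x) \<le> r" if ij: "J \<le> j" "j \<le> i" for i j x
    proof -
      have sub: "nat_box j \<subseteq> (nat_box i :: (int ^ 'd) set)" by (rule nat_box_mono[OF ij(2)])
      \<comment> \<open>By linearity the difference belongs to the polynomial supported on the new
        indices, and the derivatives act on \<open>b\<close> only.\<close>
      have "partials bs (g i) x - partials bs (g j) x = param_integral (\<lambda>y. cnj (F y * trig_poly (nat_box i - nat_box j) U y)) ?b x"
        unfolding g_def partials_param_integral[OF \<Omega> b bs] lin[OF b'] by (rule sum_diff[OF finite_nat_box sub, symmetric])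
      then have "(1 + norm x) ^ N * norm (partials bs (g i) x - partials bs (g j) x)
        \<le> C * sqrt (\<Sum>n\<in>nat_box i - nat_box j. (norm (U n))\<^sup>2)"
        using C(2)[of "nat_box i - nat_box j"] by (simp add: finite_nat_box)
      also have "(\<Sum>n\<in>nat_box i - nat_box j. (norm (U n))\<^sup>2) = ?t i - ?t j" by (rule sum_diff[OF finite_nat_box sub])
      also have "C * sqrt (?t i - ?t j) \<le> (C + 1) * (r / (C + 1))"
      proof (rule mult_mono)
        have "?t i - ?t j \<le> (r / (C + 1))\<^sup>2" using J[of i j] ij by simp
        then have "sqrt (?t i - ?t j) \<le> sqrt ((r / (C + 1))\<^sup>2)" by (rule real_sqrt_le_mono)
        then show "sqrt (?t i - ?t j) \<le> r / (C + 1)" using r C(1) by simp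
        show "0 \<le> sqrt (?t i - ?t j)" using sub by (auto intro!: sum_mono2 finite_nat_box)
      qed (use C(1) in auto)
      also have "\<dots> = r" using C(1) by simp
      finally show ?thesis .
    qed
    have "(1 + norm x) ^ N * norm (partials bs (g i) x - partials bs (g j) x) \<le> r" if "J \<le> i" "J \<le> j" for i j x
      using le[of j i x] le[of i j x] that by (cases "j \<le> i") (auto simp: norm_minus_commute)
    then show ?thesis by blast
  qed
  show S: "(\<lambda>x. \<Sum>\<^sub>\<infinity>n. cnj (U n) * f n x) \<in> schwartz"
    by (rule schwartz_limit[OF g lim Cauchy_g])
  have "(\<lambda>j. u (g j)) \<longlonglongrightarrow> u (\<lambda>x. \<Sum>\<^sub>\<infinity>n. cnj (U n) * f n x)"
    by (rule tempered_distribution_limit[OF u g S schwartz_limit_partials[OF g lim Cauchy_g]])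
  moreover have "u (g j) = (\<Sum>n\<in>nat_box j. cnj (U n) * u (f n))" for j
    unfolding g_eq by (rule tempered_distribution_sum[OF u f_schwartz])
  moreover have "(\<lambda>j. \<Sum>n\<in>nat_box j. cnj (U n) * u (f n)) \<longlonglongrightarrow> (\<Sum>\<^sub>\<infinity>n. cnj (U n) * u (f n))"
    by (rule has_sum_nat_box[OF has_sum_infsum[OF sum]])
  ultimately show "u (\<lambda>x. \<Sum>\<^sub>\<infinity>n. cnj (U n) * f n x) = (\<Sum>\<^sub>\<infinity>n. cnj (U n) * u (f n))"
    by (simp add: LIMSEQ_unique)
qed


section \<open>The Wigner transform of a reconstruction as a form\<close>

text \<open>On the Fourier side the dilation rescales and the translation becomes a character.
  \<open>reconstruction\<close> is defined weakly, so the sum over \<open>n\<close> comes straight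
  from its definition and nothing has to be exchanged.\<close>

lemma td_fourier_reconstruction:
  fixes \<phi> :: "(real ^ 'd::finite) functional"
  assumes F: "has_fourier_function \<phi> F" and h: "h > 0" and g: "g \<in> schwartz"
  shows "td_fourier (reconstruction \<phi> h U) g =
    (\<Sum>\<^sub>\<infinity>n. U n * (LBINT y. F y * cis (- (real_vec n \<bullet> y)) * g ((1 / h) *\<^sub>R y)))"
proof -
  have "td_dilate h (td_translate (real_vec n) \<phi>) (fourier g)
      = (LBINT y. F y * cis (- (real_vec n \<bullet> y)) * g ((1 / h) *\<^sub>R y))" for n
  proof -
    let ?v = "real_vec n" and ?c = "complex_of_real (1 / h ^ CARD('d))"
    \<comment> \<open>Chosen so that its Fourier transform is the dilated and translated
      \<open>fourier g\<close>; this makes the value of \<open>\<phi>\<close> accessible through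
      \<open>F\<close>.\<close>
    define g1 where "g1 y = ?c * (cis (y \<bullet> - ?v) * g ((1 / h) *\<^sub>R y + 0))" for y
    have g1: "g1 \<in> schwartz"
      unfolding g1_def[abs_def] using h by (intro schwartz_cmult schwartz_cis_mult schwartz_dilate g) auto
    have [measurable]: "g \<in> borel_measurable borel" by (rule schwartz_measurable[OF g])
    have eq: "fourier g (h *\<^sub>R (x + ?v)) = fourier g1 x" for x
    proof -
      have "fourier g (h *\<^sub>R (x + ?v)) = (1 / h) ^ DIM(real^'d) *\<^sub>R
          (LBINT y. g (0 + (1 / h) *\<^sub>R y) * cis (- ((0 + (1 / h) *\<^sub>R y) \<bullet> (h *\<^sub>R (x + ?v)))))"
        unfolding fourier_def using h by (intro integral_lborel_affine) auto
      also have "\<dots> = ?c * (LBINT y. g (0 + (1 / h) *\<^sub>R y) * cis (- ((0 + (1 / h) *\<^sub>R y) \<bullet> (h *\<^sub>R (x + ?v)))))"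
        by (simp add: scaleR_conv_of_real power_divide)
      also have "\<dots> = fourier g1 x"
      proof -
        have "- ((0 + (1 / h) *\<^sub>R y) \<bullet> (h *\<^sub>R (x + ?v))) = y \<bullet> - ?v + - (y \<bullet> x)" for y
          using h by (simp add: inner_add_right distrib_left)
        then show ?thesis
          unfolding fourier_def integral_mult_right_zero[symmetric]
          by (intro Bochner_Integration.integral_cong refl) (simp only: g1_def cis_mult[symmetric] mult_ac add_0 add_0_right)
      qed
      finally show ?thesis .
    qed
    have "td_dilate h (td_translate (real_vec n) \<phi>) (fourier g) = of_real (h ^ CARD('d)) * \<phi> (fourier g1)"
      by (simp add: td_dilate_def td_translate_def eq)
    also have "\<phi> (fourier g1) = (LBINT y. F y * g1 y)"
      using F g1 by (simp add: has_fourier_function_def td_fourier_def)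
    also have "of_real (h ^ CARD('d)) * \<dots> = (LBINT y. F y * cis (- (real_vec n \<bullet> y)) * g ((1 / h) *\<^sub>R y))"
      unfolding integral_mult_right_zero[symmetric] using h
      by (intro Bochner_Integration.integral_cong) (simp_all add: g1_def inner_commute)
    finally show ?thesis .
  qed
  then show ?thesis by (simp add: td_fourier_def reconstruction_def)
qed

text \<open>The test function together with the exponential of \<open>wigner\<close>; the second
  variable is rescaled by \<open>\<epsilon> / h\<close> so as to become the frequency variable of
  \<open>F\<close>.\<close>

definition wigner_chirp ::
  "real \<Rightarrow> real \<Rightarrow> ((real ^ 'd) \<times> (real ^ 'd) \<Rightarrow> complex) \<Rightarrow> (real ^ 'd) \<times> (real ^ 'd::finite) \<Rightarrow> complex" where
  "wigner_chirp h \<epsilon> a z = cis (1 / h * (fst z \<bullet> snd z)) * a (fst z, (\<epsilon> / h) *\<^sub>R snd z)"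

lemma wigner_chirp_schwartz:
  fixes a :: "(real ^ 'd::finite) \<times> (real ^ 'd) \<Rightarrow> complex"
  assumes "a \<in> schwartz" "h > 0" "\<epsilon> > 0"
  shows "wigner_chirp h \<epsilon> a \<in> schwartz"
  unfolding wigner_chirp_def[abs_def]
  using schwartz_chirp_mult[OF schwartz_dilate_prod[OF assms(1), of 1 "\<epsilon> / h" 0], of "1 / h"] assms by simp

text \<open>Makes the dependence of the inner factor of \<open>wigner\<close> on \<open>x\<close>
  explicit: each term is a \<open>param_integral\<close> of the same test function, from which
  regularity in \<open>x\<close> can be read off.\<close>

lemma reconstruction_profile:
  fixes \<phi> :: "(real ^ 'd::finite) functional"
  assumes F: "has_fourier_function \<phi> F" and h: "h > 0" and \<epsilon>: "\<epsilon> > 0" and a: "a \<in> schwartz"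
  shows "td_dilate \<epsilon> (td_fourier (reconstruction \<phi> h U)) (\<lambda>\<xi>. cis ((x \<bullet> \<xi>) / \<epsilon>) * a (x, \<xi>))
    = of_real (\<epsilon> ^ CARD('d)) * (\<Sum>\<^sub>\<infinity>n. U n * param_integral (\<lambda>y. F y * cis (- (real_vec n \<bullet> y))) (wigner_chirp h \<epsilon> a) x)"
proof -
  define g where "g \<xi> = cis (\<xi> \<bullet> x) * a (x, \<epsilon> *\<^sub>R \<xi> + 0)" for \<xi>
  have g: "g \<in> schwartz"
    unfolding g_def[abs_def] by (intro schwartz_cis_mult schwartz_dilate[OF schwartz_slice_snd[OF a] \<epsilon>])
  have 1: "(\<lambda>\<xi>. cis ((x \<bullet> (\<epsilon> *\<^sub>R \<xi>)) / \<epsilon>) * a (x, \<epsilon> *\<^sub>R \<xi>)) = g"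
    using \<epsilon> by (auto simp: g_def inner_commute)
  have 2: "g ((1 / h) *\<^sub>R y) = wigner_chirp h \<epsilon> a (x, y)" for y
    by (simp add: g_def wigner_chirp_def inner_commute)
  show ?thesis
    unfolding td_dilate_def param_integral_def 1 td_fourier_reconstruction[OF F h g] 2 by simp
qed

text \<open>The conjugate comes from \<open>td_cnj\<close>, the argument from the dilation and
  translation in the term with index \<open>m\<close> of the outer reconstruction.\<close>

definition shifted_chirp ::
  "real \<Rightarrow> real \<Rightarrow> ((real ^ 'd) \<times> (real ^ 'd) \<Rightarrow> complex) \<Rightarrow> int ^ 'd \<Rightarrow> (real ^ 'd) \<times> (real ^ 'd::finite) \<Rightarrow> complex" where
  "shifted_chirp h \<epsilon> a m z = cnj (wigner_chirp h \<epsilon> a (h *\<^sub>R (fst z + real_vec m), snd z))"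

lemma shifted_chirp_schwartz:
  fixes a :: "(real ^ 'd::finite) \<times> (real ^ 'd) \<Rightarrow> complex"
  assumes "a \<in> schwartz" "h > 0" "\<epsilon> > 0"
  shows "shifted_chirp h \<epsilon> a m \<in> schwartz"
  unfolding shifted_chirp_def[abs_def]
  using schwartz_cnj[OF schwartz_dilate_prod[OF wigner_chirp_schwartz[OF assms] assms(2) zero_less_one, of "h *\<^sub>R real_vec m"]]
  by (simp add: scaleR_add_right)

lemma cnj_param_integral_chirp:
  "cnj (param_integral \<Omega> (wigner_chirp h \<epsilon> a) (h *\<^sub>R (x + real_vec m)))
    = param_integral (\<lambda>y. cnj (\<Omega> y)) (shifted_chirp h \<epsilon> a m) x"
  unfolding param_integral_def Bochner_Integration.integral_cnj[symmetric] by (simp add: shifted_chirp_def)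

text \<open>With \<open>z = h (x + m)\<close>, the chirp phase and the character combine to the
  frequency \<open>(\<eta> - y) / h\<close>, at which the partial Fourier transform of
  \<open>a\<close> is taken. The shift by \<open>m\<close> leaves a character in
  \<open>\<eta>\<close>, the substitution the power of \<open>h\<close>.\<close>

lemma integral_shifted_chirp:
  fixes a :: "(real ^ 'd::finite) \<times> (real ^ 'd) \<Rightarrow> complex"
  assumes a: "a \<in> schwartz" and h: "h > 0" and \<epsilon>: "\<epsilon> > 0"
  shows "(LBINT x. shifted_chirp h \<epsilon> a m (x, y) * cis (x \<bullet> \<eta>))
    = of_real (1 / h ^ CARD('d)) * cnj (cis (real_vec m \<bullet> \<eta>) * wigner_kernel h \<epsilon> a \<eta> y)"
proof -
  let ?\<zeta> = "(\<epsilon> / h) *\<^sub>R y"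
  let ?f = "\<lambda>z. wigner_chirp h \<epsilon> a (z, y) * cis (- (((1 / h) *\<^sub>R z - real_vec m) \<bullet> \<eta>))"
  have [measurable]: "(\<lambda>z. wigner_chirp h \<epsilon> a (z, y)) \<in> borel_measurable borel"
    by (intro schwartz_measurable schwartz_slice_fst wigner_chirp_schwartz a h \<epsilon>)
  have "(LBINT x. shifted_chirp h \<epsilon> a m (x, y) * cis (x \<bullet> \<eta>))
      = cnj (LBINT x. ?f (h *\<^sub>R real_vec m + h *\<^sub>R x))"
    unfolding Bochner_Integration.integral_cnj[symmetric] using h
    by (intro Bochner_Integration.integral_cong refl)
      (simp add: shifted_chirp_def scaleR_add_right cis_cnj add.commute)
  also have "(LBINT x. ?f (h *\<^sub>R real_vec m + h *\<^sub>R x)) = of_real (1 / h ^ CARD('d)) * (LBINT z. ?f z)"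
  proof -
    have "(LBINT z. ?f z) = h ^ DIM(real^'d) *\<^sub>R (LBINT x. ?f (h *\<^sub>R real_vec m + h *\<^sub>R x))"
      by (rule integral_lborel_affine[OF h]) measurable
    then show ?thesis using h by (simp add: scaleR_conv_of_real)
  qed
  also have "(LBINT z. ?f z) = (LBINT z. cis (real_vec m \<bullet> \<eta>) * (a (z, ?\<zeta>) * cis (- (z \<bullet> ((1 / h) *\<^sub>R (\<eta> - y))))))"
  proof (intro Bochner_Integration.integral_cong refl)
    fix z
    have "cis (1 / h * (z \<bullet> y)) * cis (- (((1 / h) *\<^sub>R z - real_vec m) \<bullet> \<eta>)) = cis (real_vec m \<bullet> \<eta>) * cis (- (z \<bullet> ((1 / h) *\<^sub>R (\<eta> - y))))"
      unfolding cis_mult by (intro arg_cong[where f=cis]) (simp add: inner_diff_left inner_diff_right diff_divide_distrib)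
    then show "?f z = cis (real_vec m \<bullet> \<eta>) * (a (z, ?\<zeta>) * cis (- (z \<bullet> ((1 / h) *\<^sub>R (\<eta> - y)))))"
      by (simp add: wigner_chirp_def mult_ac)
  qed
  also have "\<dots> = cis (real_vec m \<bullet> \<eta>) * wigner_kernel h \<epsilon> a \<eta> y"
    unfolding wigner_kernel_def partial_fourier_def fourier_def integral_mult_right_zero ..
  finally show ?thesis by simp
qed

text \<open>\<open>\<phi>\<close> acts through \<open>F\<close> and the inverse Fourier transform.
  Fubini in \<open>x\<close> and \<open>y\<close> lets that transform act on the chirp alone;
  \<open>int\<close> then identifies the remaining iterated integral with the one over the product
  space.\<close>

lemma tempered_shifted_chirp:
  fixes a :: "(real ^ 'd::finite) \<times> (real ^ 'd) \<Rightarrow> complex"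
  assumes F: "has_fourier_function \<phi> F" and FT: "tempered_density F"
    and a: "a \<in> schwartz" and h: "h > 0" and \<epsilon>: "\<epsilon> > 0"
    and int: "integrable (lborel \<Otimes>\<^sub>M lborel) (\<lambda>z. cnj (F (fst z)) * F (snd z) * wigner_kernel h \<epsilon> a (fst z) (snd z)
      * cis (real_vec m \<bullet> fst z) * cis (- (real_vec n \<bullet> snd z)))"
  shows "\<phi> (param_integral (\<lambda>y. cnj (F y * cis (- (real_vec n \<bullet> y)))) (shifted_chirp h \<epsilon> a m))
    = of_real (1 / ((2 * pi) ^ CARD('d) * h ^ CARD('d)))
      * cnj (grid_form (\<lambda>\<eta> \<xi>. cnj (F \<eta>) * F \<xi> * wigner_kernel h \<epsilon> a \<eta> \<xi>) m n)"
proof -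
  let ?\<Omega> = "\<lambda>y. cnj (F y * cis (- (real_vec n \<bullet> y)))" and ?b = "shifted_chirp h \<epsilon> a m"
  have b: "?b \<in> schwartz" by (rule shifted_chirp_schwartz[OF a h \<epsilon>])
  have \<Omega>: "tempered_density ?\<Omega>"
    by (intro tempered_density_cnj tempered_density_mult[OF FT, where K=1]) auto
  have inv: "inv_fourier (param_integral ?\<Omega> ?b) \<eta>
    = of_real (1 / ((2 * pi) ^ CARD('d) * h ^ CARD('d))) * (LBINT y. ?\<Omega> y * cnj (cis (real_vec m \<bullet> \<eta>) * wigner_kernel h \<epsilon> a \<eta> y))" for \<eta>
  proof -
    have int': "integrable (lborel \<Otimes>\<^sub>M lborel) (\<lambda>(x, y). ?\<Omega> y * ?b (x, y) * cis (x \<bullet> \<eta>))"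
    proof (rule Bochner_Integration.integrable_bound[OF tempered_density_integrable_pair[OF \<Omega> b]])
      have [measurable]: "?b \<in> borel_measurable (borel \<Otimes>\<^sub>M borel)" using schwartz_measurable[OF b] by (simp add: borel_prod)
      have [measurable]: "F \<in> borel_measurable borel" using FT by (simp add: tempered_density_def)
      show "(\<lambda>(x, y). ?\<Omega> y * ?b (x, y) * cis (x \<bullet> \<eta>)) \<in> borel_measurable (lborel \<Otimes>\<^sub>M lborel)" by measurable
    qed (auto simp: norm_mult)
    have "inv_fourier (param_integral ?\<Omega> ?b) \<eta>
      = of_real (1 / (2 * pi) ^ CARD('d)) * (LBINT x. LBINT y. ?\<Omega> y * ?b (x, y) * cis (x \<bullet> \<eta>))"
      unfolding inv_fourier_def param_integral_def integral_mult_left_zero by simp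
    also have "(LBINT x. LBINT y. ?\<Omega> y * ?b (x, y) * cis (x \<bullet> \<eta>)) = (LBINT y. LBINT x. ?\<Omega> y * (?b (x, y) * cis (x \<bullet> \<eta>)))"
      using lborel_pair.Fubini_integral[OF int'] by (simp add: mult.assoc)
    also have "\<dots> = (LBINT y. of_real (1 / h ^ CARD('d)) * (?\<Omega> y * cnj (cis (real_vec m \<bullet> \<eta>) * wigner_kernel h \<epsilon> a \<eta> y)))"
    proof -
      have "(LBINT x. ?\<Omega> y * (?b (x, y) * cis (x \<bullet> \<eta>))) = of_real (1 / h ^ CARD('d)) * (?\<Omega> y * cnj (cis (real_vec m \<bullet> \<eta>) * wigner_kernel h \<epsilon> a \<eta> y))" for y
        unfolding integral_mult_right_zero integral_shifted_chirp[OF a h \<epsilon>] by (rule mult.left_commute)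
      then show ?thesis by presburger
    qed
    also have "\<dots> = of_real (1 / h ^ CARD('d)) * (LBINT y. ?\<Omega> y * cnj (cis (real_vec m \<bullet> \<eta>) * wigner_kernel h \<epsilon> a \<eta> y))"
      by (rule integral_mult_right_zero)
    finally show ?thesis by simp
  qed
  have "\<phi> (param_integral ?\<Omega> ?b) = (LBINT \<eta>. F \<eta> * inv_fourier (param_integral ?\<Omega> ?b) \<eta>)"
    by (rule has_fourier_function_apply[OF F param_integral_schwartz[OF \<Omega> b]])
  also have "\<dots> = of_real (1 / ((2 * pi) ^ CARD('d) * h ^ CARD('d))) * (LBINT \<eta>. LBINT y. F \<eta> * (?\<Omega> y * cnj (cis (real_vec m \<bullet> \<eta>) * wigner_kernel h \<epsilon> a \<eta> y)))"
  proof -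
    let ?J = "\<lambda>\<eta>. LBINT y. ?\<Omega> y * cnj (cis (real_vec m \<bullet> \<eta>) * wigner_kernel h \<epsilon> a \<eta> y)"
    have "(LBINT \<eta>. F \<eta> * inv_fourier (param_integral ?\<Omega> ?b) \<eta>) = (LBINT \<eta>. of_real (1 / ((2 * pi) ^ CARD('d) * h ^ CARD('d))) * (F \<eta> * ?J \<eta>))"
      unfolding inv by (intro Bochner_Integration.integral_cong refl mult.left_commute)
    also have "\<dots> = of_real (1 / ((2 * pi) ^ CARD('d) * h ^ CARD('d))) * (LBINT \<eta>. F \<eta> * ?J \<eta>)"
      by (rule integral_mult_right_zero)
    finally show ?thesis unfolding integral_mult_right_zero[of lborel "F _"] .
  qed
  also have "(LBINT \<eta>. LBINT y. F \<eta> * (?\<Omega> y * cnj (cis (real_vec m \<bullet> \<eta>) * wigner_kernel h \<epsilon> a \<eta> y)))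
    = cnj (LBINT \<eta>. LBINT y. cnj (F \<eta>) * F y * wigner_kernel h \<epsilon> a \<eta> y * cis (real_vec m \<bullet> \<eta>) * cis (- (real_vec n \<bullet> y)))"
    unfolding Bochner_Integration.integral_cnj[symmetric] by (simp add: mult_ac)
  also have "(LBINT \<eta>. LBINT y. cnj (F \<eta>) * F y * wigner_kernel h \<epsilon> a \<eta> y * cis (real_vec m \<bullet> \<eta>) * cis (- (real_vec n \<bullet> y)))
    = grid_form (\<lambda>\<eta> \<xi>. cnj (F \<eta>) * F \<xi> * wigner_kernel h \<epsilon> a \<eta> \<xi>) m n"
    unfolding grid_form_def using lborel_pair.integral_fst'[OF int] by simp
  finally show ?thesis .
qed

text \<open>The outer sum evaluates \<open>\<phi>\<close> at dilated and translated copies of the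
  conjugated profile \<open>?P\<close>, itself a series in \<open>U\<close>.
  \<open>tempered_param_series\<close> carries \<open>\<phi>\<close> through the inner series, and a
  final conjugation from \<open>td_cnj\<close> restores the entries of the form.\<close>

lemma wigner_reconstruction_eq:
  fixes a :: "(real ^ 'd::finite) \<times> (real ^ 'd) \<Rightarrow> complex"
  defines "H \<equiv> \<lambda>h \<epsilon> F \<eta> \<xi>. cnj (F \<eta>) * F \<xi> * wigner_kernel h \<epsilon> a \<eta> \<xi>"
  assumes \<phi>: "tempered_distribution \<phi>" and F: "has_fourier_function \<phi> F"
    and FB: "trig_bounded (\<lambda>x. norm (F x) / (1 + norm x) ^ M) B"
    and a: "a \<in> schwartz" and h: "h > 0" and \<epsilon>: "\<epsilon> > 0"
    and U: "(\<lambda>n. (norm (U n))\<^sup>2) summable_on UNIV"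
    and int: "\<And>m n. integrable (lborel \<Otimes>\<^sub>M lborel) (\<lambda>z. H h \<epsilon> F (fst z) (snd z)
      * cis (real_vec m \<bullet> fst z) * cis (- (real_vec n \<bullet> snd z)))"
    and sum: "\<And>m. (\<lambda>n. U n * grid_form (H h \<epsilon> F) m n) summable_on UNIV"
  shows "wigner \<epsilon> (reconstruction \<phi> h U) a = of_real (1 / (2 * pi) ^ (2 * CARD('d))) *
    (\<Sum>\<^sub>\<infinity>m. cnj (U m) * (\<Sum>\<^sub>\<infinity>n. U n * grid_form (H h \<epsilon> F) m n))"
proof -
  let ?c = "(2 * pi) ^ CARD('d) * h ^ CARD('d)"
  let ?\<Omega> = "\<lambda>n y. F y * cis (- (real_vec n \<bullet> y))"
  let ?P = "\<lambda>x. td_dilate \<epsilon> (td_fourier (reconstruction \<phi> h U)) (\<lambda>\<xi>. cis ((x \<bullet> \<xi>) / \<epsilon>) * a (x, \<xi>))"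
  let ?w = "\<lambda>m. \<Sum>\<^sub>\<infinity>n. U n * grid_form (H h \<epsilon> F) m n"
  have Fm: "F \<in> borel_measurable borel" using F by (simp add: has_fourier_function_def)
  have FT: "tempered_density F" by (rule trig_bounded_tempered[OF Fm FB])
  have profile: "\<phi> (\<lambda>x. cnj (?P (h *\<^sub>R (x + real_vec m)))) = of_real (\<epsilon> ^ CARD('d) * (1 / ?c)) * cnj (?w m)" for m
  proof -
    let ?f = "\<lambda>n. param_integral (\<lambda>y. cnj (?\<Omega> n y)) (shifted_chirp h \<epsilon> a m)"
    have b: "shifted_chirp h \<epsilon> a m \<in> schwartz" by (rule shifted_chirp_schwartz[OF a h \<epsilon>])
    have \<phi>f: "\<phi> (?f n) = of_real (1 / ?c) * cnj (grid_form (H h \<epsilon> F) m n)" for n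
      using tempered_shifted_chirp[OF F FT a h \<epsilon> int[unfolded H_def]] unfolding H_def .
    have \<phi>f': "cnj (U n) * \<phi> (?f n) = of_real (1 / ?c) * cnj (U n * grid_form (H h \<epsilon> F) m n)" for n
      unfolding \<phi>f by simp
    \<comment> \<open>Up to a constant these terms are the conjugates of a row of the form, which is
      summable by \<open>sum\<close>.\<close>
    have "(\<lambda>n. cnj (U n) * \<phi> (?f n)) summable_on UNIV"
      unfolding \<phi>f' by (intro summable_on_cmult_right) (simp only: summable_on_cnj_iff sum)
    note series = tempered_param_series[OF \<phi> Fm FB b U this]
    have "(\<lambda>x. cnj (?P (h *\<^sub>R (x + real_vec m)))) = (\<lambda>x. of_real (\<epsilon> ^ CARD('d)) * (\<Sum>\<^sub>\<infinity>n. cnj (U n) * ?f n x))"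
      unfolding reconstruction_profile[OF F h \<epsilon> a] complex_cnj_mult infsum_cnj[symmetric] cnj_param_integral_chirp complex_cnj_complex_of_real ..
    moreover have "\<forall>c. \<forall>f\<in>schwartz. \<phi> (\<lambda>x. c * f x) = c * \<phi> f" using \<phi> by (simp add: tempered_distribution_def)
    ultimately have "\<phi> (\<lambda>x. cnj (?P (h *\<^sub>R (x + real_vec m)))) = of_real (\<epsilon> ^ CARD('d)) * \<phi> (\<lambda>x. \<Sum>\<^sub>\<infinity>n. cnj (U n) * ?f n x)"
      using series(1) by simp
    also have "\<phi> (\<lambda>x. \<Sum>\<^sub>\<infinity>n. cnj (U n) * ?f n x) = of_real (1 / ?c) * cnj (?w m)"
      unfolding series(2) \<phi>f' infsum_cmult_right' infsum_cnj ..
    finally show ?thesis by (simp only: of_real_mult mult.assoc)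
  qed
  have "wigner \<epsilon> (reconstruction \<phi> h U) a = of_real (1 / (2 * pi * \<epsilon>) ^ CARD('d)) * cnj (reconstruction \<phi> h U (\<lambda>x. cnj (?P x)))"
    by (simp add: wigner_def td_cnj_def)
  also have "reconstruction \<phi> h U (\<lambda>x. cnj (?P x)) = (\<Sum>\<^sub>\<infinity>m. U m * (of_real (h ^ CARD('d)) * \<phi> (\<lambda>x. cnj (?P (h *\<^sub>R (x + real_vec m))))))"
    unfolding reconstruction_def td_dilate_def[of h] td_translate_def by simp
  also have "\<dots> = (\<Sum>\<^sub>\<infinity>m. of_real (h ^ CARD('d) * (\<epsilon> ^ CARD('d) * (1 / ?c))) * cnj (cnj (U m) * ?w m))"
    unfolding profile by (intro infsum_cong) simp
  also have "of_real (1 / (2 * pi * \<epsilon>) ^ CARD('d)) * cnj \<dots>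
     = of_real (1 / (2 * pi * \<epsilon>) ^ CARD('d) * (h ^ CARD('d) * (\<epsilon> ^ CARD('d) * (1 / ?c)))) * (\<Sum>\<^sub>\<infinity>m. cnj (U m) * ?w m)"
    unfolding infsum_cmult_right' infsum_cnj unfolding complex_cnj_mult complex_cnj_cnj complex_cnj_complex_of_real of_real_mult by (simp only: mult.assoc)
  \<comment> \<open>The power of \<open>h\<close> from the dilation cancels the one from
    \<open>shifted_chirp\<close>, and the powers of \<open>\<epsilon>\<close> cancel as well. The
    constant left over is that of \<open>grid_wigner_eq\<close>, so the two forms can be subtracted
    directly.\<close>
  also have "1 / (2 * pi * \<epsilon>) ^ CARD('d) * (h ^ CARD('d) * (\<epsilon> ^ CARD('d) * (1 / ?c))) = 1 / (2 * pi) ^ (2 * CARD('d))"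
  proof -
    have "x ^ (2 * n) = x ^ n * x ^ n" for x :: real and n
      by (metis mult_2 power_add)
    then show ?thesis using h \<epsilon> by (simp add: power_mult_distrib power_divide)
  qed
  finally show ?thesis .
qed


section \<open>Comparison of the two transforms\<close>

lemma scale_measure_density:
  assumes "0 \<le> c" shows "scale_measure (ennreal c) M = density M (\<lambda>_. ennreal c)"
  by (rule measure_eqI) (auto simp: emeasure_density nn_integral_cmult_indicator)

lemma
  fixes f :: "'a \<Rightarrow> complex"
  assumes c: "0 \<le> c" and f: "integrable M f"
  shows integrable_scale_measure: "integrable (scale_measure (ennreal c) M) f"
    and integral_scale_measure: "(LINT x|scale_measure (ennreal c) M. f x) = of_real c * (LINT x|M. f x)"
proof -
  have [measurable]: "f \<in> borel_measurable M" using f by auto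
  show "integrable (scale_measure (ennreal c) M) f"
    unfolding scale_measure_density[OF c] using c f by (subst integrable_density) auto
  show "(LINT x|scale_measure (ennreal c) M. f x) = of_real c * (LINT x|M. f x)"
    unfolding scale_measure_density[OF c] using c by (subst integral_density) (auto simp: scaleR_conv_of_real)
qed

lemma infsum_diff:
  fixes f g :: "'i \<Rightarrow> complex"
  assumes "f summable_on A" "g summable_on A"
  shows "(\<Sum>\<^sub>\<infinity>x\<in>A. f x - g x) = infsum f A - infsum g A"
  using infsum_add[of f A "\<lambda>x. - g x"] assms by (simp add: infsum_uminus summable_on_uminus)

lemma radon_measure_scale: "radon_measure \<mu> \<Longrightarrow> radon_measure (scale_measure (ennreal c) \<mu>)"
  by (auto simp: radon_measure_def ennreal_mult_less_top)

text \<open>The error kernel is small for two different reasons: near the origin because \<open>F\<close> is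
  continuous at \<open>0\<close>, and elsewhere because \<^const>\<open>wigner_kernel\<close> decays on the scales \<open>h\<close> and \<open>h / \<epsilon>\<close>.\<close>

lemma error_kernel_bound:
  fixes F :: "real ^ 'd::finite \<Rightarrow> complex"
  assumes h: "0 < h" and \<epsilon>: "0 < \<epsilon>" and r: "0 < r" and \<delta>: "0 \<le> \<delta>"
    and near: "\<And>x. norm x < r \<Longrightarrow> norm (F x - F 0) \<le> \<delta>"
    and K: "(1 + norm (\<eta> - \<xi>) / h) * (1 + \<epsilon> / h * norm \<xi>) * k \<le> Z" and k: "0 \<le> k"
  shows "norm (cnj (F \<eta>) * F \<xi> - of_real ((norm (F 0))\<^sup>2)) * k
    \<le> (\<delta> + (h + h / \<epsilon>) / r) * ((norm (F \<eta>) + (norm (F 0) + 1)) * (norm (F \<xi>) + (norm (F 0) + 1)) * Z)"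
proof -
  define X where "X = (1 + norm (\<eta> - \<xi>) / h) * (1 + \<epsilon> / h * norm \<xi>)"
  define q where "q = (h + h / \<epsilon>) / r"
  let ?f = "norm (F \<eta>)" and ?g = "norm (F \<xi>)" and ?c = "norm (F 0)"
  let ?G = "norm (cnj (F \<eta>) * F \<xi> - of_real (?c\<^sup>2))"
  have q0: "0 \<le> q" using h \<epsilon> r by (simp add: q_def)
  have X_ge: "1 + norm (\<eta> - \<xi>) / h \<le> X" "1 + \<epsilon> / h * norm \<xi> \<le> X"
  proof -
    have *: "1 + u \<le> (1 + u) * (1 + v)" "1 + v \<le> (1 + u) * (1 + v)" if "0 \<le> u" "0 \<le> v" for u v :: real
      using that mult_nonneg_nonneg[OF that] unfolding ring_distribs by linarith+
    have "0 \<le> norm (\<eta> - \<xi>) / h" "0 \<le> \<epsilon> / h * norm \<xi>" using h \<epsilon> by auto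
    from *[OF this] show "1 + norm (\<eta> - \<xi>) / h \<le> X" "1 + \<epsilon> / h * norm \<xi> \<le> X"
      unfolding X_def by auto
  qed
  have X1: "1 \<le> X"
  proof -
    have "0 \<le> norm (\<eta> - \<xi>) / h" using h by simp
    with X_ge(1) show ?thesis by linarith
  qed
  have kZ: "k \<le> Z"
    using K[folded X_def] mult_right_mono[OF X1 k] by simp
  have Z0: "0 \<le> Z" using kZ k by simp
  \<comment> \<open>The added 1 makes each factor at least 1, so it may be inserted into a product
    when only the other factor is needed.\<close>
  have ff: "1 \<le> ?f + (?c + 1)" "1 \<le> ?g + (?c + 1)" by (simp_all add: add_nonneg_nonneg)
  let ?R = "(?f + (?c + 1)) * (?g + (?c + 1))"
  have R0: "0 \<le> ?R" using ff by simp
  have c2: "of_real (?c\<^sup>2) = cnj (F 0) * F 0" by (simp only: complex_norm_square mult.commute)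
  show ?thesis
  proof (cases "norm \<eta> < r \<and> norm \<xi> < r")
    case True
    have "cnj (F \<eta>) * F \<xi> - of_real (?c\<^sup>2) = cnj (F \<eta>) * (F \<xi> - F 0) + cnj (F \<eta> - F 0) * F 0"
      unfolding c2 by (simp add: algebra_simps)
    then have "?G \<le> norm (cnj (F \<eta>) * (F \<xi> - F 0)) + norm (cnj (F \<eta> - F 0) * F 0)"
      by (simp only: norm_triangle_ineq)
    also have "\<dots> = ?f * norm (F \<xi> - F 0) + norm (F \<eta> - F 0) * ?c"
      unfolding norm_mult complex_mod_cnj ..
    also have "\<dots> \<le> ?f * \<delta> + \<delta> * ?c"
      using True near by (intro add_mono mult_left_mono mult_right_mono) auto
    also have "\<dots> \<le> \<delta> * ((?f + (?c + 1)) * 1)"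
      using \<delta> by (simp add: algebra_simps)
    also have "\<dots> \<le> \<delta> * ?R"
      using \<delta> ff by (intro mult_left_mono) auto
    finally have "?G * k \<le> (\<delta> * ?R) * Z"
      using kZ k \<delta> R0 by (intro mult_mono mult_nonneg_nonneg) auto
    also have "\<dots> \<le> (\<delta> + q) * (?R * Z)"
      using q0 R0 Z0 by (simp add: algebra_simps)
    finally show ?thesis by (simp add: q_def)
  next
    case False
    have e1: "norm (\<eta> - \<xi>) \<le> h * X"
    proof -
      have "h * (norm (\<eta> - \<xi>) / h) \<le> h * X" using X_ge(1) h by (intro mult_left_mono) auto
      then show ?thesis using h by simp
    qed
    have e2: "norm \<xi> \<le> h / \<epsilon> * X"
    proof -
      have "h / \<epsilon> * (\<epsilon> / h * norm \<xi>) \<le> h / \<epsilon> * X" using X_ge(2) h \<epsilon> by (intro mult_left_mono) auto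
      then show ?thesis using h \<epsilon> by simp
    qed
    have "norm \<eta> \<le> norm (\<eta> - \<xi>) + norm \<xi>" using norm_triangle_ineq[of "\<eta> - \<xi>" \<xi>] by simp
    \<comment> \<open>If \<open>\<xi>\<close> lies outside the ball, \<open>e2\<close> alone gives
      this; if \<open>\<eta>\<close> does, the triangle inequality adds \<open>e1\<close>. So the
      reserve \<open>X\<close> is at least \<open>r / (h + h / \<epsilon>)\<close>.\<close>
    with False e1 e2 have "r \<le> h * X + h / \<epsilon> * X"
      using mult_nonneg_nonneg[of h X] h X1 by linarith
    then have qX: "1 \<le> q * X" using r by (simp add: q_def field_simps)
    have "?G \<le> norm (cnj (F \<eta>) * F \<xi>) + norm (cnj (F 0) * F 0)"
      unfolding c2 by (rule norm_triangle_ineq4)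
    also have "\<dots> = ?f * ?g + ?c * ?c" unfolding norm_mult complex_mod_cnj ..
    also have "\<dots> \<le> ?R"
      by (simp add: algebra_simps add_nonneg_nonneg)
    finally have "?G * k \<le> ?R * k" using k by (rule mult_right_mono)
    also have "\<dots> \<le> ?R * (q * X * k)" using mult_right_mono[OF qX k] R0 by (intro mult_left_mono) auto
    also have "q * X * k \<le> q * Z" using mult_left_mono[OF K[folded X_def] q0] by (simp add: mult.assoc)
    then have "?R * (q * X * k) \<le> ?R * (q * Z)" using R0 by (intro mult_left_mono) auto
    also have "\<dots> \<le> (\<delta> + q) * (?R * Z)"
      using \<delta> R0 Z0 by (simp add: algebra_simps)
    finally show ?thesis by (simp add: q_def)
  qed
qed

text \<open>Both transforms are the same constant times a grid form, so their difference is the form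
  of the difference of the kernels. \<open>Q\<close> is chosen before \<open>h\<close>,
  \<open>\<epsilon>\<close>, \<open>r\<close>, \<open>\<delta>\<close> and \<open>U\<close>, hence
  the estimate is uniform along the scales.\<close>

lemma wigner_minus_grid_wigner_bound:
  fixes \<phi> :: "(real ^ 'd::finite) functional" and a :: "(real ^ 'd) \<times> (real ^ 'd) \<Rightarrow> complex"
  assumes BP: "BP \<phi>" and F: "has_fourier_function \<phi> F" and a: "a \<in> schwartz"
  obtains Q where "Q \<ge> 0"
    "\<And>h \<epsilon> r \<delta> U. 0 < h \<Longrightarrow> h \<le> 1 \<Longrightarrow> h \<le> \<epsilon> \<Longrightarrow> 0 < r \<Longrightarrow> 0 \<le> \<delta> \<Longrightarrow>
      (\<And>x. norm x < r \<Longrightarrow> norm (F x - F 0) \<le> \<delta>) \<Longrightarrow> U \<in> grid_L2 \<Longrightarrow>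
      norm (wigner \<epsilon> (reconstruction \<phi> h U) a - of_real ((norm (F 0))\<^sup>2) * grid_wigner h \<epsilon> U a)
        \<le> Q * (\<delta> + (h + h / \<epsilon>) / r) * (grid_norm h U)\<^sup>2"
proof -
  have \<phi>: "tempered_distribution \<phi>" using BP by (auto simp: BP_def sobolev_space_def)
  have Fm [measurable]: "F \<in> borel_measurable borel" using F by (simp add: has_fourier_function_def)
  let ?c = "norm (F 0) + 1" and ?L = "1 / (2 * pi) ^ (2 * CARD('d))" and ?\<kappa> = "decay_mass TYPE(real^'d)"
  obtain M0 where "\<forall>M\<ge>M0. \<exists>B. trig_bounded (\<lambda>x. norm (F x) / (1 + norm x) ^ M) B"
    using BP_trig_bounded[OF BP F] by blast
  \<comment> \<open>Large enough for the weight with \<open>F\<close>, and at least the dimension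
    for the constant weight.\<close>
  moreover define M where "M = max M0 CARD('d)"
  then have "M0 \<le> M" by simp
  ultimately obtain B1 where B1: "trig_bounded (\<lambda>x. norm (F x) / (1 + norm x) ^ M) B1" by blast
  obtain B2 where B2: "trig_bounded (\<lambda>x::real^'d. 1 / (1 + norm x) ^ M) B2"
    using trig_bounded_power[where 'd='d and M=M] by (auto simp: M_def)
  \<comment> \<open>Up to the common power, \<open>\<rho>\<close> is
    \<open>norm (F x) + norm (F 0) + 1\<close>, the factor that occurs twice in
    \<open>error_kernel_bound\<close>.\<close>
  define \<rho> where "\<rho> x = norm (F x) / (1 + norm x) ^ M + ?c * (1 / (1 + norm x) ^ M)" for x
  define B where "B = 2 * B1 + 2 * ?c\<^sup>2 * B2"
  have \<rho>: "trig_bounded \<rho> B"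
    unfolding \<rho>_def[abs_def] B_def by (rule trig_bounded_add[OF B1 B2]) simp
  have B0: "0 \<le> B" using \<rho> by (simp add: trig_bounded_def)
  have \<rho>_eq: "\<rho> x = (norm (F x) + ?c) * (1 / (1 + norm x) ^ M)" for x
    by (simp add: \<rho>_def add_divide_distrib distrib_right)
  obtain C where C: "C > 0"
    "\<And>h \<epsilon> \<eta> \<xi>. 0 < h \<Longrightarrow> h \<le> 1 \<Longrightarrow> h \<le> \<epsilon> \<Longrightarrow>
      (1 + norm (\<eta> - \<xi>) / h) * (1 + \<epsilon> / h * norm \<xi>) * norm (wigner_kernel h \<epsilon> a \<eta> \<xi>)
      \<le> C * (1 / (1 + norm \<eta>) ^ M * (1 / (1 + norm \<xi>) ^ M) / (1 + norm (\<eta> - \<xi>) / h) ^ (2 * CARD('d)))"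
    using wigner_kernel_bound[OF a] by metis
  \<comment> \<open>The form bound contains \<open>h ^ d * ?\<kappa> * B / 2\<close> times twice the
    square sum of \<open>U\<close>; the factors 2 cancel, and \<open>h ^ d\<close> goes into
    \<open>grid_norm\<close>.\<close>
  define Q where "Q = ?L * (C * ?\<kappa> * B)"
  have Q: "Q \<ge> 0" using C(1) B0 decay_mass_nonneg[where 'a="real^'d"] by (simp add: Q_def)
  have "norm (wigner \<epsilon> (reconstruction \<phi> h U) a - of_real ((norm (F 0))\<^sup>2) * grid_wigner h \<epsilon> U a)
        \<le> Q * (\<delta> + (h + h / \<epsilon>) / r) * (grid_norm h U)\<^sup>2"
    if h: "0 < h" "h \<le> 1" "h \<le> \<epsilon>" and r: "0 < r" and \<delta>: "0 \<le> \<delta>"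
      and near: "\<And>x. norm x < r \<Longrightarrow> norm (F x - F 0) \<le> \<delta>" and U: "U \<in> grid_L2" for h \<epsilon> r \<delta> U
  proof -
    have \<epsilon>: "0 < \<epsilon>" using h by linarith
    have U2: "(\<lambda>n. (norm (U n))\<^sup>2) summable_on UNIV" using U by (simp add: grid_L2_def)
    let ?S = "\<Sum>\<^sub>\<infinity>n. (norm (U n))\<^sup>2"
    let ?K = "wigner_kernel h \<epsilon> a"
    let ?HF = "\<lambda>\<eta> \<xi>. cnj (F \<eta>) * F \<xi> * ?K \<eta> \<xi>"
    let ?HG = "\<lambda>\<eta> \<xi>. (cnj (F \<eta>) * F \<xi> - of_real ((norm (F 0))\<^sup>2)) * ?K \<eta> \<xi>"
    let ?Z = "\<lambda>\<eta> \<xi>::real^'d. 1 / (1 + norm \<eta>) ^ M * (1 / (1 + norm \<xi>) ^ M) / (1 + norm (\<eta> - \<xi>) / h) ^ (2 * CARD('d))"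
    let ?W = "\<lambda>\<eta> \<xi>. \<rho> \<eta> * \<rho> \<xi> / (1 + norm (\<eta> - \<xi>) / h) ^ (2 * CARD('d))"
    define \<theta> where "\<theta> = \<delta> + (h + h / \<epsilon>) / r"
    have \<theta>0: "0 \<le> \<theta>" using \<delta> h r \<epsilon> by (simp add: \<theta>_def)
    have W: "?W \<eta> \<xi> = (norm (F \<eta>) + ?c) * (norm (F \<xi>) + ?c) * ?Z \<eta> \<xi>" for \<eta> \<xi>
      unfolding \<rho>_eq by (simp add: mult_ac)
    have Z0: "0 \<le> ?Z \<eta> \<xi>" for \<eta> \<xi> using h by simp
    have KZ: "norm (?K \<eta> \<xi>) \<le> C * ?Z \<eta> \<xi>" for \<eta> \<xi>
    proof -
      have "1 * 1 \<le> (1 + norm (\<eta> - \<xi>) / h) * (1 + \<epsilon> / h * norm \<xi>)"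
        using h \<epsilon> by (intro mult_mono) auto
      from mult_right_mono[OF this norm_ge_zero[of "?K \<eta> \<xi>"]] show ?thesis
        using C(2)[OF h, of \<eta> \<xi>] by simp
    qed
    \<comment> \<open>This bound and \<open>boundF\<close> provide integrability and summability, so
      that the two forms may be subtracted term by term. The smallness of the difference comes from
      \<open>boundG\<close>.\<close>
    have boundK: "norm (?K \<eta> \<xi>) \<le> C * ?W \<eta> \<xi>" for \<eta> \<xi>
    proof -
      have "1 * 1 \<le> (norm (F \<eta>) + ?c) * (norm (F \<xi>) + ?c)" by (intro mult_mono) (auto simp: add_nonneg_nonneg)
      from mult_right_mono[OF this Z0[of \<eta> \<xi>]] have "?Z \<eta> \<xi> \<le> ?W \<eta> \<xi>" unfolding W by simp
      then have "C * ?Z \<eta> \<xi> \<le> C * ?W \<eta> \<xi>" using C(1) by (intro mult_left_mono) auto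
      with KZ[of \<eta> \<xi>] show ?thesis by (rule order_trans)
    qed
    have boundF: "norm (?HF \<eta> \<xi>) \<le> C * ?W \<eta> \<xi>" for \<eta> \<xi>
    proof -
      have "norm (?HF \<eta> \<xi>) = norm (F \<eta>) * norm (F \<xi>) * norm (?K \<eta> \<xi>)" by (simp add: norm_mult)
      also have "\<dots> \<le> (norm (F \<eta>) + ?c) * (norm (F \<xi>) + ?c) * (C * ?Z \<eta> \<xi>)"
        by (intro mult_mono KZ) auto
      also have "\<dots> = C * ?W \<eta> \<xi>" unfolding W by (rule mult.left_commute)
      finally show ?thesis .
    qed
    have boundG: "norm (?HG \<eta> \<xi>) \<le> (\<theta> * C) * ?W \<eta> \<xi>" for \<eta> \<xi>
    proof -
      have "norm (?HG \<eta> \<xi>) \<le> \<theta> * ((norm (F \<eta>) + ?c) * (norm (F \<xi>) + ?c) * (C * ?Z \<eta> \<xi>))"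
        unfolding norm_mult \<theta>_def
        by (rule error_kernel_bound[where F=F, OF h(1) \<epsilon> r \<delta> near C(2)[OF h, of \<eta> \<xi>] norm_ge_zero])
      also have "\<dots> = (\<theta> * C) * ?W \<eta> \<xi>" unfolding W by (simp only: mult_ac)
      finally show ?thesis .
    qed
    have Km [measurable]: "(\<lambda>z. ?K (fst z) (snd z)) \<in> borel_measurable (borel \<Otimes>\<^sub>M borel)"
      by (rule wigner_kernel_measurable[OF a])
    have HFm: "(\<lambda>z. ?HF (fst z) (snd z)) \<in> borel_measurable (borel \<Otimes>\<^sub>M borel)" by measurable
    have HGm: "(\<lambda>z. ?HG (fst z) (snd z)) \<in> borel_measurable (borel \<Otimes>\<^sub>M borel)" by measurable
    have C0: "0 \<le> C" and \<theta>C: "0 \<le> \<theta> * C" using C(1) \<theta>0 by auto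
    let ?k = "\<lambda>\<theta>. \<theta> * h ^ CARD('d) * ?\<kappa> * B / 2"
    have k0: "0 \<le> \<theta> \<Longrightarrow> 0 \<le> ?k \<theta>" for \<theta>
      using h B0 decay_mass_nonneg[where 'a="real^'d"] by simp
    note intK = grid_form_integrable[OF \<rho> h(1) C0 Km boundK]
      and intF = grid_form_integrable[OF \<rho> h(1) C0 HFm boundF]
    note formK = grid_form_bound[OF \<rho> h(1) C0 Km boundK]
      and formF = grid_form_bound[OF \<rho> h(1) C0 HFm boundF]
      and formG = grid_form_bound[OF \<rho> h(1) \<theta>C HGm boundG]
    note innerK = form_inner_summable[OF formK k0[OF C0] U2 U2]
      and innerF = form_inner_summable[OF formF k0[OF C0] U2 U2]
    note outerK = form_outer_summable[OF formK k0[OF C0] U2 U2]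
      and outerF = form_outer_summable[OF formF k0[OF C0] U2 U2]
    have G_eq: "grid_form ?HG m n = grid_form ?HF m n - of_real ((norm (F 0))\<^sup>2) * grid_form ?K m n" for m n
    proof -
      have "grid_form ?HG m n = (LINT z|(lborel \<Otimes>\<^sub>M lborel).
          ?HF (fst z) (snd z) * cis (real_vec m \<bullet> fst z) * cis (- (real_vec n \<bullet> snd z))
          - of_real ((norm (F 0))\<^sup>2) * (?K (fst z) (snd z) * cis (real_vec m \<bullet> fst z) * cis (- (real_vec n \<bullet> snd z))))"
        unfolding grid_form_def by (intro Bochner_Integration.integral_cong refl) (simp add: algebra_simps)
      also have "\<dots> = grid_form ?HF m n - of_real ((norm (F 0))\<^sup>2) * grid_form ?K m n"
        unfolding grid_form_def integral_mult_right_zero[symmetric]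
        by (intro Bochner_Integration.integral_diff intF integrable_mult_right intK)
      finally show ?thesis .
    qed
    let ?w = "\<lambda>H m. \<Sum>\<^sub>\<infinity>n. U n * grid_form H m n"
    have w_eq: "?w ?HG m = ?w ?HF m - of_real ((norm (F 0))\<^sup>2) * ?w ?K m" for m
    proof -
      have "?w ?HG m = (\<Sum>\<^sub>\<infinity>n. U n * grid_form ?HF m n - of_real ((norm (F 0))\<^sup>2) * (U n * grid_form ?K m n))"
        unfolding G_eq by (intro infsum_cong) (simp add: algebra_simps)
      also have "\<dots> = ?w ?HF m - (\<Sum>\<^sub>\<infinity>n. of_real ((norm (F 0))\<^sup>2) * (U n * grid_form ?K m n))"
        by (intro infsum_diff innerF summable_on_cmult_right innerK)
      finally show ?thesis unfolding infsum_cmult_right' .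
    qed
    have sum_eq: "(\<Sum>\<^sub>\<infinity>m. cnj (U m) * ?w ?HG m) = (\<Sum>\<^sub>\<infinity>m. cnj (U m) * ?w ?HF m) - of_real ((norm (F 0))\<^sup>2) * (\<Sum>\<^sub>\<infinity>m. cnj (U m) * ?w ?K m)"
    proof -
      have "(\<Sum>\<^sub>\<infinity>m. cnj (U m) * ?w ?HG m) = (\<Sum>\<^sub>\<infinity>m. cnj (U m) * ?w ?HF m - of_real ((norm (F 0))\<^sup>2) * (cnj (U m) * ?w ?K m))"
        unfolding w_eq by (intro infsum_cong) (simp add: algebra_simps)
      also have "\<dots> = (\<Sum>\<^sub>\<infinity>m. cnj (U m) * ?w ?HF m) - (\<Sum>\<^sub>\<infinity>m. of_real ((norm (F 0))\<^sup>2) * (cnj (U m) * ?w ?K m))"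
        by (intro infsum_diff outerF summable_on_cmult_right outerK)
      finally show ?thesis unfolding infsum_cmult_right' .
    qed
    have "wigner \<epsilon> (reconstruction \<phi> h U) a - of_real ((norm (F 0))\<^sup>2) * grid_wigner h \<epsilon> U a
        = of_real ?L * (\<Sum>\<^sub>\<infinity>m. cnj (U m) * ?w ?HG m)"
    proof -
      have "wigner \<epsilon> (reconstruction \<phi> h U) a = of_real ?L * (\<Sum>\<^sub>\<infinity>m. cnj (U m) * ?w ?HF m)"
        by (rule wigner_reconstruction_eq[OF \<phi> F B1 a h(1) \<epsilon> U2 intF innerF])
      moreover have "grid_wigner h \<epsilon> U a = of_real ?L * (\<Sum>\<^sub>\<infinity>m. cnj (U m) * ?w ?K m)"
        by (rule grid_wigner_eq[OF a h(1) \<epsilon> intK])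
      ultimately show ?thesis
        unfolding sum_eq by (simp only: right_diff_distrib mult.left_commute)
    qed
    also have "norm \<dots> = ?L * norm (\<Sum>\<^sub>\<infinity>m. cnj (U m) * ?w ?HG m)"
      unfolding norm_mult norm_of_real by simp
    also have "\<dots> \<le> ?L * (?k (\<theta> * C) * (?S + ?S))"
      using form_infsum_bound[OF formG k0[OF \<theta>C] U2 U2] by (intro mult_left_mono) auto
    also have "\<dots> = Q * \<theta> * (h ^ CARD('d) * ?S)"
      by (simp add: Q_def)
    also have "h ^ CARD('d) * ?S = (grid_norm h U)\<^sup>2"
      unfolding grid_norm_def using h by (intro real_sqrt_pow2[symmetric] mult_nonneg_nonneg infsum_nonneg) auto
    finally show ?thesis by (simp add: \<theta>_def)
  qed
  with Q show thesis by (rule that)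
qed

theorem theorem6p1:
  fixes \<phi> :: "(real ^ 'd::finite) functional"
    and \<phi>hat :: "real ^ 'd \<Rightarrow> complex"
    and h \<epsilon> :: "nat \<Rightarrow> real"
    and U :: "nat \<Rightarrow> int ^ 'd \<Rightarrow> complex"
    and \<mu> :: "((real ^ 'd) \<times> (real ^ 'd)) measure"
    and N :: "(real ^ 'd) set"
  assumes "BP \<phi>"
    and "has_fourier_function \<phi> \<phi>hat"
    and "open N" and "0 \<in> N" and "continuous_on N \<phi>hat"
    and "is_scale h" and "is_scale \<epsilon>"
    and "(\<lambda>k. h k / \<epsilon> k) \<longlonglongrightarrow> 0"
    and "h_bounded h U"
    and "converges_to_measure (\<lambda>k. grid_wigner (h k) (\<epsilon> k) (U k)) \<mu>"
  shows "converges_to_measure (\<lambda>k. wigner (\<epsilon> k) (reconstruction \<phi> (h k) (U k)))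
           (scale_measure (ennreal ((norm (\<phi>hat 0))\<^sup>2)) \<mu>)"
proof -
  let ?c = "(norm (\<phi>hat 0))\<^sup>2"
  have h: "\<And>k. 0 < h k" "h \<longlonglongrightarrow> 0" and \<epsilon>: "\<And>k. 0 < \<epsilon> k"
    using assms(6,7) by (auto simp: is_scale_def)
  have radon: "radon_measure \<mu>" and int: "\<And>a. a \<in> schwartz \<Longrightarrow> integrable \<mu> a"
    and lim: "\<And>a. a \<in> schwartz \<Longrightarrow> (\<lambda>k. grid_wigner (h k) (\<epsilon> k) (U k) a) \<longlonglongrightarrow> (LINT z|\<mu>. a z)"
    using assms(10) by (auto simp: converges_to_measure_def)
  obtain D where U: "\<And>k. U k \<in> grid_L2" and D: "\<And>k. grid_norm (h k) (U k) \<le> D"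
    using assms(9) by (auto simp: h_bounded_def)
  have cont: "isCont \<phi>hat 0" using assms(3-5) by (simp add: continuous_on_eq_continuous_at)
  have "(\<lambda>k. wigner (\<epsilon> k) (reconstruction \<phi> (h k) (U k)) a) \<longlonglongrightarrow> of_real ?c * (LINT z|\<mu>. a z)" if a: "a \<in> schwartz" for a
  proof -
    let ?E = "\<lambda>k. wigner (\<epsilon> k) (reconstruction \<phi> (h k) (U k)) a - of_real ?c * grid_wigner (h k) (\<epsilon> k) (U k) a"
    obtain Q where Q: "Q \<ge> 0"
      "\<And>h \<epsilon> r \<delta> U. 0 < h \<Longrightarrow> h \<le> 1 \<Longrightarrow> h \<le> \<epsilon> \<Longrightarrow> 0 < r \<Longrightarrow> 0 \<le> \<delta> \<Longrightarrow>
        (\<And>x. norm x < r \<Longrightarrow> norm (\<phi>hat x - \<phi>hat 0) \<le> \<delta>) \<Longrightarrow> U \<in> grid_L2 \<Longrightarrow>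
        norm (wigner \<epsilon> (reconstruction \<phi> h U) a - of_real ?c * grid_wigner h \<epsilon> U a)
          \<le> Q * (\<delta> + (h + h / \<epsilon>) / r) * (grid_norm h U)\<^sup>2"
      using wigner_minus_grid_wigner_bound[OF assms(1,2) a] by blast
    have "?E \<longlonglongrightarrow> 0"
    proof (rule LIMSEQ_I)
      fix e :: real assume e: "e > 0"
      \<comment> \<open>Both parts of the error will be at most \<open>\<delta>\<close>, so the
        total is at most \<open>2 * \<delta> * (Q * D^2)\<close>; the added 1 makes this strictly
        less than \<open>e\<close> and keeps the denominator positive.\<close>
      define \<delta> where "\<delta> = e / (2 * (Q * D\<^sup>2 + 1))"
      have QD: "0 \<le> Q * D\<^sup>2" using Q(1) by simp
      have \<delta>: "\<delta> > 0" using e QD by (simp add: \<delta>_def)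
      obtain r where r: "r > 0" "\<And>x. norm x < r \<Longrightarrow> norm (\<phi>hat x - \<phi>hat 0) \<le> \<delta>"
        using cont \<delta> unfolding continuous_at_eps_delta by (metis dist_0_norm dist_norm less_imp_le dist_commute)
      \<comment> \<open>The radius \<open>r\<close> depends on \<open>\<delta>\<close> but not on
        \<open>k\<close>, so dividing by it does not affect the limit.\<close>
      have "(\<lambda>k. (h k + h k / \<epsilon> k) / r) \<longlonglongrightarrow> (0 + 0) / r"
        using r(1) by (intro tendsto_intros h assms(8)) auto
      then have "\<forall>\<^sub>F k in sequentially. (h k + h k / \<epsilon> k) / r < \<delta>"
        using \<delta> by (intro order_tendstoD(2)) auto
      moreover have "\<forall>\<^sub>F k in sequentially. h k < 1" using h(2) by (rule order_tendstoD) simp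
      moreover have "\<forall>\<^sub>F k in sequentially. h k / \<epsilon> k < 1" using assms(8) by (rule order_tendstoD) simp
      ultimately have "\<forall>\<^sub>F k in sequentially. norm (?E k - 0) < e"
      proof eventually_elim
        case (elim k)
        have "h k \<le> \<epsilon> k" using elim(3) \<epsilon>[of k] by (simp add: field_simps)
        then have "norm (?E k) \<le> Q * (\<delta> + (h k + h k / \<epsilon> k) / r) * (grid_norm (h k) (U k))\<^sup>2"
          using elim(2) \<delta> r by (intro Q(2) h U) auto
        also have "\<dots> \<le> Q * (\<delta> + \<delta>) * D\<^sup>2"
        proof (intro mult_mono power_mono)
          show "0 \<le> grid_norm (h k) (U k)"
            unfolding grid_norm_def using h(1)[of k] by (intro real_sqrt_ge_zero mult_nonneg_nonneg infsum_nonneg) auto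
          show "0 \<le> \<delta> + (h k + h k / \<epsilon> k) / r"
            using \<delta> r(1) h(1)[of k] \<epsilon>[of k] by (intro add_nonneg_nonneg divide_nonneg_nonneg) auto
        qed (use elim(1) Q(1) D \<delta> in auto)
        also have "\<dots> = (Q * D\<^sup>2) * (2 * \<delta>)" by simp
        also have "\<dots> < (Q * D\<^sup>2 + 1) * (2 * \<delta>)" using \<delta> by (intro mult_strict_right_mono) auto
        also have "\<dots> = e"
        proof -
          have *: "x * (2 * (e / (2 * x))) = e" if "x > 0" for x :: real using that by simp
          show ?thesis unfolding \<delta>_def by (rule *) (use QD in linarith)
        qed
        finally show ?case by simp
      qed
      then show "\<exists>no. \<forall>n\<ge>no. norm (?E n - 0) < e" by (simp add: eventually_sequentially)
    qed
    from tendsto_add[OF this tendsto_mult[OF tendsto_const[of "complex_of_real ?c"] lim[OF a]]]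
    show ?thesis by simp
  qed
  then show ?thesis
    unfolding converges_to_measure_def using int
    by (auto intro!: radon_measure_scale radon integrable_scale_measure simp: integral_scale_measure simp del: of_real_power)
qed

end
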